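(* Let $\psi$ and $\varphi$ be Bernstein functions such that $J[e^{-t\varphi},\psi]<\infty$ for every $t>0$. Let $-A$ be the generator of a bounded $C_0$-semigroup $(e^{-tA})_{t\ge0}$ on a Banach space $X$ satisfying the Yosida condition $Y(c_0,c_1)$. Then for every $t>0$, $$\|\psi(A)e^{-t\varphi(A)}\|\le \psi(0)\,\|e^{-t\varphi(A)}\|+2\max(2M(A),c_1)\,J[e^{-t\varphi},\psi]+4M(A)\,e^{-t\varphi(0)}\,C[c_0;\psi].$$
   Context: A positive (meaning $\ge 0$) function $g\in C^\infty(0,\infty)$ is completely monotone if $(-1)^n g^{(n)}(\tau)\ge 0$ for all $\tau>0$, $n\in\mathbb{N}$. A positive $\psi\in C^\infty(0,\infty)$ is a Bernstein function if $\psi'$ is completely monotone; equivalently there are unique $a,b\ge 0$ and a positive Radon measure $\gamma$ on $(0,\infty)$ with $\int_{0+}^\infty \frac{s}{1+s}\,\gamma(ds)<\infty$ such that $\psi(\tau)=a+b\tau+\int_{0+}^\infty(1-e^{-s\tau})\,\gamma(ds)$, $\tau>0$. We write $\psi(0)=\psi(0+)=a$. $J[e^{-t\varphi},\psi]:=\int_0^\infty e^{-t\varphi(s)}\psi'(s)\,ds\in[0,\infty]$. $C[c_0;\psi]:=\int_0^\infty e^{-s/c_0}\psi'(s)\,ds$ for $c_0>0$, and $C[0;\psi]:=0$. Let $-A$ generate a bounded $C_0$-semigroup $(e^{-tA})_{t\ge0}$ on $X$. If $f$ is the Laplace transform of a bounded Radon measure $\mu$ on $[0,\infty)$, then $f(A)x:=\int_0^\infty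 e^{-sA}x\,\mu(ds)$. For a Bernstein function $\psi$ the function $\psi(z)/(1+z)$ is such a Laplace transform and $\psi(A):=(1+A)[\psi(z)(1+z)^{-1}](A)$, a closed operator; equivalently, $\psi(A)$ is the closure of $x\mapsto ax+bAx+\int_{0+}^\infty(1-e^{-sA})x\,\gamma(ds)$ defined on $\mathrm{dom}(A)$. For a Bernstein function $\varphi$ the operator $-\varphi(A)$ generates a bounded $C_0$-semigroup $e^{-t\varphi(A)}=\int_0^\infty e^{-sA}\mu_t(ds)$, where $(\mu_t)_{t\ge0}$ is the vaguely continuous convolution semigroup of subprobability measures on $[0,\infty)$ with $\int_0^\infty e^{-s\tau}\mu_t(ds)=e^{-t\varphi(\tau)}$, $\tau>0$. $M(A):=\sup_{t\ge0}\|e^{-tA}\|$. A bounded $C_0$-semigroup $(e^{-tA})_{t\ge0}$ satisfies the Yosida condition $Y(c_0,c_1)$, where $c_0\ge0$, $c_1>0$, if $e^{-tA}(X)\subset\mathrm{dom}(A)$ for all $t>0$ and $\|Ae^{-tA}\|\le c_0+c_1/t$ for all $t>0$. Writing $\|\psi(A)e^{-t\varphi(A)}\|\le\dots$ includes the assertion that $\psi(A)e^{-t\varphi(A)}$ is a bounded operator defined on all of $X$. *)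

theory Defs
  imports "HOL-Analysis.Analysis"
begin

subsection \<open>Completely monotone and Bernstein functions\<close>

text \<open>Functions on \<open>(0,\<infinity>)\<close> are total functions on the reals whose values on \<open>(-\<infinity>,0]\<close> are irrelevant.\<close>

definition smooth_pos :: "(real \<Rightarrow> real) \<Rightarrow> bool" where
  "smooth_pos g \<longleftrightarrow> (\<forall>n. \<forall>\<tau>>0. ((deriv ^^ n) g) differentiable (at \<tau>))"

definition completely_monotone :: "(real \<Rightarrow> real) \<Rightarrow> bool" where
  "completely_monotone g \<longleftrightarrow> smooth_pos g \<and> (\<forall>\<tau>>0. 0 \<le> g \<tau>) \<and>
     (\<forall>n. \<forall>\<tau>>0. 0 \<le> (-1) ^ n * (deriv ^^ n) g \<tau>)"

definition bernstein :: "(real \<Rightarrow> real) \<Rightarrow> bool" where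
  "bernstein \<psi> \<longleftrightarrow> smooth_pos \<psi> \<and> (\<forall>\<tau>>0. 0 \<le> \<psi> \<tau>) \<and> completely_monotone (deriv \<psi>)"

definition at_zero :: "(real \<Rightarrow> real) \<Rightarrow> real" where
  "at_zero \<psi> = Lim (at_right 0) \<psi>"

definition J_int :: "(real \<Rightarrow> real) \<Rightarrow> (real \<Rightarrow> real) \<Rightarrow> ennreal" where
  "J_int g \<psi> = (\<integral>\<^sup>+ s\<in>{0<..}. ennreal (g s * deriv \<psi> s) \<partial>lborel)"

definition C_int :: "real \<Rightarrow> (real \<Rightarrow> real) \<Rightarrow> ennreal" where
  "C_int c\<^sub>0 \<psi> =
     (if c\<^sub>0 = 0 then 0 else \<integral>\<^sup>+ s\<in>{0<..}. ennreal (exp (- s / c\<^sub>0) * deriv \<psi> s) \<partial>lborel)"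

subsection \<open>Bochner integral in arbitrary normed spaces\<close>

text \<open>The library's \<open>has_bochner_integral\<close> requires a second countable (separable) target space.
  This is its definition verbatim, without that sort constraint; in a non-separable space, the
  approximating simple functions are what makes the integrand strongly measurable.\<close>

definition has_bochner :: "'b measure \<Rightarrow> ('b \<Rightarrow> 'a::real_normed_vector) \<Rightarrow> 'a \<Rightarrow> bool" where
  "has_bochner M f x \<longleftrightarrow> f \<in> borel_measurable M \<and>
     (\<exists>u. (\<forall>i::nat. Bochner_Integration.simple_bochner_integrable M (u i)) \<and>
          (\<lambda>i. \<integral>\<^sup>+ s. ennreal (norm (f s - u i s)) \<partial>M) \<longlonglongrightarrow> 0 \<and>
          (\<lambda>i. Bochner_Integration.simple_bochner_integral M (u i)) \<longlonglongrightarrow> x)"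

definition bochner :: "'b measure \<Rightarrow> ('b \<Rightarrow> 'a::real_normed_vector) \<Rightarrow> 'a" where
  "bochner M f = (THE x. has_bochner M f x)"

subsection \<open>Operators and semigroups\<close>

text \<open>A possibly unbounded, not everywhere defined operator is identified with its graph. The
  product \<open>P Q\<close> on its natural domain is then the relation composition \<open>Q O P\<close>.\<close>

type_synonym 'a operator = "('a \<times> 'a) set"

definition bop :: "('a::real_normed_vector \<Rightarrow>\<^sub>L 'a) \<Rightarrow> 'a operator" where
  "bop B = {(x, blinfun_apply B x) | x. True}"

definition bounded_C0_semigroup :: "(real \<Rightarrow> ('a::real_normed_vector \<Rightarrow>\<^sub>L 'a)) \<Rightarrow> bool" where
  "bounded_C0_semigroup T \<longleftrightarrow>
     T 0 = id_blinfun \<and>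
     (\<forall>s\<ge>0. \<forall>t\<ge>0. T (s + t) = T s o\<^sub>L T t) \<and>
     (\<forall>x. ((\<lambda>t. blinfun_apply (T t) x) \<longlongrightarrow> x) (at_right 0)) \<and>
     bounded (T ` {0..})"

definition generator :: "(real \<Rightarrow> ('a::real_normed_vector \<Rightarrow>\<^sub>L 'a)) \<Rightarrow> 'a operator" where
  "generator T = {(x, y). ((\<lambda>t. (1 / t) *\<^sub>R (blinfun_apply (T t) x - x)) \<longlongrightarrow> y) (at_right 0)}"

text \<open>The operator \<open>A\<close> such that \<open>T t = e\<^sup>-\<^sup>t\<^sup>A\<close>, that is, such that \<open>-A\<close> generates \<open>T\<close>.\<close>

definition neg_generator :: "(real \<Rightarrow> ('a::real_normed_vector \<Rightarrow>\<^sub>L 'a)) \<Rightarrow> 'a operator" where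
  "neg_generator T = {(x, - y) | x y. (x, y) \<in> generator T}"

definition sup_norm :: "(real \<Rightarrow> ('a::real_normed_vector \<Rightarrow>\<^sub>L 'a)) \<Rightarrow> real" where
  "sup_norm T = (SUP t\<in>{0..}. norm (T t))"

definition yosida :: "(real \<Rightarrow> ('a::real_normed_vector \<Rightarrow>\<^sub>L 'a)) \<Rightarrow> real \<Rightarrow> real \<Rightarrow> bool" where
  "yosida T c\<^sub>0 c\<^sub>1 \<longleftrightarrow>
     (\<forall>t>0. range (blinfun_apply (T t)) \<subseteq> Domain (neg_generator T)) \<and>
     (\<forall>t>0. \<exists>B. bop (T t) O neg_generator T = bop B \<and> norm B \<le> c\<^sub>0 + c\<^sub>1 / t)"

subsection \<open>Functional calculus\<close>

text \<open>Bounded positive Radon measures on \<open>[0,\<infinity>)\<close>: finite Borel measures there are Radon.\<close>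

definition halfline_measure :: "real measure \<Rightarrow> bool" where
  "halfline_measure \<mu> \<longleftrightarrow> finite_measure \<mu> \<and> sets \<mu> = sets (restrict_space borel {0..})"

definition laplace :: "real measure \<Rightarrow> real \<Rightarrow> real" where
  "laplace \<mu> \<tau> = (\<integral>s. exp (- (s * \<tau>)) \<partial>\<mu>)"

definition average :: "(real \<Rightarrow> ('a::real_normed_vector \<Rightarrow>\<^sub>L 'a)) \<Rightarrow> real measure \<Rightarrow> ('a \<Rightarrow>\<^sub>L 'a)" where
  "average T \<mu> = Blinfun (\<lambda>x. bochner \<mu> (\<lambda>s. blinfun_apply (T s) x))"

text \<open>The measure representing \<open>\<psi>(z)/(1+z)\<close> is in general signed, so it is written as a difference
  of two positive ones. The choice of the pair is immaterial, since the Laplace transform on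
  \<open>(0,\<infinity>)\<close> determines the signed measure.\<close>

definition laplace_pair :: "(real \<Rightarrow> real) \<Rightarrow> real measure \<times> real measure \<Rightarrow> bool" where
  "laplace_pair f = (\<lambda>(\<mu>, \<nu>). halfline_measure \<mu> \<and> halfline_measure \<nu> \<and>
     (\<forall>\<tau>>0. f \<tau> = laplace \<mu> \<tau> - laplace \<nu> \<tau>))"

definition hp_calculus :: "(real \<Rightarrow> ('a::real_normed_vector \<Rightarrow>\<^sub>L 'a)) \<Rightarrow> (real \<Rightarrow> real) \<Rightarrow> ('a \<Rightarrow>\<^sub>L 'a)" where
  "hp_calculus T f = (case (SOME p. laplace_pair f p) of (\<mu>, \<nu>) \<Rightarrow> average T \<mu> - average T \<nu>)"

text \<open>\<open>\<psi>(A) = (1 + A) [\<psi>(z)/(1 + z)](A)\<close>\<close>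

definition bernstein_op :: "(real \<Rightarrow> ('a::real_normed_vector \<Rightarrow>\<^sub>L 'a)) \<Rightarrow> (real \<Rightarrow> real) \<Rightarrow> 'a operator" where
  "bernstein_op T \<psi> =
     bop (hp_calculus T (\<lambda>z. \<psi> z / (1 + z))) O {(x, x + y) | x y. (x, y) \<in> neg_generator T}"

text \<open>The subprobability measure \<open>\<mu>\<^sub>t\<close> is determined by its Laplace transform; that \<open>(\<mu>\<^sub>t)\<close> is a vaguely
  continuous convolution semigroup is a consequence.\<close>

definition subordinator :: "(real \<Rightarrow> real) \<Rightarrow> real \<Rightarrow> real measure" where
  "subordinator \<phi> t = (SOME \<mu>. halfline_measure \<mu> \<and> emeasure \<mu> (space \<mu>) \<le> 1 \<and>
     (\<forall>\<tau>>0. laplace \<mu> \<tau> = exp (- t * \<phi> \<tau>)))"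

text \<open>\<open>e\<^sup>-\<^sup>t\<^sup>\<phi>\<^sup>(\<^sup>A\<^sup>)\<close>\<close>

definition subordinate ::
    "(real \<Rightarrow> ('a::real_normed_vector \<Rightarrow>\<^sub>L 'a)) \<Rightarrow> (real \<Rightarrow> real) \<Rightarrow> real \<Rightarrow> ('a \<Rightarrow>\<^sub>L 'a)" where
  "subordinate T \<phi> t = average T (subordinator \<phi> t)"

end

theory Submission
  imports Defs "HOL-Probability.Probability"
begin

text \<open>Write \<open>S\<close> for the operator \<open>e\<^sup>-\<^sup>t\<^sup>\<phi>\<^sup>(\<^sup>A\<^sup>)\<close>, the average of the orbits over the law \<open>\<mu>\<close> of the subordinator, and \<open>M\<close>
  for the bound of the semigroup. The operator \<open>\<psi>(A) T r\<close> is bounded for each \<open>r > 0\<close>, but its norm may blow up as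
  \<open>r\<close> tends to \<open>0\<close>; finiteness of \<open>J\<close> makes the blow-up integrable with respect to \<open>\<mu>\<close>.

  \<^bold>\<open>Representation of \<open>\<psi>\<close>.\<close> The function \<open>\<psi>(z + 1) - \<psi>(z)\<close> is completely monotone and bounded by
  \<open>\<psi>(1) - \<psi>(0)\<close>, so Bernstein's theorem makes it the Laplace transform of a finite measure \<open>\<rho>\<close>
  (\<open>increment_measure\<close>). In terms of the Levy measure and the drift of \<open>\<psi>\<close> this is
  \<open>\<rho>(du) = (1 - e\<^sup>-\<^sup>u) \<gamma>(du) + b \<delta>\<^sub>0(du)\<close>. Summing increments gives
  \<open>\<psi>(k) = \<psi>(0) + \<integral> (1 - e\<^sup>-\<^sup>u\<^sup>k) / (1 - e\<^sup>-\<^sup>u) \<rho>(du)\<close> for integers \<open>k \<ge> 1\<close>, and Fatou's lemma gives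
  \<open>\<integral> q(u) e\<^sup>-\<^sup>s\<^sup>u \<rho>(du) \<le> \<psi>'(s)\<close> with \<open>q(u) = u / (1 - e\<^sup>-\<^sup>u)\<close>. The quotients are read as \<open>k\<close> and \<open>1\<close> at \<open>u = 0\<close>.

  \<^bold>\<open>From functions to operators.\<close> A functional on bounded continuous functions \<open>F\<close> on the half-line,
  with values in a Banach space, that obeys dominated convergence is determined by its values on the exponentials
  \<open>e\<^sup>-\<^sup>k\<^sup>s x\<close>, \<open>k = 1, 2, \<dots>\<close> (\<open>dct_functional_Laplace_unique\<close>): Bernstein polynomials in the variable \<open>e\<^sup>-\<^sup>s\<close>
  approximate \<open>F\<close> pointwise and boundedly. Applied to the orbit \<open>F(s) = T s x\<close> this transfers the
  scalar identities above to the functional calculus, whatever pair of measures represents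
  \<open>\<psi>(z) / (1 + z)\<close>. With \<open>R = (1 + A)\<^sup>-\<^sup>1\<close> and \<open>H\<close> the operator assigned to \<open>\<psi>(z) / (1 + z)\<close>, the result is
  \<open>H x = \<psi>(0) R x + \<integral> (1 - T u) R x / (1 - e\<^sup>-\<^sup>u) \<rho>(du)\<close> (\<open>hp_calculus_eq\<close>), the integrand at \<open>u = 0\<close> being \<open>A R x\<close>.

  \<^bold>\<open>The estimate.\<close> By the Yosida condition and a telescoping sum,
  \<open>\<parallel>T p x - T (p + u) x\<parallel> \<le> min(2 M, u (c\<^sub>0 + c\<^sub>1 / p)) \<parallel>x\<parallel>\<close>. Elementary inequalities then bound
  \<open>(T p x - T (p + u) x) / (1 - e\<^sup>-\<^sup>u)\<close> by \<open>q(u) (4 M / (1 / c\<^sub>0 + u) + 2 max(2 M, c\<^sub>1) / (p + u)) \<parallel>x\<parallel>\<close>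
  (\<open>norm_orbit_dquot_le\<close>), the first term being \<open>0\<close> if \<open>c\<^sub>0 = 0\<close>. Writing \<open>1 / (r + u)\<close> as the integral of \<open>e\<^sup>-\<^sup>s\<^sup>(\<^sup>r\<^sup>+\<^sup>u\<^sup>)\<close> over \<open>s > 0\<close>, Tonelli's theorem and
  the inequality for \<open>\<psi>'\<close> turn the integral of the second term over \<open>\<rho>(du) \<mu>(dr)\<close> into at most a multiple of \<open>J\<close>;
  the first term contributes the multiple of \<open>C[c\<^sub>0; \<psi>]\<close>, and \<open>\<mu>\<close> has mass \<open>e\<^sup>-\<^sup>t\<^sup>\<phi>\<^sup>(\<^sup>0\<^sup>)\<close>.

  \<^bold>\<open>The operator.\<close> For \<open>\<delta> > 0\<close> put \<open>\<Psi>\<^sub>\<delta> x = \<integral> (1 - T u) T \<delta> x / (1 - e\<^sup>-\<^sup>u) \<rho>(du)\<close>, which is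
  \<open>(\<psi>(A) - \<psi>(0)) T \<delta> x\<close>. The estimate holds for all \<open>S \<Psi>\<^sub>\<delta>\<close> with the same constant, so these operators converge
  strongly to a bounded operator \<open>L\<close> as \<open>\<delta>\<close> tends to \<open>0\<close>, and the formula for \<open>H\<close> passes to the limit:
  \<open>R (\<psi>(0) S + L) = H S\<close>. Since \<open>R\<close> inverts \<open>1 + A\<close>, this equation says that \<open>\<psi>(A) S = (1 + A) H S\<close> is everywhere
  defined and equal to \<open>\<psi>(0) S + L\<close>.\<close>

section \<open>Bochner integrals of bounded continuous functions on the half-line\<close>

abbreviation "sb_int \<equiv> Bochner_Integration.simple_bochner_integral"
abbreviation "sb_ible \<equiv> Bochner_Integration.simple_bochner_integrable"

text \<open>The difference of two measurable functions need not be measurable when the target space is not separable.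
  It is when one of them takes countably many values: on each level set the difference is a translate.\<close>

lemma borel_measurable_diff_simple:
  fixes f u :: "'b \<Rightarrow> 'a::real_normed_vector"
  assumes f: "f \<in> borel_measurable M" and u: "simple_function M u"
  shows "(\<lambda>s. f s - u s) \<in> borel_measurable M"
proof (rule measurable_compose_countable'[where f="\<lambda>v s. f s - v" and g=u and I="u ` space M"])
  show "countable (u ` space M)"
    using u by (simp add: simple_function_def countable_finite)
  show "u \<in> measurable M (count_space (u ` space M))"
    using u by (auto simp: measurable_count_space_eq2 simple_function_def)
  fix v
  have "continuous_on UNIV (\<lambda>y::'a. y - v)" by (intro continuous_intros)
  then show "(\<lambda>s. f s - v) \<in> borel_measurable M"
    using measurable_compose[OF f borel_measurable_continuous_onI, of "\<lambda>y. y - v"] by simp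
qed

lemma sb_ible_simple: "sb_ible M u \<Longrightarrow> simple_function M u"
  by (auto elim: Bochner_Integration.simple_bochner_integrable.cases)

lemma nn_norm_diff_measurable:
  fixes f u :: "'b \<Rightarrow> 'a::real_normed_vector"
  assumes "f \<in> borel_measurable M" "sb_ible M u"
  shows "(\<lambda>s. ennreal (norm (f s - u s))) \<in> borel_measurable M"
  using measurable_compose[OF borel_measurable_diff_simple[OF assms(1) sb_ible_simple[OF assms(2)]] borel_measurable_norm]
  by simp

lemma norm_sb_int_le:
  assumes u: "sb_ible M u"
  shows "ennreal (norm (sb_int M u)) \<le> (\<integral>\<^sup>+ s. ennreal (norm (u s)) \<partial>M)"
proof -
  have "ennreal (norm (sb_int M u)) \<le> sb_int M (\<lambda>s. norm (u s))"
    using simple_bochner_integral_norm_bound[OF u] by (rule ennreal_leI)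
  also have "\<dots> = (\<integral>\<^sup>+ s. ennreal (norm (u s)) \<partial>M)"
    using simple_bochner_integrable_compose2[of "\<lambda>x y. norm x", OF _ u u]
    by (intro simple_bochner_integral_eq_nn_integral) auto
  finally show ?thesis .
qed

text \<open>Comparing two simple functions through \<open>f\<close> is what makes the integral independent of the approximating
  sequence and the integrals of such a sequence a Cauchy sequence.\<close>

lemma norm_sb_int_diff_le:
  assumes f: "f \<in> borel_measurable M" and u: "sb_ible M u" and v: "sb_ible M v"
  shows "ennreal (norm (sb_int M u - sb_int M v))
    \<le> (\<integral>\<^sup>+ s. ennreal (norm (f s - u s)) \<partial>M) + (\<integral>\<^sup>+ s. ennreal (norm (f s - v s)) \<partial>M)"
proof -
  have "ennreal (norm (sb_int M u - sb_int M v)) \<le> (\<integral>\<^sup>+ s. ennreal (norm (u s - v s)) \<partial>M)"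
    using norm_sb_int_le[OF simple_bochner_integrable_compose2[of "(-)", OF _ u v]]
    by (simp add: simple_bochner_integral_diff[OF u v])
  also have "\<dots> \<le> (\<integral>\<^sup>+ s. ennreal (norm (f s - u s)) + ennreal (norm (f s - v s)) \<partial>M)"
  proof (intro nn_integral_mono)
    fix s
    have "norm (u s - v s) \<le> norm (f s - u s) + norm (f s - v s)"
      using norm_triangle_ineq4[of "f s - v s" "f s - u s"] by (simp add: add.commute)
    then show "ennreal (norm (u s - v s)) \<le> ennreal (norm (f s - u s)) + ennreal (norm (f s - v s))"
      by (simp flip: ennreal_plus)
  qed
  also have "\<dots> = (\<integral>\<^sup>+ s. ennreal (norm (f s - u s)) \<partial>M) + (\<integral>\<^sup>+ s. ennreal (norm (f s - v s)) \<partial>M)"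
    by (intro nn_integral_add nn_norm_diff_measurable assms)
  finally show ?thesis .
qed

lemma ennreal_tendsto_0_le:
  fixes f g :: "nat \<Rightarrow> ennreal"
  assumes "\<And>i. f i \<le> g i" "g \<longlonglongrightarrow> 0"
  shows "f \<longlonglongrightarrow> 0"
  by (rule tendsto_sandwich[OF _ _ tendsto_const assms(2)]) (simp_all add: assms(1))

lemma has_bochner_unique:
  assumes "has_bochner M f x" "has_bochner M f y"
  shows "x = y"
proof -
  from assms obtain u v where f: "f \<in> borel_measurable M"
    and u: "\<And>i::nat. sb_ible M (u i)" "(\<lambda>i. \<integral>\<^sup>+ s. ennreal (norm (f s - u i s)) \<partial>M) \<longlonglongrightarrow> 0"
      "(\<lambda>i. sb_int M (u i)) \<longlonglongrightarrow> x"
    and v: "\<And>i::nat. sb_ible M (v i)" "(\<lambda>i. \<integral>\<^sup>+ s. ennreal (norm (f s - v i s)) \<partial>M) \<longlonglongrightarrow> 0"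
      "(\<lambda>i. sb_int M (v i)) \<longlonglongrightarrow> y"
    unfolding has_bochner_def by blast
  have "(\<lambda>i. ennreal (norm (sb_int M (u i) - sb_int M (v i)))) \<longlonglongrightarrow> 0"
    by (rule ennreal_tendsto_0_le[OF norm_sb_int_diff_le[OF f u(1) v(1)]])
       (use tendsto_add[OF u(2) v(2)] in simp)
  moreover have "(\<lambda>i. ennreal (norm (sb_int M (u i) - sb_int M (v i)))) \<longlonglongrightarrow> ennreal (norm (x - y))"
    by (intro tendsto_intros u v)
  ultimately have "ennreal (norm (x - y)) = 0"
    using LIMSEQ_unique by blast
  then show ?thesis by simp
qed

lemma bochner_eqI: "has_bochner M f x \<Longrightarrow> bochner M f = x"
  unfolding bochner_def by (blast intro: has_bochner_unique)

lemma has_bochner_norm_le: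
  assumes "has_bochner M f x"
  shows "ennreal (norm x) \<le> (\<integral>\<^sup>+ s. ennreal (norm (f s)) \<partial>M)"
proof -
  from assms obtain u where f: "f \<in> borel_measurable M"
    and u: "\<And>i::nat. sb_ible M (u i)" "(\<lambda>i. \<integral>\<^sup>+ s. ennreal (norm (f s - u i s)) \<partial>M) \<longlonglongrightarrow> 0"
      "(\<lambda>i. sb_int M (u i)) \<longlonglongrightarrow> x"
    unfolding has_bochner_def by blast
  have f': "(\<lambda>s. ennreal (norm (f s))) \<in> borel_measurable M" using f by measurable
  have "ennreal (norm (sb_int M (u i))) \<le>
      (\<integral>\<^sup>+ s. ennreal (norm (f s)) \<partial>M) + (\<integral>\<^sup>+ s. ennreal (norm (f s - u i s)) \<partial>M)" for i
  proof -
    have "ennreal (norm (sb_int M (u i))) \<le> (\<integral>\<^sup>+ s. ennreal (norm (u i s)) \<partial>M)"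
      by (rule norm_sb_int_le[OF u(1)])
    also have "\<dots> \<le> (\<integral>\<^sup>+ s. ennreal (norm (f s)) + ennreal (norm (f s - u i s)) \<partial>M)"
      by (intro nn_integral_mono)
         (metis ennreal_leI ennreal_plus norm_ge_zero norm_triangle_sub norm_minus_commute)
    also have "\<dots> = (\<integral>\<^sup>+ s. ennreal (norm (f s)) \<partial>M) + (\<integral>\<^sup>+ s. ennreal (norm (f s - u i s)) \<partial>M)"
      by (intro nn_integral_add nn_norm_diff_measurable f f' u)
    finally show ?thesis .
  qed
  moreover have "(\<lambda>i. ennreal (norm (sb_int M (u i)))) \<longlonglongrightarrow> ennreal (norm x)"
    by (intro tendsto_intros u)
  moreover have "(\<lambda>i. (\<integral>\<^sup>+ s. ennreal (norm (f s)) \<partial>M) + (\<integral>\<^sup>+ s. ennreal (norm (f s - u i s)) \<partial>M))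
      \<longlonglongrightarrow> (\<integral>\<^sup>+ s. ennreal (norm (f s)) \<partial>M) + 0"
    by (intro tendsto_add tendsto_const u)
  ultimately have "ennreal (norm x) \<le> (\<integral>\<^sup>+ s. ennreal (norm (f s)) \<partial>M) + 0"
    using LIMSEQ_le[of "\<lambda>i. ennreal (norm (sb_int M (u i)))"] by blast
  then show ?thesis by simp
qed

lemma has_bochner_add:
  assumes "has_bochner M f x" "has_bochner M g y"
    and m: "(\<lambda>s. f s + g s) \<in> borel_measurable M"
  shows "has_bochner M (\<lambda>s. f s + g s) (x + y)"
proof -
  from assms obtain u v where f: "f \<in> borel_measurable M" and g: "g \<in> borel_measurable M"
    and u: "\<And>i::nat. sb_ible M (u i)" "(\<lambda>i. \<integral>\<^sup>+ s. ennreal (norm (f s - u i s)) \<partial>M) \<longlonglongrightarrow> 0"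
      "(\<lambda>i. sb_int M (u i)) \<longlonglongrightarrow> x"
    and v: "\<And>i::nat. sb_ible M (v i)" "(\<lambda>i. \<integral>\<^sup>+ s. ennreal (norm (g s - v i s)) \<partial>M) \<longlonglongrightarrow> 0"
      "(\<lambda>i. sb_int M (v i)) \<longlonglongrightarrow> y"
    unfolding has_bochner_def by blast
  have "(\<integral>\<^sup>+ s. ennreal (norm (f s + g s - (u i s + v i s))) \<partial>M)
      \<le> (\<integral>\<^sup>+ s. ennreal (norm (f s - u i s)) \<partial>M) + (\<integral>\<^sup>+ s. ennreal (norm (g s - v i s)) \<partial>M)" for i
  proof -
    have "(\<integral>\<^sup>+ s. ennreal (norm (f s + g s - (u i s + v i s))) \<partial>M)
       \<le> (\<integral>\<^sup>+ s. ennreal (norm (f s - u i s)) + ennreal (norm (g s - v i s)) \<partial>M)"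
      by (intro nn_integral_mono)
         (simp flip: ennreal_plus add: norm_diff_triangle_ineq)
    also have "\<dots> = (\<integral>\<^sup>+ s. ennreal (norm (f s - u i s)) \<partial>M) + (\<integral>\<^sup>+ s. ennreal (norm (g s - v i s)) \<partial>M)"
      by (intro nn_integral_add nn_norm_diff_measurable f g u v)
    finally show ?thesis .
  qed
  then have "(\<lambda>i. \<integral>\<^sup>+ s. ennreal (norm (f s + g s - (u i s + v i s))) \<partial>M) \<longlonglongrightarrow> 0"
    by (rule ennreal_tendsto_0_le) (use tendsto_add[OF u(2) v(2)] in simp)
  moreover have "(\<lambda>i. sb_int M (\<lambda>s. u i s + v i s)) \<longlonglongrightarrow> x + y"
    using tendsto_add[OF u(3) v(3)] by (simp add: simple_bochner_integral_add[OF u(1) v(1)])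
  moreover have "sb_ible M (\<lambda>s. u i s + v i s)" for i
    using simple_bochner_integrable_compose2[of "(+)", OF _ u(1) v(1)] by simp
  ultimately show ?thesis
    unfolding has_bochner_def using m by (intro conjI exI[of _ "\<lambda>i s. u i s + v i s"]) auto
qed

lemma has_bochner_bounded_linear:
  assumes L: "bounded_linear L" and "has_bochner M f x"
  shows "has_bochner M (\<lambda>s. L (f s)) (L x)"
proof -
  interpret L: bounded_linear L by fact
  from assms obtain u where f: "f \<in> borel_measurable M"
    and u: "\<And>i::nat. sb_ible M (u i)" "(\<lambda>i. \<integral>\<^sup>+ s. ennreal (norm (f s - u i s)) \<partial>M) \<longlonglongrightarrow> 0"
      "(\<lambda>i. sb_int M (u i)) \<longlonglongrightarrow> x"
    unfolding has_bochner_def by blast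
  obtain K where K: "0 \<le> K" "\<And>y. norm (L y) \<le> norm y * K"
    using L.nonneg_bounded by blast
  have "(\<integral>\<^sup>+ s. ennreal (norm (L (f s) - L (u i s))) \<partial>M)
      \<le> ennreal K * (\<integral>\<^sup>+ s. ennreal (norm (f s - u i s)) \<partial>M)" for i
  proof -
    have "(\<integral>\<^sup>+ s. ennreal (norm (L (f s) - L (u i s))) \<partial>M)
      \<le> (\<integral>\<^sup>+ s. ennreal K * ennreal (norm (f s - u i s)) \<partial>M)"
      using K(2)[of "f s - u i s" for s] K(1) by (intro nn_integral_mono)
        (metis ennreal_leI ennreal_mult L.diff mult.commute norm_ge_zero)
    also have "\<dots> = ennreal K * (\<integral>\<^sup>+ s. ennreal (norm (f s - u i s)) \<partial>M)"
      by (intro nn_integral_cmult nn_norm_diff_measurable f u)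
    finally show ?thesis .
  qed
  moreover have "(\<lambda>i. ennreal K * (\<integral>\<^sup>+ s. ennreal (norm (f s - u i s)) \<partial>M)) \<longlonglongrightarrow> 0"
    using ennreal_tendsto_cmult[OF _ u(2), of "ennreal K"] by simp
  ultimately have "(\<lambda>i. \<integral>\<^sup>+ s. ennreal (norm (L (f s) - L (u i s))) \<partial>M) \<longlonglongrightarrow> 0"
    by (rule ennreal_tendsto_0_le)
  moreover have "(\<lambda>i. sb_int M (\<lambda>s. L (u i s))) \<longlonglongrightarrow> L x"
    using L.tendsto[OF u(3)] by (simp add: simple_bochner_integral_linear[OF L.linear u(1)])
  moreover have "sb_ible M (\<lambda>s. L (u i s))" for i
    using simple_bochner_integrable_compose2[of "\<lambda>x y. L x", OF _ u(1) u(1)] by (simp add: L.zero)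
  moreover have "(\<lambda>s. L (f s)) \<in> borel_measurable M"
    using measurable_compose[OF f borel_measurable_continuous_onI[of L]]
    by (simp add: L.continuous_on continuous_on_id)
  ultimately show ?thesis
    unfolding has_bochner_def by (intro conjI exI[of _ "\<lambda>i s. L (u i s)"]) auto
qed

lemma has_bochner_real:
  fixes f :: "'b \<Rightarrow> real"
  assumes "integrable M f"
  shows "has_bochner M f (integral\<^sup>L M f)"
  using has_bochner_integral_integrable[OF assms]
  by (auto simp: has_bochner_def elim!: has_bochner_integral.cases)

text \<open>All integrands are of this kind. Values at negative arguments are irrelevant, since the measures
  live on \<open>[0, \<infinity>)\<close>.\<close>

definition Cb :: "(real \<Rightarrow> 'a::real_normed_vector) set" where
  "Cb = {F. continuous_on {0..} F \<and> bounded (F ` {0..})}"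

lemma CbI:
  assumes "continuous_on {0..} F" "\<And>s. s \<ge> 0 \<Longrightarrow> norm (F s) \<le> C"
  shows "F \<in> Cb"
  using assms by (auto simp: Cb_def bounded_iff)

lemma Cb_bound:
  assumes "F \<in> Cb"
  obtains C where "C \<ge> 0" "\<And>s. s \<ge> 0 \<Longrightarrow> norm (F s) \<le> C"
proof -
  from assms obtain C where "\<forall>s\<ge>0. norm (F s) \<le> C" by (auto simp: Cb_def bounded_iff)
  then show thesis using that[of "max C 0"] by fastforce
qed

lemma halfline_space: "halfline_measure \<mu> \<Longrightarrow> space \<mu> = {0..}"
  by (simp add: halfline_measure_def sets_eq_imp_space_eq[of \<mu> "restrict_space borel {0..}"] space_restrict_space)

lemma halfline_measurable:
  assumes "halfline_measure \<mu>" "continuous_on {0..} F"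
  shows "F \<in> borel_measurable \<mu>"
  using borel_measurable_continuous_on_restrict[OF assms(2)] assms(1)
  by (simp add: halfline_measure_def cong: measurable_cong_sets)

lemma halfline_measurable_Cb:
  assumes "halfline_measure \<mu>" "F \<in> Cb"
  shows "F \<in> borel_measurable \<mu>"
  using assms halfline_measurable by (auto simp: Cb_def)

lemma sb_ible_finite:
  assumes "finite_measure M" "simple_function M u"
  shows "sb_ible M u"
  by (rule Bochner_Integration.simple_bochner_integrable.intros[OF assms(2)])
     (simp add: finite_measure.emeasure_finite[OF assms(1)])

text \<open>Sampling \<open>F\<close> on finer and finer grids gives simple functions that converge boundedly to \<open>F\<close>; dominated
  convergence for the real functions \<open>\<parallel>F - u\<^sub>i\<parallel>\<close> then yields the integral.\<close>

lemma has_bochner_Cb_ex: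
  fixes F :: "real \<Rightarrow> 'a::banach"
  assumes \<mu>: "halfline_measure \<mu>" and F: "F \<in> Cb"
  shows "\<exists>x. has_bochner \<mu> F x"
proof -
  interpret finite_measure \<mu> using \<mu> by (simp add: halfline_measure_def)
  have sp: "space \<mu> = {0..}" by (rule halfline_space[OF \<mu>])
  have mF: "F \<in> borel_measurable \<mu>" by (rule halfline_measurable_Cb[OF \<mu> F])
  obtain C where C: "C \<ge> 0" "\<And>s. s \<ge> 0 \<Longrightarrow> norm (F s) \<le> C" using Cb_bound[OF F] by blast
  \<comment> \<open>Round down to a multiple of \<open>1 / (i + 1)\<close>; the cap leaves finitely many grid points.\<close>
  define g :: "nat \<Rightarrow> real \<Rightarrow> int" where "g i s = min \<lfloor>s * real (Suc i)\<rfloor> (int (Suc i * Suc i))" for i s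
  define p where "p i s = real_of_int (g i s) / real (Suc i)" for i s
  define u where "u i s = F (p i s)" for i s
  have p0: "p i s \<ge> 0" if "s \<ge> 0" for i s using that by (auto simp: p_def g_def)
  have simple: "simple_function \<mu> (u i)" for i
  proof -
    have "g i ` {0..} \<subseteq> {0..int (Suc i * Suc i)}" by (auto simp: g_def)
    then have "finite (g i ` space \<mu>)" unfolding sp by (rule finite_subset) simp
    moreover have "g i \<in> measurable \<mu> (count_space UNIV)"
    proof -
      have "(\<lambda>s. s) \<in> borel_measurable \<mu>"
        by (rule halfline_measurable[OF \<mu>]) (intro continuous_intros)
      then show ?thesis unfolding g_def by measurable
    qed
    ultimately have "simple_function \<mu> (g i)"
      by (auto simp: simple_function_def measurable_count_space_eq2_countable)
    from simple_function_compose1[OF this, of "\<lambda>k. F (real_of_int k / real (Suc i))"]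
    show ?thesis by (simp add: u_def[abs_def] p_def)
  qed
  have ptend: "(\<lambda>i. p i s) \<longlonglongrightarrow> s" if "s \<ge> 0" for s
  proof (rule tendsto_sandwich[of "\<lambda>i. s - 1 / real (Suc i)" _ _ "\<lambda>i. s"])
    show "eventually (\<lambda>i. s - 1 / real (Suc i) \<le> p i s) sequentially"
      using eventually_ge_at_top[of "nat \<lceil>s\<rceil>"]
    proof eventually_elim
      fix i assume "nat \<lceil>s\<rceil> \<le> i"
      then have "s \<le> real (Suc i)" by linarith
      then have "s * real (Suc i) \<le> real (Suc i) * real (Suc i)"
        by (intro mult_right_mono) auto
      then have "\<lfloor>s * real (Suc i)\<rfloor> \<le> int (Suc i * Suc i)"
        by (metis floor_mono floor_of_nat of_nat_mult)
      then have "g i s = \<lfloor>s * real (Suc i)\<rfloor>" by (simp add: g_def)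
      then have "s * real (Suc i) - 1 \<le> real_of_int (g i s)" by linarith
      then have "(s * real (Suc i) - 1) / real (Suc i) \<le> p i s"
        unfolding p_def by (intro divide_right_mono) auto
      then show "s - 1 / real (Suc i) \<le> p i s" by (simp add: diff_divide_distrib)
    qed
    show "eventually (\<lambda>i. p i s \<le> s) sequentially"
    proof (rule always_eventually, rule allI)
      fix i
      have "real_of_int (g i s) \<le> s * real (Suc i)" unfolding g_def by linarith
      then show "p i s \<le> s" by (simp add: p_def divide_le_eq)
    qed
    show "(\<lambda>i. s - 1 / real (Suc i)) \<longlonglongrightarrow> s"
      using tendsto_diff[OF tendsto_const LIMSEQ_inverse_real_of_nat, of s] by (simp add: inverse_eq_divide)
  qed simp
  have utend: "(\<lambda>i. u i s) \<longlonglongrightarrow> F s" if s: "s \<ge> 0" for s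
    unfolding u_def using F s p0
    by (intro continuous_on_tendsto_compose[OF _ ptend]) (auto simp: Cb_def)
  have "(\<lambda>i. \<integral>\<^sup>+ s. ennreal (norm (F s - u i s)) \<partial>\<mu>) \<longlonglongrightarrow> (\<integral>\<^sup>+ s. 0 \<partial>\<mu>)"
  proof (rule nn_integral_dominated_convergence[where w="\<lambda>_. ennreal (2 * C)"])
    show "(\<lambda>s. ennreal (norm (F s - u i s))) \<in> borel_measurable \<mu>" for i
      by (intro nn_norm_diff_measurable mF sb_ible_finite simple finite_measure_axioms)
    show "AE s in \<mu>. ennreal (norm (F s - u i s)) \<le> ennreal (2 * C)" for i
    proof (intro AE_I2 ennreal_leI)
      fix s assume "s \<in> space \<mu>"
      then have "s \<ge> 0" by (simp add: sp)
      then show "norm (F s - u i s) \<le> 2 * C"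
        using C(2)[of s] C(2)[OF p0[of s i]] norm_triangle_ineq4[of "F s" "u i s"] by (simp add: u_def)
    qed
    show "(\<integral>\<^sup>+ s. ennreal (2 * C) \<partial>\<mu>) < \<infinity>"
      by (simp add: emeasure_eq_measure ennreal_mult_less_top)
    show "AE s in \<mu>. (\<lambda>i. ennreal (norm (F s - u i s))) \<longlonglongrightarrow> 0"
    proof (rule AE_I2)
      fix s assume "s \<in> space \<mu>"
      then have "(\<lambda>i. ennreal (norm (F s - u i s))) \<longlonglongrightarrow> ennreal (norm (F s - F s))"
        by (intro tendsto_intros utend) (simp add: sp)
      then show "(\<lambda>i. ennreal (norm (F s - u i s))) \<longlonglongrightarrow> 0" by simp
    qed
  qed auto
  then have lim: "(\<lambda>i. \<integral>\<^sup>+ s. ennreal (norm (F s - u i s)) \<partial>\<mu>) \<longlonglongrightarrow> 0" by simp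
  have ible: "sb_ible \<mu> (u i)" for i by (intro sb_ible_finite simple finite_measure_axioms)
  have "Cauchy (\<lambda>i. sb_int \<mu> (u i))"
  proof (rule metric_CauchyI)
    fix e :: real assume e: "e > 0"
    have "eventually (\<lambda>i. (\<integral>\<^sup>+ s. ennreal (norm (F s - u i s)) \<partial>\<mu>) < ennreal (e / 2)) sequentially"
      using e by (intro order_tendstoD[OF lim]) auto
    then obtain N where N: "\<And>i. i \<ge> N \<Longrightarrow> (\<integral>\<^sup>+ s. ennreal (norm (F s - u i s)) \<partial>\<mu>) < ennreal (e / 2)"
      by (auto simp: eventually_sequentially)
    show "\<exists>N. \<forall>m\<ge>N. \<forall>n\<ge>N. dist (sb_int \<mu> (u m)) (sb_int \<mu> (u n)) < e"
    proof (intro exI allI impI)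
      fix m n assume "m \<ge> N" "n \<ge> N"
      have "ennreal (norm (sb_int \<mu> (u m) - sb_int \<mu> (u n))) < ennreal (e / 2) + ennreal (e / 2)"
        using norm_sb_int_diff_le[OF mF ible ible, of m n] add_strict_mono[OF N[OF \<open>m \<ge> N\<close>] N[OF \<open>n \<ge> N\<close>]]
        by (rule order_le_less_trans)
      also have "\<dots> = ennreal e" using e by (simp flip: ennreal_plus)
      finally show "dist (sb_int \<mu> (u m)) (sb_int \<mu> (u n)) < e"
        using e by (simp add: dist_norm ennreal_less_iff)
    qed
  qed
  then obtain x where "(\<lambda>i. sb_int \<mu> (u i)) \<longlonglongrightarrow> x" using Cauchy_convergent convergent_def by blast
  then show ?thesis unfolding has_bochner_def using mF ible lim by blast
qed

lemma has_bochner_Cb: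
  fixes F :: "real \<Rightarrow> 'a::banach"
  assumes "halfline_measure \<mu>" "F \<in> Cb"
  shows "has_bochner \<mu> F (bochner \<mu> F)"
  using has_bochner_Cb_ex[OF assms] bochner_eqI by fastforce

lemma Cb_add: "F \<in> Cb \<Longrightarrow> G \<in> Cb \<Longrightarrow> (\<lambda>s. F s + G s) \<in> Cb"
  by (auto simp: Cb_def bounded_plus_comp intro!: continuous_intros)

lemma Cb_bounded_linear: "bounded_linear L \<Longrightarrow> F \<in> Cb \<Longrightarrow> (\<lambda>s. L (F s)) \<in> Cb"
proof -
  assume L: "bounded_linear L" and F: "F \<in> Cb"
  have "bounded (L ` F ` {0..})" using F bounded_linear_image[OF _ L, of "F ` {0..}"] by (simp add: Cb_def)
  moreover have "continuous_on {0..} (\<lambda>s. L (F s))"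
    using F by (intro bounded_linear.continuous_on[OF L]) (simp add: Cb_def)
  ultimately show ?thesis by (simp add: Cb_def image_image)
qed

lemma Cb_scaleR: "F \<in> Cb \<Longrightarrow> (\<lambda>s. c *\<^sub>R F s) \<in> Cb"
  by (rule Cb_bounded_linear[OF bounded_linear_scaleR_right])

lemma Cb_diff: "F \<in> Cb \<Longrightarrow> G \<in> Cb \<Longrightarrow> (\<lambda>s. F s - G s) \<in> Cb"
  using Cb_add[OF _ Cb_scaleR[of G "-1"]] by simp

lemma Cb_const: "(\<lambda>s. c) \<in> Cb"
  by (rule CbI[of _ "norm c"]) (auto intro: continuous_intros)

lemma Cb_sum: "(\<And>i. i \<in> I \<Longrightarrow> F i \<in> Cb) \<Longrightarrow> (\<lambda>s. \<Sum>i\<in>I. F i s) \<in> Cb"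
  by (induction I rule: infinite_finite_induct) (simp_all add: Cb_add Cb_const)

lemma Cb_shift: "F \<in> Cb \<Longrightarrow> h \<ge> 0 \<Longrightarrow> (\<lambda>s. F (s + h)) \<in> Cb"
  by (force simp: Cb_def bounded_iff intro!: continuous_on_compose2[of "{0..}" F] continuous_intros)

context
  fixes \<mu> assumes \<mu>: "halfline_measure \<mu>"
begin

lemma bochner_add:
  fixes F G :: "real \<Rightarrow> 'a::banach"
  assumes "F \<in> Cb" "G \<in> Cb"
  shows "bochner \<mu> (\<lambda>s. F s + G s) = bochner \<mu> F + bochner \<mu> G"
  by (rule bochner_eqI[OF has_bochner_add[OF has_bochner_Cb[OF \<mu> assms(1)] has_bochner_Cb[OF \<mu> assms(2)]
      halfline_measurable_Cb[OF \<mu> Cb_add[OF assms]]]])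

lemma bochner_bounded_linear:
  fixes F :: "real \<Rightarrow> 'a::banach"
  assumes "bounded_linear L" "F \<in> Cb"
  shows "bochner \<mu> (\<lambda>s. L (F s)) = L (bochner \<mu> F)"
  by (rule bochner_eqI[OF has_bochner_bounded_linear[OF assms(1) has_bochner_Cb[OF \<mu> assms(2)]]])

lemma bochner_scaleR:
  fixes F :: "real \<Rightarrow> 'a::banach"
  assumes "F \<in> Cb"
  shows "bochner \<mu> (\<lambda>s. c *\<^sub>R F s) = c *\<^sub>R bochner \<mu> F"
  using bochner_bounded_linear[OF bounded_linear_scaleR_right assms] .

lemma bochner_diff:
  fixes F G :: "real \<Rightarrow> 'a::banach"
  assumes "F \<in> Cb" "G \<in> Cb"
  shows "bochner \<mu> (\<lambda>s. F s - G s) = bochner \<mu> F - bochner \<mu> G"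
  using bochner_add[OF assms(1) Cb_scaleR[OF assms(2), of "-1"]] bochner_scaleR[OF assms(2), of "-1"] by simp

lemma norm_bochner_le:
  fixes F :: "real \<Rightarrow> 'a::banach"
  assumes "F \<in> Cb"
  shows "ennreal (norm (bochner \<mu> F)) \<le> (\<integral>\<^sup>+ s. ennreal (norm (F s)) \<partial>\<mu>)"
  by (intro has_bochner_norm_le has_bochner_Cb \<mu> assms)

lemma norm_bochner_le_measure:
  fixes F :: "real \<Rightarrow> 'a::banach"
  assumes F: "F \<in> Cb" and C: "\<And>s. s \<ge> 0 \<Longrightarrow> norm (F s) \<le> C"
  shows "norm (bochner \<mu> F) \<le> C * measure \<mu> {0..}"
proof -
  interpret finite_measure \<mu> using \<mu> by (simp add: halfline_measure_def)
  have "C \<ge> 0" using C[of 0] norm_ge_zero[of "F 0"] by linarith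
  have "ennreal (norm (bochner \<mu> F)) \<le> (\<integral>\<^sup>+ s. ennreal C \<partial>\<mu>)"
    by (rule order_trans[OF norm_bochner_le[OF F] nn_integral_mono])
       (auto simp: halfline_space[OF \<mu>] intro!: ennreal_leI C)
  also have "\<dots> = ennreal (C * measure \<mu> {0..})"
    using \<open>C \<ge> 0\<close> by (simp add: halfline_space[OF \<mu>] emeasure_eq_measure ennreal_mult)
  finally show ?thesis using \<open>C \<ge> 0\<close> by (simp add: ennreal_le_iff)
qed

lemma bochner_scaleR_left:
  fixes x :: "'a::banach" and c :: "real \<Rightarrow> real"
  assumes c: "c \<in> Cb"
  shows "bochner \<mu> (\<lambda>s. c s *\<^sub>R x) = (\<integral>s. c s \<partial>\<mu>) *\<^sub>R x"
proof -
  interpret finite_measure \<mu> using \<mu> by (simp add: halfline_measure_def)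
  obtain C where "C \<ge> 0" "\<And>s. s \<ge> 0 \<Longrightarrow> norm (c s) \<le> C" using Cb_bound[OF c] by blast
  then have "integrable \<mu> c"
    by (intro integrable_const_bound[of _ C] halfline_measurable_Cb[OF \<mu> c] AE_I2)
       (auto simp: halfline_space[OF \<mu>])
  then show ?thesis
    using bochner_eqI[OF has_bochner_bounded_linear[OF bounded_linear_scaleR_left has_bochner_real]] by blast
qed

lemma bochner_dominated_convergence:
  fixes F :: "real \<Rightarrow> 'a::banach"
  assumes Fn: "\<And>n. Fn n \<in> Cb" and F: "F \<in> Cb"
    and C: "\<And>n s. s \<ge> 0 \<Longrightarrow> norm (Fn n s) \<le> C"
    and lim: "\<And>s. s \<ge> 0 \<Longrightarrow> (\<lambda>n. Fn n s) \<longlonglongrightarrow> F s"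
  shows "(\<lambda>n. bochner \<mu> (Fn n)) \<longlonglongrightarrow> bochner \<mu> F"
proof -
  interpret finite_measure \<mu> using \<mu> by (simp add: halfline_measure_def)
  have CF: "norm (F s) \<le> C" if "s \<ge> 0" for s
    using lim[OF that] C[OF that] by (intro LIMSEQ_le_const2[OF tendsto_norm]) auto
  have "(\<lambda>n. \<integral>\<^sup>+ s. ennreal (norm (Fn n s - F s)) \<partial>\<mu>) \<longlonglongrightarrow> (\<integral>\<^sup>+ s. 0 \<partial>\<mu>)"
  proof (rule nn_integral_dominated_convergence[where w="\<lambda>_. ennreal (2 * C)"])
    show "(\<lambda>s. ennreal (norm (Fn i s - F s))) \<in> borel_measurable \<mu>" for i
      using measurable_compose[OF halfline_measurable_Cb[OF \<mu> Cb_diff[OF Fn F]] borel_measurable_norm] by simp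
    show "AE s in \<mu>. ennreal (norm (Fn i s - F s)) \<le> ennreal (2 * C)" for i
    proof (intro AE_I2 ennreal_leI)
      fix s assume "s \<in> space \<mu>"
      then have "s \<ge> 0" by (simp add: halfline_space[OF \<mu>])
      then show "norm (Fn i s - F s) \<le> 2 * C"
        using C[of s i] CF[of s] norm_triangle_ineq4[of "Fn i s" "F s"] by simp
    qed
    show "(\<integral>\<^sup>+ s. ennreal (2 * C) \<partial>\<mu>) < \<infinity>"
      by (simp add: emeasure_eq_measure ennreal_mult_less_top)
    show "AE s in \<mu>. (\<lambda>i. ennreal (norm (Fn i s - F s))) \<longlonglongrightarrow> 0"
    proof (rule AE_I2)
      fix s assume "s \<in> space \<mu>"
      then have "(\<lambda>i. ennreal (norm (Fn i s - F s))) \<longlonglongrightarrow> ennreal (norm (F s - F s))"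
        by (intro tendsto_intros lim) (simp add: halfline_space[OF \<mu>])
      then show "(\<lambda>i. ennreal (norm (Fn i s - F s))) \<longlonglongrightarrow> 0" by simp
    qed
  qed auto
  then have *: "(\<lambda>n. \<integral>\<^sup>+ s. ennreal (norm (Fn n s - F s)) \<partial>\<mu>) \<longlonglongrightarrow> 0" by simp
  have "(\<lambda>n. ennreal (norm (bochner \<mu> (Fn n) - bochner \<mu> F))) \<longlonglongrightarrow> 0"
    by (rule ennreal_tendsto_0_le[OF norm_bochner_le[OF Cb_diff[OF Fn F]], unfolded bochner_diff[OF Fn F], OF *])
  then have "(\<lambda>n. norm (bochner \<mu> (Fn n) - bochner \<mu> F)) \<longlonglongrightarrow> 0"
    by (subst (asm) ennreal_0[symmetric], subst (asm) tendsto_ennreal_iff) auto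
  then show ?thesis
    by (simp add: LIM_zero_iff tendsto_norm_zero_iff)
qed

end

section \<open>Functionals determined by their values on exponentials\<close>

text \<open>The abstract form of an integral: linearity together with dominated convergence. The class contains
  iterated integrals such as \<open>F \<mapsto> \<integral> \<Lambda>\<^sub>u F \<rho>(du)\<close>, which can thus be compared with single ones through their values on
  exponentials.\<close>

definition dct_functional :: "((real \<Rightarrow> 'a::real_normed_vector) \<Rightarrow> 'b::real_normed_vector) \<Rightarrow> bool" where
  "dct_functional \<Lambda> \<longleftrightarrow>
     (\<forall>F\<in>Cb. \<forall>G\<in>Cb. \<Lambda> (\<lambda>s. F s + G s) = \<Lambda> F + \<Lambda> G) \<and>
     (\<forall>F\<in>Cb. \<forall>c. \<Lambda> (\<lambda>s. c *\<^sub>R F s) = c *\<^sub>R \<Lambda> F) \<and>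
     (\<forall>Fn C. \<forall>F\<in>Cb. (\<forall>n::nat. Fn n \<in> Cb) \<longrightarrow> (\<forall>n. \<forall>s\<ge>0. norm (Fn n s) \<le> C) \<longrightarrow>
        (\<forall>s\<ge>0. (\<lambda>n. Fn n s) \<longlonglongrightarrow> F s) \<longrightarrow> (\<lambda>n. \<Lambda> (Fn n)) \<longlonglongrightarrow> \<Lambda> F)"

lemma dct_functional_tendsto:
  assumes "dct_functional \<Lambda>" "\<And>n. Fn n \<in> Cb" "F \<in> Cb" "\<And>n s. s \<ge> 0 \<Longrightarrow> norm (Fn n s) \<le> C"
    "\<And>s. s \<ge> 0 \<Longrightarrow> (\<lambda>n. Fn n s) \<longlonglongrightarrow> F s"
  shows "(\<lambda>n. \<Lambda> (Fn n)) \<longlonglongrightarrow> \<Lambda> F"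
  using assms(1)[unfolded dct_functional_def, THEN conjunct2, THEN conjunct2, rule_format, where Fn=Fn and C=C and F=F] assms(2-)
  by simp

lemma dct_functional_bochner:
  assumes "halfline_measure \<mu>"
  shows "dct_functional (bochner \<mu> :: (real \<Rightarrow> 'a::banach) \<Rightarrow> 'a)"
  unfolding dct_functional_def
proof (intro conjI ballI allI impI)
  show "bochner \<mu> (\<lambda>s. F s + G s) = bochner \<mu> F + bochner \<mu> G" if "F \<in> Cb" "G \<in> Cb" for F G :: "real \<Rightarrow> 'a"
    by (rule bochner_add[OF assms that])
  show "bochner \<mu> (\<lambda>s. c *\<^sub>R F s) = c *\<^sub>R bochner \<mu> F" if "F \<in> Cb" for F :: "real \<Rightarrow> 'a" and c
    by (rule bochner_scaleR[OF assms that])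
  fix Fn :: "nat \<Rightarrow> real \<Rightarrow> 'a" and C F
  assume "F \<in> Cb" "\<forall>n. Fn n \<in> Cb" "\<forall>n. \<forall>s\<ge>0. norm (Fn n s) \<le> C" "\<forall>s\<ge>0. (\<lambda>n. Fn n s) \<longlonglongrightarrow> F s"
  then show "(\<lambda>n. bochner \<mu> (Fn n)) \<longlonglongrightarrow> bochner \<mu> F"
    by (intro bochner_dominated_convergence[OF assms, where C=C]) auto
qed

text \<open>The law of large numbers: \<open>k / n\<close> is the mean of \<open>n\<close> coin tosses of bias \<open>y\<close>, and Chebyshev's inequality
  with variance \<open>y (1 - y) / n\<close> localises the sum near \<open>y\<close>. Continuity is only assumed at the point \<open>y\<close>,
  because the function used below may jump at \<open>0\<close>.\<close>

lemma Bernstein_polynomial_tendsto: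
  fixes G :: "real \<Rightarrow> 'a::real_normed_vector"
  assumes y: "0 \<le> y" "y \<le> 1" and C: "\<And>z. 0 \<le> z \<Longrightarrow> z \<le> 1 \<Longrightarrow> norm (G z) \<le> C"
    and cont: "continuous (at y within {0..1}) G"
  shows "(\<lambda>n. \<Sum>k\<le>n. Bernstein n k y *\<^sub>R G (real k / real n)) \<longlonglongrightarrow> G y"
proof (rule metric_LIMSEQ_I)
  fix e :: real assume e: "e > 0"
  have "C \<ge> 0" using C[OF y] norm_ge_zero[of "G y"] by linarith
  from cont e obtain d where d: "d > 0" "\<And>z. 0 \<le> z \<Longrightarrow> z \<le> 1 \<Longrightarrow> \<bar>z - y\<bar> < d \<Longrightarrow> norm (G z - G y) < e / 2"
    unfolding continuous_within_eps_delta
    by (metis atLeastAtMost_iff dist_norm half_gt_zero real_norm_def)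
  have bound: "norm (G z - G y) \<le> e / 2 + 2 * C / d\<^sup>2 * (z - y)\<^sup>2" if "0 \<le> z" "z \<le> 1" for z
  proof (cases "\<bar>z - y\<bar> < d")
    case True
    then show ?thesis using d(2)[OF that True] \<open>C \<ge> 0\<close> by (simp add: add_increasing2)
  next
    case False
    then have "d\<^sup>2 \<le> (z - y)\<^sup>2" using d(1) by (intro abs_le_square_iff[THEN iffD1]) auto
    then have "1 \<le> (z - y)\<^sup>2 / d\<^sup>2" using d(1) by simp
    then have "2 * C * 1 \<le> 2 * C * ((z - y)\<^sup>2 / d\<^sup>2)" using \<open>C \<ge> 0\<close> by (intro mult_left_mono) auto
    moreover have "norm (G z - G y) \<le> 2 * C"
      using norm_triangle_ineq4[of "G z" "G y"] C[OF that] C[OF y] by linarith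
    ultimately show ?thesis using e by simp
  qed
  obtain N where N: "real N > 4 * C / (d\<^sup>2 * e)" using reals_Archimedean2 by blast
  show "\<exists>N. \<forall>n\<ge>N. dist (\<Sum>k\<le>n. Bernstein n k y *\<^sub>R G (real k / real n)) (G y) < e"
  proof (intro exI allI impI)
    fix n assume "n \<ge> Suc N"
    then have n: "n > 0" "real n > 4 * C / (d\<^sup>2 * e)" using N by auto
    have var: "(\<Sum>k\<le>n. Bernstein n k y * (real k / real n - y)\<^sup>2) = y * (1 - y) / n"
    proof -
      have *: "Bernstein n k y * (real k / real n - y)\<^sup>2 =
         (real k * (real k - 1) * Bernstein n k y + (1 - 2 * n * y) * (real k * Bernstein n k y)
           + n\<^sup>2 * y\<^sup>2 * Bernstein n k y) / n\<^sup>2" for k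
        using n by (simp add: field_simps power2_eq_square)
      have "(\<Sum>k\<le>n. Bernstein n k y * (real k / real n - y)\<^sup>2) =
         (real n * (real n - 1) * y\<^sup>2 + (1 - 2 * n * y) * (n * y) + n\<^sup>2 * y\<^sup>2) / n\<^sup>2"
        unfolding * by (simp add: sum.distrib flip: sum_divide_distrib sum_distrib_left)
      also have "\<dots> = y * (1 - y) / n"
        using n by (simp add: field_simps power2_eq_square)
      finally show ?thesis .
    qed
    have "(\<Sum>k\<le>n. Bernstein n k y *\<^sub>R G (real k / real n)) - G y
        = (\<Sum>k\<le>n. Bernstein n k y *\<^sub>R (G (real k / real n) - G y))"
      by (simp add: scaleR_diff_right sum_subtractf flip: scaleR_sum_left)
    also have "norm \<dots> \<le> (\<Sum>k\<le>n. Bernstein n k y * (e / 2 + 2 * C / d\<^sup>2 * (real k / real n - y)\<^sup>2))"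
      using n y by (intro sum_norm_le) (auto simp: Bernstein_nonneg simp del: times_divide_eq_left intro!: mult_left_mono bound)
    also have "\<dots> = (\<Sum>k\<le>n. e / 2 * Bernstein n k y) + (\<Sum>k\<le>n. 2 * C / d\<^sup>2 * (Bernstein n k y * (real k / real n - y)\<^sup>2))"
      unfolding sum.distrib[symmetric] by (intro sum.cong) (auto simp: algebra_simps)
    also have "\<dots> = e / 2 + 2 * C / d\<^sup>2 * (y * (1 - y) / n)"
      unfolding sum_distrib_left[symmetric] var by simp
    also have "\<dots> < e"
    proof -
      have "y * (1 - y) \<le> 1 * 1" using y by (intro mult_mono) auto
      then have "2 * C / d\<^sup>2 * (y * (1 - y) / n) \<le> 2 * C / d\<^sup>2 * (1 / n)"
        using \<open>C \<ge> 0\<close> n by (intro mult_left_mono divide_right_mono) auto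
      also have "\<dots> < e / 2" using n e d(1) by (simp add: field_simps)
      finally show ?thesis by simp
    qed
    finally show "dist (\<Sum>k\<le>n. Bernstein n k y *\<^sub>R G (real k / real n)) (G y) < e"
      by (simp add: dist_norm)
  qed
qed

lemma Cb_exp_scaleR:
  assumes "k \<ge> 0" shows "(\<lambda>s. (exp (- (s * k)) * (1 - exp (- s)) ^ m) *\<^sub>R x) \<in> Cb"
proof (rule CbI[of _ "norm x"])
  show "continuous_on {0..} (\<lambda>s. (exp (- (s * k)) * (1 - exp (- s)) ^ m) *\<^sub>R x)"
    by (intro continuous_intros)
  fix s :: real assume s: "s \<ge> 0"
  have "exp (- (s * k)) * (1 - exp (- s)) ^ m \<le> 1 * 1"
    using s assms by (intro mult_mono power_le_one) auto
  then show "norm ((exp (- (s * k)) * (1 - exp (- s)) ^ m) *\<^sub>R x) \<le> norm x"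
    using s by (simp add: abs_mult mult_left_le_one_le)
qed

text \<open>The substitution \<open>y = e\<^sup>-\<^sup>s\<close> moves \<open>F\<close> to a bounded function \<open>G\<close> on \<open>(0, 1]\<close>. Its Bernstein polynomials are
  combinations of exponentials, are bounded by the bound of \<open>F\<close>, and converge to \<open>F\<close> at every \<open>s\<close>. Both
  functionals agree on them.\<close>

theorem dct_functional_Laplace_unique:
  fixes \<Lambda>1 \<Lambda>2 :: "(real \<Rightarrow> 'a::real_normed_vector) \<Rightarrow> 'b::real_normed_vector"
  assumes \<Lambda>1: "dct_functional \<Lambda>1" and \<Lambda>2: "dct_functional \<Lambda>2"
    and eq: "\<And>k x. k \<ge> 1 \<Longrightarrow> \<Lambda>1 (\<lambda>s. exp (- (s * real k)) *\<^sub>R x) = \<Lambda>2 (\<lambda>s. exp (- (s * real k)) *\<^sub>R x)"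
    and F: "F \<in> Cb"
  shows "\<Lambda>1 F = \<Lambda>2 F"
proof -
  define S where "S = {F \<in> Cb. \<Lambda>1 F = \<Lambda>2 F}"
  have S_add: "(\<lambda>s. F s + G s) \<in> S" if "F \<in> S" "G \<in> S" for F G
    using that \<Lambda>1 \<Lambda>2 by (auto simp: S_def dct_functional_def Cb_add)
  have S_scaleR: "(\<lambda>s. c *\<^sub>R F s) \<in> S" if "F \<in> S" for c F
    using that \<Lambda>1 \<Lambda>2 by (auto simp: S_def dct_functional_def Cb_scaleR)
  have S_sum: "(\<lambda>s. \<Sum>i\<in>I. H i s) \<in> S" if "finite I" "\<And>i. i \<in> I \<Longrightarrow> H i \<in> S" for H and I :: "nat set"
    using that
  proof (induction I rule: finite_induct)
    case empty
    have "(\<lambda>s. exp (- (s * real 1)) *\<^sub>R 0) \<in> S"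
      using Cb_exp_scaleR[of "real 1" 0 "0::'a"] eq[of 1 0] by (simp add: S_def)
    then show ?case by simp
  qed (simp add: S_add)
  have S_exp: "(\<lambda>s. (exp (- (s * real k)) * (1 - exp (- s)) ^ m) *\<^sub>R x) \<in> S" if "k \<ge> 1" for k m x
    using that
  proof (induction m arbitrary: k)
    case 0
    then show ?case using eq[of k x] Cb_exp_scaleR[of "real k" 0 x] by (simp add: S_def)
  next
    case (Suc m)
    have *: "(exp (- (s * real k)) * (1 - exp (- s)) ^ Suc m) *\<^sub>R x =
       (exp (- (s * real k)) * (1 - exp (- s)) ^ m) *\<^sub>R x +
       (-1) *\<^sub>R ((exp (- (s * real (Suc k))) * (1 - exp (- s)) ^ m) *\<^sub>R x)" for s
    proof -
      have "exp (- (s * real (Suc k))) = exp (- (s * real k)) * exp (- s)"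
        by (simp flip: exp_add add: algebra_simps)
      then show ?thesis by (simp add: algebra_simps flip: scaleR_diff_left)
    qed
    have "k \<ge> 1" "Suc k \<ge> 1" using Suc by auto
    then show ?case unfolding * by (intro S_add S_scaleR Suc.IH)
  qed
  obtain C where C: "C \<ge> 0" "\<And>s. s \<ge> 0 \<Longrightarrow> norm (F s) \<le> C" using Cb_bound[OF F] by blast
  \<comment> \<open>The value \<open>0\<close> at \<open>y = 0\<close> removes the constant term from the polynomials, so that only \<open>e\<^sup>-\<^sup>k\<^sup>s\<close> with \<open>k \<ge> 1\<close> occur.\<close>
  define G where "G y = (if y = 0 then 0 else F (- ln y))" for y
  have GC: "norm (G y) \<le> C" if "0 \<le> y" "y \<le> 1" for y
    using that C by (auto simp: G_def)
  define Fn where "Fn n s = (\<Sum>k\<le>n. Bernstein n k (exp (- s)) *\<^sub>R G (real k / real n))" for n s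
  have FnS: "Fn n \<in> S" for n
  proof -
    have "Fn n = (\<lambda>s. \<Sum>k\<in>{1..n}. real (n choose k) *\<^sub>R
       ((exp (- (s * real k)) * (1 - exp (- s)) ^ (n - k)) *\<^sub>R G (real k / real n)))"
    proof
      fix s
      have "Fn n s = (\<Sum>k\<in>{1..n}. Bernstein n k (exp (- s)) *\<^sub>R G (real k / real n))"
        unfolding Fn_def
      proof (rule sum.mono_neutral_right)
        show "\<forall>i\<in>{..n} - {1..n}. Bernstein n i (exp (- s)) *\<^sub>R G (real i / real n) = 0"
        proof
          fix i assume "i \<in> {..n} - {1..n}"
          then have "i = 0" by auto
          then show "Bernstein n i (exp (- s)) *\<^sub>R G (real i / real n) = 0" by (simp add: G_def)
        qed
      qed auto
      then show "Fn n s = (\<Sum>k\<in>{1..n}. real (n choose k) *\<^sub>R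
       ((exp (- (s * real k)) * (1 - exp (- s)) ^ (n - k)) *\<^sub>R G (real k / real n)))"
        by (simp add: Bernstein_def mult.assoc exp_of_nat_mult[symmetric] mult.commute[of s])
    qed
    then show ?thesis by (simp only:) (intro S_sum S_scaleR S_exp, auto)
  qed
  have bound: "norm (Fn n s) \<le> C" if "s \<ge> 0" for n s
  proof -
    have "norm (Fn n s) \<le> (\<Sum>k\<le>n. Bernstein n k (exp (- s)) * C)"
      unfolding Fn_def using that
      by (intro sum_norm_le) (auto simp: Bernstein_nonneg intro!: mult_left_mono GC divide_le_eq_1[THEN iffD2])
    also have "\<dots> = C" by (simp flip: sum_distrib_right)
    finally show ?thesis .
  qed
  have lim: "(\<lambda>n. Fn n s) \<longlonglongrightarrow> F s" if s: "s \<ge> 0" for s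
  proof -
    have c: "continuous_on {0..} F" using F by (simp add: Cb_def)
    have "continuous_on {0<..1::real} (\<lambda>y. - ln y)" by (intro continuous_intros) auto
    then have "continuous_on {0<..1} (\<lambda>y. F (- ln y))"
      by (rule continuous_on_compose2[OF c]) auto
    then have "continuous_on {0<..1} G"
      by (rule continuous_on_eq) (auto simp: G_def)
    then have "continuous (at (exp (- s)) within {0<..1}) G"
      using s by (simp add: continuous_on_eq_continuous_within)
    then have "continuous (at (exp (- s)) within {0..1}) G"
      unfolding continuous_within
      by (subst (asm) at_within_nhd[of _ "{0<..}" _ "{0..1}"]) auto
    from Bernstein_polynomial_tendsto[OF _ _ GC this] s
    show ?thesis by (simp add: Fn_def G_def)
  qed
  have FnCb: "Fn n \<in> Cb" for n using FnS[of n] by (simp add: S_def)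
  have "(\<lambda>n. \<Lambda>1 (Fn n)) \<longlonglongrightarrow> \<Lambda>1 F"
    by (rule dct_functional_tendsto[OF \<Lambda>1 FnCb F bound lim])
  moreover have "(\<lambda>n. \<Lambda>2 (Fn n)) \<longlonglongrightarrow> \<Lambda>2 F"
    by (rule dct_functional_tendsto[OF \<Lambda>2 FnCb F bound lim])
  moreover have "\<Lambda>1 (Fn n) = \<Lambda>2 (Fn n)" for n using FnS[of n] by (simp add: S_def)
  ultimately show ?thesis by (simp add: LIMSEQ_unique)
qed

lemma bochner_cong:
  fixes F G :: "real \<Rightarrow> 'a::banach"
  assumes \<mu>: "halfline_measure \<mu>" and F: "F \<in> Cb" and eq: "\<And>s. s \<ge> 0 \<Longrightarrow> F s = G s"
  shows "bochner \<mu> F = bochner \<mu> G"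
proof -
  have G: "G \<in> Cb"
  proof -
    obtain C where C: "\<And>s. s \<ge> 0 \<Longrightarrow> norm (F s) \<le> C" using Cb_bound[OF F] by blast
    have "continuous_on {0..} F" using F by (simp add: Cb_def)
    then have "continuous_on {0..} G" by (rule continuous_on_eq) (simp add: eq)
    then show ?thesis by (rule CbI[of _ C]) (use C eq in metis)
  qed
  have "norm (bochner \<mu> (\<lambda>s. F s - G s)) \<le> 0 * measure \<mu> {0..}"
    by (rule norm_bochner_le_measure[OF \<mu> Cb_diff[OF F G]]) (simp add: eq)
  then show ?thesis by (simp add: bochner_diff[OF \<mu> F G])
qed

lemma dct_functionalI:
  assumes "\<And>F G. F \<in> Cb \<Longrightarrow> G \<in> Cb \<Longrightarrow> \<Lambda> (\<lambda>s. F s + G s) = \<Lambda> F + \<Lambda> G"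
    and "\<And>F c. F \<in> Cb \<Longrightarrow> \<Lambda> (\<lambda>s. c *\<^sub>R F s) = c *\<^sub>R \<Lambda> F"
    and "\<And>Fn F C. (\<And>n. Fn n \<in> Cb) \<Longrightarrow> F \<in> Cb \<Longrightarrow> (\<And>n s. s \<ge> 0 \<Longrightarrow> norm (Fn n s) \<le> C) \<Longrightarrow>
      (\<And>s. s \<ge> 0 \<Longrightarrow> (\<lambda>n. Fn n s) \<longlonglongrightarrow> F s) \<Longrightarrow> (\<lambda>n. \<Lambda> (Fn n)) \<longlonglongrightarrow> \<Lambda> F"
  shows "dct_functional \<Lambda>"
  unfolding dct_functional_def
proof (intro conjI ballI allI impI)
  fix Fn :: "nat \<Rightarrow> real \<Rightarrow> 'a" and C F
  assume "F \<in> Cb" "\<forall>n. Fn n \<in> Cb" "\<forall>n. \<forall>s\<ge>0. norm (Fn n s) \<le> C" "\<forall>s\<ge>0. (\<lambda>n. Fn n s) \<longlonglongrightarrow> F s"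
  then show "(\<lambda>n. \<Lambda> (Fn n)) \<longlonglongrightarrow> \<Lambda> F" by (intro assms(3)[of Fn F C]) auto
qed (simp_all add: assms(1,2))

lemma dct_functional_plus: "dct_functional \<Lambda> \<Longrightarrow> F \<in> Cb \<Longrightarrow> G \<in> Cb \<Longrightarrow> \<Lambda> (\<lambda>s. F s + G s) = \<Lambda> F + \<Lambda> G"
  unfolding dct_functional_def by blast

lemma dct_functional_scale: "dct_functional \<Lambda> \<Longrightarrow> F \<in> Cb \<Longrightarrow> \<Lambda> (\<lambda>s. c *\<^sub>R F s) = c *\<^sub>R \<Lambda> F"
  unfolding dct_functional_def by blast

lemma dct_functional_add:
  assumes "dct_functional \<Lambda>1" "dct_functional \<Lambda>2"
  shows "dct_functional (\<lambda>F. \<Lambda>1 F + \<Lambda>2 F)"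
proof (rule dct_functionalI)
  fix Fn :: "nat \<Rightarrow> real \<Rightarrow> 'a" and F C
  assume *: "\<And>n. Fn n \<in> Cb" "F \<in> Cb" "\<And>n s. s \<ge> 0 \<Longrightarrow> norm (Fn n s) \<le> C" "\<And>s. s \<ge> 0 \<Longrightarrow> (\<lambda>n. Fn n s) \<longlonglongrightarrow> F s"
  show "(\<lambda>n. \<Lambda>1 (Fn n) + \<Lambda>2 (Fn n)) \<longlonglongrightarrow> \<Lambda>1 F + \<Lambda>2 F"
    by (rule tendsto_add[OF dct_functional_tendsto[OF assms(1) *] dct_functional_tendsto[OF assms(2) *]])
qed (simp_all add: dct_functional_plus[OF assms(1)] dct_functional_plus[OF assms(2)]
      dct_functional_scale[OF assms(1)] dct_functional_scale[OF assms(2)] scaleR_add_right)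

lemma dct_functional_scaleR:
  assumes "dct_functional \<Lambda>"
  shows "dct_functional (\<lambda>F. c *\<^sub>R \<Lambda> F)"
proof (rule dct_functionalI)
  fix Fn :: "nat \<Rightarrow> real \<Rightarrow> 'a" and F C
  assume *: "\<And>n. Fn n \<in> Cb" "F \<in> Cb" "\<And>n s. s \<ge> 0 \<Longrightarrow> norm (Fn n s) \<le> C" "\<And>s. s \<ge> 0 \<Longrightarrow> (\<lambda>n. Fn n s) \<longlonglongrightarrow> F s"
  show "(\<lambda>n. c *\<^sub>R \<Lambda> (Fn n)) \<longlonglongrightarrow> c *\<^sub>R \<Lambda> F"
    by (rule tendsto_scaleR[OF tendsto_const dct_functional_tendsto[OF assms *]])
qed (simp_all add: dct_functional_plus[OF assms] dct_functional_scale[OF assms] scaleR_add_right mult.commute)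

lemma dct_functional_diff:
  assumes "dct_functional \<Lambda>1" "dct_functional \<Lambda>2"
  shows "dct_functional (\<lambda>F. \<Lambda>1 F - \<Lambda>2 F)"
  using dct_functional_add[OF assms(1) dct_functional_scaleR[OF assms(2), of "-1"]] by simp

lemma dct_functional_shift:
  assumes "dct_functional \<Lambda>" and h: "h \<ge> 0"
  shows "dct_functional (\<lambda>F. \<Lambda> (\<lambda>s. F (s + h)))"
proof (rule dct_functionalI)
  fix Fn :: "nat \<Rightarrow> real \<Rightarrow> 'a" and F C
  assume *: "\<And>n. Fn n \<in> Cb" "F \<in> Cb" "\<And>n s. s \<ge> 0 \<Longrightarrow> norm (Fn n s) \<le> C" "\<And>s. s \<ge> 0 \<Longrightarrow> (\<lambda>n. Fn n s) \<longlonglongrightarrow> F s"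
  show "(\<lambda>n. \<Lambda> (\<lambda>s. Fn n (s + h))) \<longlonglongrightarrow> \<Lambda> (\<lambda>s. F (s + h))"
    by (rule dct_functional_tendsto[OF assms(1) Cb_shift[OF *(1) h] Cb_shift[OF *(2) h], where C=C]) (use *(3,4) h in auto)
next
  fix F G :: "real \<Rightarrow> 'a" and c assume F: "F \<in> Cb"
  show "\<Lambda> (\<lambda>s. c *\<^sub>R F (s + h)) = c *\<^sub>R \<Lambda> (\<lambda>s. F (s + h))"
    by (rule dct_functional_scale[OF assms(1) Cb_shift[OF F h]])
  assume G: "G \<in> Cb"
  show "\<Lambda> (\<lambda>s. F (s + h) + G (s + h)) = \<Lambda> (\<lambda>s. F (s + h)) + \<Lambda> (\<lambda>s. G (s + h))"
    by (rule dct_functional_plus[OF assms(1) Cb_shift[OF F h] Cb_shift[OF G h]])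
qed

lemma Cb_exp: "\<tau> \<ge> 0 \<Longrightarrow> (\<lambda>s. exp (- (s * \<tau>))) \<in> (Cb :: (real \<Rightarrow> real) set)"
  using Cb_exp_scaleR[of \<tau> 0 "1::real"] by simp

lemma dct_functional_exp_bochner:
  fixes x :: "'a::banach"
  assumes "halfline_measure \<mu>" "\<tau> \<ge> 0"
  shows "bochner \<mu> (\<lambda>s. exp (- (s * \<tau>)) *\<^sub>R x) = laplace \<mu> \<tau> *\<^sub>R x"
  unfolding laplace_def by (rule bochner_scaleR_left[OF assms(1) Cb_exp[OF assms(2)]])

section \<open>Completely monotone functions and Bernstein functions\<close>

text \<open>Complete monotonicity up to order \<open>n\<close>, phrased with some derivative \<open>-g\<close> instead of iterated \<open>deriv\<close>. In this
  form, closure under products and exponentials follows by induction on \<open>n\<close> from the product and the chain rule.\<close>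

fun cm_upto :: "nat \<Rightarrow> (real \<Rightarrow> real) \<Rightarrow> bool" where
  "cm_upto 0 f \<longleftrightarrow> (\<forall>x>0. 0 \<le> f x)"
| "cm_upto (Suc n) f \<longleftrightarrow> (\<forall>x>0. 0 \<le> f x) \<and>
     (\<exists>g. (\<forall>x>0. (f has_real_derivative - g x) (at x)) \<and> cm_upto n g)"

lemma cm_upto_nonneg: "cm_upto n f \<Longrightarrow> x > 0 \<Longrightarrow> 0 \<le> f x"
  by (cases n) auto

lemma cm_upto_SucI:
  assumes "\<And>x. x > 0 \<Longrightarrow> 0 \<le> f x" "\<And>x. x > 0 \<Longrightarrow> (f has_real_derivative - g x) (at x)" "cm_upto n g"
  shows "cm_upto (Suc n) f"
  using assms by auto

lemma cm_upto_SucE: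
  assumes "cm_upto (Suc n) f"
  obtains g where "\<And>x. x > 0 \<Longrightarrow> (f has_real_derivative - g x) (at x)" "cm_upto n g"
  using assms by auto

lemmas [simp del] = cm_upto.simps(2)

lemma DERIV_cong_pos:
  assumes "(f has_real_derivative d) (at x)" "x > 0" "\<And>x. x > 0 \<Longrightarrow> f x = g x"
  shows "(g has_real_derivative d) (at x)"
  using has_field_derivative_transform_within_open[OF assms(1), of "{0<..}" g] assms(2,3) by auto

lemma cm_upto_cong: "cm_upto n f \<Longrightarrow> (\<And>x. x > 0 \<Longrightarrow> f x = g x) \<Longrightarrow> cm_upto n g"
proof (cases n)
  case (Suc m)
  assume f: "cm_upto n f" and eq: "\<And>x. x > 0 \<Longrightarrow> f x = g x"
  from f obtain h where h: "\<And>x. x > 0 \<Longrightarrow> (f has_real_derivative - h x) (at x)" "cm_upto m h"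
    unfolding Suc by (rule cm_upto_SucE) blast
  show ?thesis unfolding Suc
  proof (rule cm_upto_SucI[OF _ _ h(2)])
    fix x :: real assume x: "x > 0"
    show "0 \<le> g x" using cm_upto_nonneg[OF f x] eq[OF x] by simp
    show "(g has_real_derivative - h x) (at x)" by (rule DERIV_cong_pos[OF h(1)[OF x] x eq])
  qed
qed simp

lemma cm_upto_Suc_imp: "cm_upto (Suc n) f \<Longrightarrow> cm_upto n f"
proof (induction n arbitrary: f)
  case (Suc n)
  from Suc.prems obtain g where g: "\<And>x. x > 0 \<Longrightarrow> (f has_real_derivative - g x) (at x)" "cm_upto (Suc n) g"
    by (rule cm_upto_SucE) blast
  show ?case by (rule cm_upto_SucI[OF cm_upto_nonneg[OF Suc.prems] g(1) Suc.IH[OF g(2)]])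
qed (simp add: cm_upto_nonneg)

lemma cm_upto_add: "cm_upto n f \<Longrightarrow> cm_upto n g \<Longrightarrow> cm_upto n (\<lambda>x. f x + g x)"
proof (induction n arbitrary: f g)
  case (Suc n)
  from Suc.prems(1) obtain f' where f': "\<And>x. x > 0 \<Longrightarrow> (f has_real_derivative - f' x) (at x)" "cm_upto n f'"
    by (rule cm_upto_SucE) blast
  from Suc.prems(2) obtain g' where g': "\<And>x. x > 0 \<Longrightarrow> (g has_real_derivative - g' x) (at x)" "cm_upto n g'"
    by (rule cm_upto_SucE) blast
  show ?case
  proof (rule cm_upto_SucI[OF _ _ Suc.IH[OF f'(2) g'(2)]])
    fix x :: real assume x: "x > 0"
    show "0 \<le> f x + g x" using cm_upto_nonneg[OF Suc.prems(1) x] cm_upto_nonneg[OF Suc.prems(2) x] by simp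
    show "((\<lambda>x. f x + g x) has_real_derivative - (f' x + g' x)) (at x)"
      using DERIV_add[OF f'(1)[OF x] g'(1)[OF x]] by simp
  qed
qed simp

lemma cm_upto_mult: "cm_upto n f \<Longrightarrow> cm_upto n g \<Longrightarrow> cm_upto n (\<lambda>x. f x * g x)"
proof (induction n arbitrary: f g)
  case (Suc n)
  from Suc.prems(1) obtain f' where f': "\<And>x. x > 0 \<Longrightarrow> (f has_real_derivative - f' x) (at x)" "cm_upto n f'"
    by (rule cm_upto_SucE) blast
  from Suc.prems(2) obtain g' where g': "\<And>x. x > 0 \<Longrightarrow> (g has_real_derivative - g' x) (at x)" "cm_upto n g'"
    by (rule cm_upto_SucE) blast
  have "cm_upto n (\<lambda>x. f' x * g x + f x * g' x)"
    by (rule cm_upto_add[OF Suc.IH[OF f'(2) cm_upto_Suc_imp[OF Suc.prems(2)]]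
          Suc.IH[OF cm_upto_Suc_imp[OF Suc.prems(1)] g'(2)]])
  then show ?case
  proof (rule cm_upto_SucI[rotated 2])
    fix x :: real assume x: "x > 0"
    show "0 \<le> f x * g x" using cm_upto_nonneg[OF Suc.prems(1) x] cm_upto_nonneg[OF Suc.prems(2) x] by simp
    show "((\<lambda>x. f x * g x) has_real_derivative - (f' x * g x + f x * g' x)) (at x)"
      using DERIV_mult[OF f'(1)[OF x] g'(1)[OF x]] by (simp add: algebra_simps)
  qed
qed simp

lemma cm_upto_const: "c \<ge> 0 \<Longrightarrow> cm_upto n (\<lambda>x. c)"
proof (induction n arbitrary: c)
  case (Suc n)
  show ?case by (rule cm_upto_SucI[where g="\<lambda>_. 0", OF _ _ Suc.IH]) (use Suc.prems in auto)
qed simp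

lemma cm_upto_shift: "cm_upto n f \<Longrightarrow> c \<ge> 0 \<Longrightarrow> cm_upto n (\<lambda>x. f (x + c))"
proof (induction n arbitrary: f)
  case (Suc n)
  from Suc.prems(1) obtain f' where f': "\<And>x. x > 0 \<Longrightarrow> (f has_real_derivative - f' x) (at x)" "cm_upto n f'"
    by (rule cm_upto_SucE) blast
  show ?case
  proof (rule cm_upto_SucI[OF _ _ Suc.IH[OF f'(2) Suc.prems(2)]])
    fix x :: real assume x: "x > 0"
    then have xc: "x + c > 0" using Suc.prems(2) by simp
    show "0 \<le> f (x + c)" by (rule cm_upto_nonneg[OF Suc.prems(1) xc])
    show "((\<lambda>x. f (x + c)) has_real_derivative - f' (x + c)) (at x)"
      using f'(1)[OF xc] by (simp add: DERIV_shift)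
  qed
qed simp

text \<open>The derivative of \<open>h = e\<^sup>-\<^sup>t\<^sup>\<phi>\<close> is \<open>-t \<phi>' h\<close>, so order \<open>n\<close> for \<open>h\<close> and for \<open>\<phi>'\<close> gives order \<open>n + 1\<close> for \<open>h\<close>.\<close>

lemma cm_upto_exp:
  assumes \<phi>: "\<And>x. x > 0 \<Longrightarrow> (\<phi> has_real_derivative g x) (at x)" and t: "t \<ge> 0" and g: "\<And>n. cm_upto n g"
  shows "cm_upto n (\<lambda>x. exp (- t * \<phi> x))"
proof (induction n)
  case (Suc n)
  have "cm_upto n (\<lambda>x. t * (g x * exp (- t * \<phi> x)))"
    by (rule cm_upto_mult[OF cm_upto_const[OF t] cm_upto_mult[OF g Suc]])
  then show ?case
  proof (rule cm_upto_SucI[rotated 2])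
    show "((\<lambda>x. exp (- t * \<phi> x)) has_real_derivative - (t * (g x * exp (- t * \<phi> x)))) (at x)" if "x > 0" for x
      using DERIV_fun_exp[OF DERIV_cmult[OF \<phi>[OF that], of "- t"]] by (simp add: algebra_simps)
  qed simp
qed simp

definition cm_deriv :: "(real \<Rightarrow> real) \<Rightarrow> nat \<Rightarrow> real \<Rightarrow> real" where
  "cm_deriv f k x = (-1) ^ k * (deriv ^^ k) f x"

lemma cm_deriv_0 [simp]: "cm_deriv f 0 = f"
  by (auto simp: cm_deriv_def)

lemma completely_monotone_derivs:
  assumes "completely_monotone f" "x > 0"
  shows "cm_deriv f k x \<ge> 0" "(cm_deriv f k has_real_derivative - cm_deriv f (Suc k) x) (at x)"
proof -
  show "cm_deriv f k x \<ge> 0" using assms by (simp add: completely_monotone_def cm_deriv_def)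
  have "((deriv ^^ k) f has_real_derivative (deriv ^^ Suc k) f x) (at x)"
    using assms by (simp add: completely_monotone_def smooth_pos_def DERIV_deriv_iff_real_differentiable)
  from DERIV_cmult[OF this, of "(-1) ^ k"]
  show "(cm_deriv f k has_real_derivative - cm_deriv f (Suc k) x) (at x)"
    by (simp add: cm_deriv_def[abs_def])
qed

lemma cm_upto_cm_deriv:
  assumes "completely_monotone f"
  shows "cm_upto n (cm_deriv f k)"
proof (induction n arbitrary: k)
  case (Suc n)
  show ?case
    by (rule cm_upto_SucI[OF completely_monotone_derivs[OF assms] Suc])
qed (simp add: completely_monotone_derivs[OF assms])

lemma completely_monotone_iff_cm_upto: "completely_monotone f \<longleftrightarrow> (\<forall>n. cm_upto n f)"
proof
  assume "completely_monotone f"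
  then show "\<forall>n. cm_upto n f" using cm_upto_cm_deriv[of f _ 0] by simp
next
  assume f: "\<forall>n. cm_upto n f"
  have step: "(\<forall>x>0. (g has_real_derivative deriv g x) (at x)) \<and> (\<forall>n. cm_upto n (\<lambda>x. - deriv g x))"
    if g: "\<forall>n. cm_upto n g" for g
  proof -
    obtain h where h: "\<And>x. x > 0 \<Longrightarrow> (g has_real_derivative - h x) (at x)"
      using g[rule_format, of "Suc 0"] by (rule cm_upto_SucE) blast
    then have "\<forall>x>0. (g has_real_derivative deriv g x) (at x)"
      using DERIV_imp_deriv by fastforce
    moreover have "cm_upto n (\<lambda>x. - deriv g x)" for n
    proof -
      obtain h where h: "\<And>x. x > 0 \<Longrightarrow> (g has_real_derivative - h x) (at x)" "cm_upto n h"
        using g[rule_format, of "Suc n"] by (rule cm_upto_SucE) blast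
      show ?thesis by (rule cm_upto_cong[OF h(2)]) (use DERIV_imp_deriv[OF h(1)] in simp)
    qed
    ultimately show ?thesis by blast
  qed
  have all: "\<forall>n. cm_upto n (cm_deriv f k)" for k
  proof (induction k)
    case (Suc k)
    have "(deriv ^^ k) f x = (-1) ^ k * cm_deriv f k x" for x
      by (simp add: cm_deriv_def flip: mult.assoc power_mult_distrib)
    then have "cm_deriv f (Suc k) x = - deriv (cm_deriv f k) x" if "x > 0" for x
    proof -
      have *: "(deriv ^^ k) f = (\<lambda>x. (-1) ^ k * cm_deriv f k x)"
        by (auto simp: cm_deriv_def simp flip: mult.assoc power_mult_distrib)
      have "((\<lambda>x. (-1) ^ k * cm_deriv f k x) has_real_derivative (-1) ^ k * deriv (cm_deriv f k) x) (at x)"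
        using step[OF Suc] that by (intro DERIV_cmult) auto
      from DERIV_imp_deriv[OF this] have "deriv ((deriv ^^ k) f) x = (-1) ^ k * deriv (cm_deriv f k) x"
        unfolding * .
      then show ?thesis by (simp add: cm_deriv_def[of f "Suc k"] flip: mult.assoc power_mult_distrib)
    qed
    then show ?case using step[OF Suc] by (metis cm_upto_cong)
  qed (use f in simp)
  have "(deriv ^^ k) f differentiable (at x)" if "x > 0" for k x
  proof -
    have *: "(deriv ^^ k) f = (\<lambda>x. (-1) ^ k * cm_deriv f k x)"
      by (auto simp: cm_deriv_def simp flip: mult.assoc power_mult_distrib)
    have "((\<lambda>x. (-1) ^ k * cm_deriv f k x) has_real_derivative (-1) ^ k * deriv (cm_deriv f k) x) (at x)"
      using step[OF all] that by (intro DERIV_cmult) auto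
    then show ?thesis unfolding * by (auto simp: real_differentiable_def)
  qed
  moreover have "0 \<le> (-1) ^ k * (deriv ^^ k) f x" if "x > 0" for k x
    using cm_upto_nonneg[OF spec[OF all] that] unfolding cm_deriv_def .
  ultimately show "completely_monotone f"
    using f cm_upto_nonneg by (auto simp: completely_monotone_def smooth_pos_def)
qed

lemma completely_monotone_mult:
  "completely_monotone f \<Longrightarrow> completely_monotone g \<Longrightarrow> completely_monotone (\<lambda>x. f x * g x)"
  by (simp add: completely_monotone_iff_cm_upto cm_upto_mult)

lemma completely_monotone_cmult:
  "completely_monotone f \<Longrightarrow> c \<ge> 0 \<Longrightarrow> completely_monotone (\<lambda>x. c * f x)"
  by (simp add: completely_monotone_iff_cm_upto cm_upto_mult cm_upto_const)

lemma completely_monotone_shift: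
  "completely_monotone f \<Longrightarrow> c \<ge> 0 \<Longrightarrow> completely_monotone (\<lambda>x. f (x + c))"
  by (simp add: completely_monotone_iff_cm_upto cm_upto_shift)

lemma antimono_pos:
  fixes f :: "real \<Rightarrow> real"
  assumes "\<And>x. x > 0 \<Longrightarrow> (f has_real_derivative f' x) (at x)" "\<And>x. x > 0 \<Longrightarrow> f' x \<le> 0"
    and "0 < x" "x \<le> y"
  shows "f y \<le> f x"
proof (rule DERIV_nonpos_imp_nonincreasing[OF assms(4)])
  fix z assume "x \<le> z"
  then have "z > 0" using assms(3) by simp
  then show "\<exists>d. (f has_real_derivative d) (at z) \<and> d \<le> 0" using assms(1,2) by blast
qed

lemma cm_deriv_antimono:
  assumes "completely_monotone f" "0 < x" "x \<le> y"
  shows "cm_deriv f k y \<le> cm_deriv f k x"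
  by (rule antimono_pos[of _ "\<lambda>x. - cm_deriv f (Suc k) x"])
     (use assms completely_monotone_derivs[OF assms(1)] in auto)

lemma completely_monotone_antimono:
  assumes "completely_monotone f" "0 < x" "x \<le> y"
  shows "f y \<le> f x"
  using cm_deriv_antimono[OF assms, of 0] by simp

lemma bernstein_DERIV:
  assumes "bernstein \<psi>" "x > 0"
  shows "(\<psi> has_real_derivative deriv \<psi> x) (at x)"
proof -
  have "(deriv ^^ 0) \<psi> differentiable (at x)"
    using assms unfolding bernstein_def smooth_pos_def by blast
  then show ?thesis by (simp add: DERIV_deriv_iff_real_differentiable)
qed

lemma bernstein_completely_monotone_deriv: "bernstein \<psi> \<Longrightarrow> completely_monotone (deriv \<psi>)"
  by (simp add: bernstein_def)

lemma bernstein_deriv_nonneg: "bernstein \<psi> \<Longrightarrow> x > 0 \<Longrightarrow> deriv \<psi> x \<ge> 0"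
  by (simp add: bernstein_def completely_monotone_def)

lemma bernstein_nonneg: "bernstein \<psi> \<Longrightarrow> x > 0 \<Longrightarrow> \<psi> x \<ge> 0"
  by (simp add: bernstein_def)

lemma bernstein_mono:
  assumes "bernstein \<psi>" "0 < x" "x \<le> y"
  shows "\<psi> x \<le> \<psi> y"
proof -
  have "- \<psi> y \<le> - \<psi> x"
    by (rule antimono_pos[of "\<lambda>x. - \<psi> x" "\<lambda>x. - deriv \<psi> x" x y])
       (simp_all add: DERIV_minus bernstein_DERIV[OF assms(1)] bernstein_deriv_nonneg[OF assms(1)] assms(2,3))
  then show ?thesis by simp
qed

lemma completely_monotone_exp_bernstein:
  assumes "bernstein \<phi>" "t \<ge> 0"
  shows "completely_monotone (\<lambda>x. exp (- t * \<phi> x))"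
  using cm_upto_exp[OF bernstein_DERIV[OF assms(1)] assms(2)]
    bernstein_completely_monotone_deriv[OF assms(1)]
  by (simp add: completely_monotone_iff_cm_upto)

text \<open>The derivatives of \<open>\<psi>'\<close> are alternately decreasing and increasing, so their increments alternate in sign as well.\<close>

lemma completely_monotone_bernstein_increment:
  assumes \<psi>: "bernstein \<psi>" and c: "c \<ge> 0"
  shows "completely_monotone (\<lambda>z. \<psi> (z + c) - \<psi> z)"
proof -
  note cm = bernstein_completely_monotone_deriv[OF \<psi>]
  let ?P = "cm_deriv (deriv \<psi>)"
  have P: "cm_upto n (\<lambda>z. ?P k z - ?P k (z + c))" for n k
  proof (induction n arbitrary: k)
    case 0
    then show ?case using cm_deriv_antimono[OF cm] c by simp
  next
    case (Suc n)
    show ?case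
    proof (rule cm_upto_SucI[OF _ _ Suc[of "Suc k"]])
      fix x :: real assume x: "x > 0"
      show "0 \<le> ?P k x - ?P k (x + c)" using cm_deriv_antimono[OF cm, of x "x + c" k] c x by simp
      have "((\<lambda>z. ?P k (z + c)) has_real_derivative - ?P (Suc k) (x + c)) (at x)"
        using completely_monotone_derivs(2)[OF cm, of "x + c" k] x c by (simp add: DERIV_shift)
      from DERIV_diff[OF completely_monotone_derivs(2)[OF cm x, of k] this]
      show "((\<lambda>z. ?P k z - ?P k (z + c)) has_real_derivative - (?P (Suc k) x - ?P (Suc k) (x + c))) (at x)"
        by simp
    qed
  qed
  have "cm_upto (Suc n) (\<lambda>z. \<psi> (z + c) - \<psi> z)" for n
  proof (rule cm_upto_SucI[OF _ _ P[of n 0]])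
    fix x :: real assume x: "x > 0"
    show "0 \<le> \<psi> (x + c) - \<psi> x" using bernstein_mono[OF \<psi> x, of "x + c"] c by simp
    have "((\<lambda>z. \<psi> (z + c)) has_real_derivative deriv \<psi> (x + c)) (at x)"
      using bernstein_DERIV[OF \<psi>, of "x + c"] x c by (simp add: DERIV_shift)
    from DERIV_diff[OF this bernstein_DERIV[OF \<psi> x]]
    show "((\<lambda>z. \<psi> (z + c) - \<psi> z) has_real_derivative - (?P 0 x - ?P 0 (x + c))) (at x)" by simp
  qed
  then show ?thesis unfolding completely_monotone_iff_cm_upto using cm_upto_Suc_imp by blast
qed

text \<open>The \<open>n\<close>-th derivative of \<open>\<psi>(z + 1) / z\<close> is \<open>(-1)\<^sup>n n! Q\<^sub>n(z) / z\<^sup>n\<^sup>+\<^sup>1\<close>, where \<open>Q\<^sub>n(z)\<close> is the Taylor polynomial of degree \<open>n\<close>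
  of \<open>\<psi>\<close> at \<open>z + 1\<close>, evaluated at \<open>1\<close>. It is nonnegative because \<open>Q\<^sub>n(0) = \<psi>(1)\<close> and \<open>Q\<^sub>n' \<ge> 0\<close>, the sum telescoping.
  The shift by \<open>1\<close> keeps the base point away from \<open>0\<close>, where \<open>\<psi>\<close> need not be differentiable.\<close>

lemma completely_monotone_bernstein_quotient:
  assumes \<psi>: "bernstein \<psi>"
  shows "completely_monotone (\<lambda>z. \<psi> (z + 1) / z)"
proof -
  note cm = bernstein_completely_monotone_deriv[OF \<psi>]
  let ?P = "cm_deriv (deriv \<psi>)"
  define Q where "Q n z = \<psi> (z + 1) - (\<Sum>k<n. ?P k (z + 1) * z ^ Suc k / fact (Suc k))" for n :: nat and z :: real
  have QSuc: "Q (Suc n) = (\<lambda>z. Q n z - ?P n (z + 1) * z ^ Suc n / fact (Suc n))" for n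
    by (auto simp: Q_def)
  have DQ: "(Q n has_real_derivative ?P n (z + 1) * z ^ n / fact n) (at z)" if "z \<ge> 0" for n z
  proof (induction n)
    case 0
    have "((\<lambda>z. \<psi> (z + 1)) has_real_derivative deriv \<psi> (z + 1)) (at z)"
      using bernstein_DERIV[OF \<psi>, of "z + 1"] that by (simp add: DERIV_shift)
    then show ?case by (simp add: Q_def[abs_def])
  next
    case (Suc n)
    have "((\<lambda>z. ?P n (z + 1)) has_real_derivative - ?P (Suc n) (z + 1)) (at z)"
      using completely_monotone_derivs(2)[OF cm, of "z + 1" n] that by (simp add: DERIV_shift)
    moreover have "((\<lambda>z. z ^ Suc n / fact (Suc n)) has_real_derivative z ^ n / fact n) (at z)"
      by (rule DERIV_cong[OF DERIV_cdivide[OF DERIV_pow]]) (simp add: fact_Suc del: of_nat_Suc)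
    ultimately have "((\<lambda>z. ?P n (z + 1) * (z ^ Suc n / fact (Suc n))) has_real_derivative
        - ?P (Suc n) (z + 1) * (z ^ Suc n / fact (Suc n)) + z ^ n / fact n * ?P n (z + 1)) (at z)"
      by (rule DERIV_mult)
    from DERIV_diff[OF Suc this] show ?case unfolding QSuc by (simp add: mult.commute)
  qed
  have Qnn: "Q n z \<ge> 0" if "z \<ge> 0" for n z
  proof -
    have "Q n 0 \<le> Q n z"
    proof (rule DERIV_nonneg_imp_nondecreasing[OF that])
      fix x :: real assume "0 \<le> x"
      moreover from this have "?P n (x + 1) * x ^ n / fact n \<ge> 0"
        using completely_monotone_derivs(1)[OF cm, of "x + 1" n] by simp
      ultimately show "\<exists>y. (Q n has_real_derivative y) (at x) \<and> 0 \<le> y" using DQ by blast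
    qed
    moreover have "Q n 0 = \<psi> 1" by (simp add: Q_def)
    ultimately show ?thesis using bernstein_nonneg[OF \<psi>, of 1] by simp
  qed
  define G where "G n z = fact n * Q n z / z ^ Suc n" for n z
  have "cm_upto m (G n)" for m n
  proof (induction m arbitrary: n)
    case 0
    then show ?case by (simp add: G_def Qnn)
  next
    case (Suc m)
    show ?case
    proof (rule cm_upto_SucI[OF _ _ Suc[of "Suc n"]])
      show "0 \<le> G n z" if "z > 0" for z using that by (simp add: G_def Qnn)
      fix z :: real assume z: "z > 0"
      have "(G n has_real_derivative ((fact n * (?P n (z + 1) * z ^ n / fact n)) * z ^ Suc n -
          fact n * Q n z * (real (Suc n) * z ^ n)) / (z ^ Suc n * z ^ Suc n)) (at z)"
        unfolding G_def[abs_def] using z DQ[of z n]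
        by (intro DERIV_divide DERIV_cmult) (auto intro!: derivative_eq_intros simp del: power_Suc)
      also have "((fact n * (?P n (z + 1) * z ^ n / fact n)) * z ^ Suc n -
          fact n * Q n z * (real (Suc n) * z ^ n)) / (z ^ Suc n * z ^ Suc n) = - G (Suc n) z"
      proof -
        have alg: "((c * (p * w / c)) * (z * w) - c * q * (N * w)) / ((z * w) * (z * w)) =
            - (N * c * (q - p * (z * w) / (N * c)) / (z * (z * w)))"
          if "c > 0" "N > 0" "w > 0" for c p w q N :: real
          using that z by (simp add: field_simps)
        show ?thesis unfolding G_def QSuc fact_Suc power_Suc by (rule alg) (use z in auto)
      qed
      finally show "(G n has_real_derivative - G (Suc n) z) (at z)" .
    qed
  qed
  from this[of _ 0] have "cm_upto m (\<lambda>z. \<psi> (z + 1) / z)" for m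
    by (rule cm_upto_cong) (simp add: G_def Q_def)
  then show ?thesis by (simp add: completely_monotone_iff_cm_upto)
qed

section \<open>Bernstein's theorem for bounded completely monotone functions\<close>

text \<open>All derivatives of \<open>g(x) = f(a - x)\<close> are nonnegative on \<open>[0, a)\<close>. For such \<open>g\<close> the Taylor remainder \<open>R\<^sub>n\<close> satisfies
  \<open>x R\<^sub>n' \<ge> n R\<^sub>n\<close>, so \<open>R\<^sub>n(x) / x\<^sup>n\<close> increases, and comparison with a point \<open>b\<close> between \<open>x\<close> and \<open>a\<close> gives
  \<open>R\<^sub>n(x) \<le> (x / b)\<^sup>n g(b)\<close>, which tends to \<open>0\<close>.\<close>

lemma completely_monotone_Taylor_sums:
  assumes f: "completely_monotone f" and a: "a > 0" and x: "0 \<le> x" "x < a"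
  shows "(\<lambda>k. cm_deriv f k a / fact k * x ^ k) sums f (a - x)"
proof -
  let ?F = "cm_deriv f"
  define R where "R j n x = ?F j (a - x) - (\<Sum>k<n. ?F (j + k) a / fact k * x ^ k)" for j n :: nat and x :: real
  \<comment> \<open>Truncated subtraction covers \<open>n = 0\<close>: then \<open>R j 0\<close> is \<open>F\<^sub>j(a - x)\<close>, with derivative \<open>R (j + 1) 0\<close>.\<close>
  have DR: "(R j n has_real_derivative R (Suc j) (n - 1) x) (at x)" if "x < a" for j n x
  proof -
    have "((\<lambda>x. ?F j (a - x)) has_real_derivative ?F (Suc j) (a - x)) (at x)"
      using DERIV_chain2[OF completely_monotone_derivs(2)[OF f, of "a - x" j] DERIV_diff[OF DERIV_const DERIV_ident]] that
      by simp
    moreover have "((\<lambda>x. \<Sum>k<n. ?F (j + k) a / fact k * x ^ k) has_real_derivative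
       (\<Sum>k<n - 1. ?F (Suc j + k) a / fact k * x ^ k)) (at x)"
    proof (cases n)
      case (Suc m)
      have "((\<lambda>x. \<Sum>k<n. ?F (j + k) a / fact k * x ^ k) has_real_derivative
         (\<Sum>k<n. ?F (j + k) a / fact k * (real k * x ^ (k - 1)))) (at x)"
        using DERIV_pow by (intro DERIV_sum DERIV_cmult) auto
      also have "(\<Sum>k<n. ?F (j + k) a / fact k * (real k * x ^ (k - 1))) =
         (\<Sum>k<n - 1. ?F (Suc j + k) a / fact k * x ^ k)"
        unfolding Suc sum.lessThan_Suc_shift by (simp add: fact_Suc del: of_nat_Suc)
      finally show ?thesis .
    qed simp
    ultimately show ?thesis unfolding R_def[abs_def] by (rule DERIV_diff)
  qed
  have R0: "R j (Suc n) 0 = 0" for j n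
    by (simp add: R_def sum.lessThan_Suc_shift)
  have mono: "h 0 \<le> h x" if "0 \<le> x" "x < a" "\<And>y. 0 \<le> y \<Longrightarrow> y < a \<Longrightarrow> (h has_real_derivative h' y) (at y) \<and> h' y \<ge> 0"
    for h h' :: "real \<Rightarrow> real" and x
  proof (rule DERIV_nonneg_imp_nondecreasing[OF that(1)])
    fix y assume "0 \<le> y" "y \<le> x"
    then show "\<exists>d. (h has_real_derivative d) (at y) \<and> 0 \<le> d"
      using that(3)[of y] that(2) by auto
  qed
  have Rnn: "R j n x \<ge> 0" if "0 \<le> x" "x < a" for j n x
    using that
  proof (induction n arbitrary: j x)
    case 0
    then show ?case using completely_monotone_derivs(1)[OF f] by (simp add: R_def)
  next
    case (Suc n)
    have "R j (Suc n) 0 \<le> R j (Suc n) x"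
      by (rule mono[where h'="R (Suc j) n"]) (use Suc DR[of _ j "Suc n"] in auto)
    then show ?case by (simp add: R0)
  qed
  have D: "x * R (Suc j) (n - 1) x - real n * R j n x \<ge> 0" if "0 \<le> x" "x < a" for j n x
    using that
  proof (induction n arbitrary: j x)
    case 0
    then show ?case using Rnn by simp
  next
    case (Suc n)
    let ?h = "\<lambda>x. x * R (Suc j) n x - real (Suc n) * R j (Suc n) x"
    have "?h 0 \<le> ?h x"
    proof (rule mono[OF Suc.prems, where h'="\<lambda>x. x * R (Suc (Suc j)) (n - 1) x - real n * R (Suc j) n x"])
      fix y assume y: "0 \<le> y" "y < a"
      have "(?h has_real_derivative (1 * R (Suc j) n y + R (Suc (Suc j)) (n - 1) y * y)
          - real (Suc n) * R (Suc j) n y) (at y)"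
        using DR[OF y(2), of j "Suc n"] DR[OF y(2), of "Suc j" n]
        by (intro DERIV_diff DERIV_mult DERIV_cmult DERIV_ident) auto
      then show "(?h has_real_derivative y * R (Suc (Suc j)) (n - 1) y - real n * R (Suc j) n y) (at y) \<and>
          y * R (Suc (Suc j)) (n - 1) y - real n * R (Suc j) n y \<ge> 0"
        using Suc.IH[OF y] by (simp add: algebra_simps)
    qed
    then show ?case by (simp add: R0)
  qed
  obtain b where b: "x < b" "b < a" using x(2) dense by blast
  have bound: "R 0 n x \<le> f (a - b) * (x / b) ^ n" for n
  proof (cases "x = 0")
    case True
    show ?thesis
    proof (cases n)
      case 0
      then show ?thesis using True completely_monotone_antimono[OF f, of "a - b" a] b x by (simp add: R_def)
    qed (use True R0 in simp)
  next
    case False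
    then have x0: "x > 0" using x by simp
    have "R 0 n x / x ^ n \<le> R 0 n b / b ^ n"
    proof (rule DERIV_nonneg_imp_nondecreasing[where f="\<lambda>y. R 0 n y / y ^ n"])
      fix y assume y: "x \<le> y" "y \<le> b"
      then have y': "0 < y" "y < a" using x0 b by auto
      have "((\<lambda>y. R 0 n y / y ^ n) has_real_derivative
         (R (Suc 0) (n - 1) y * y ^ n - R 0 n y * (real n * y ^ (n - 1))) / (y ^ n * y ^ n)) (at y)"
        using DR[OF y'(2), of 0 n] y' by (intro DERIV_divide) (auto intro!: derivative_eq_intros)
      moreover have "(R (Suc 0) (n - 1) y * y ^ n - R 0 n y * (real n * y ^ (n - 1))) =
          y ^ (n - 1) * (y * R (Suc 0) (n - 1) y - real n * R 0 n y)" if "n > 0"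
        using that by (cases n) (auto simp: algebra_simps)
      then have "(R (Suc 0) (n - 1) y * y ^ n - R 0 n y * (real n * y ^ (n - 1))) \<ge> 0"
        using D[of y 0 n] y' Rnn[of y] by (cases "n = 0") auto
      ultimately show "\<exists>d. ((\<lambda>y. R 0 n y / y ^ n) has_real_derivative d) (at y) \<and> 0 \<le> d"
        using y' by (meson divide_nonneg_nonneg mult_nonneg_nonneg zero_le_power less_imp_le)
    qed (use b in simp)
    moreover have "R 0 n b \<le> f (a - b)"
      using a x b completely_monotone_derivs(1)[OF f a] by (auto simp: R_def intro!: sum_nonneg)
    ultimately have "R 0 n x / x ^ n \<le> f (a - b) / b ^ n"
      using b x0 by (meson divide_right_mono order_trans zero_le_power less_imp_le less_trans)
    then show ?thesis using x0 by (simp add: field_simps)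
  qed
  have "(\<lambda>n. f (a - b) * (x / b) ^ n) \<longlonglongrightarrow> f (a - b) * 0"
    using b x by (intro tendsto_mult tendsto_const LIMSEQ_realpow_zero) auto
  then have "(\<lambda>n. R 0 n x) \<longlonglongrightarrow> 0"
    by (intro tendsto_sandwich[of "\<lambda>_. 0" "\<lambda>n. R 0 n x"]) (auto simp: bound Rnn x)
  then have "(\<lambda>n. f (a - x) - R 0 n x) \<longlonglongrightarrow> f (a - x) - 0" by (intro tendsto_intros)
  then show ?thesis by (simp add: sums_def R_def)
qed

lemma antimono_tendsto_at_right_0:
  fixes f :: "real \<Rightarrow> real"
  assumes anti: "\<And>x y. 0 < x \<Longrightarrow> x \<le> y \<Longrightarrow> f y \<le> f x" and C: "\<And>x. x > 0 \<Longrightarrow> f x \<le> C"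
  obtains L where "(f \<longlongrightarrow> L) (at_right 0)" "\<And>x. x > 0 \<Longrightarrow> f x \<le> L" "L \<le> C"
proof
  let ?L = "SUP x\<in>{0<..}. f x"
  have bdd: "bdd_above (f ` {0<..})" using C by (auto intro!: bdd_aboveI)
  show le: "f x \<le> ?L" if "x > 0" for x using that by (intro cSUP_upper bdd) auto
  show "?L \<le> C" by (intro cSUP_least) (use C in auto)
  show "(f \<longlongrightarrow> ?L) (at_right 0)"
  proof (rule order_tendstoI)
    fix a assume "a < ?L"
    then obtain x where x: "x > 0" "a < f x"
      using less_cSUP_iff[OF _ bdd, of a] by auto
    have "eventually (\<lambda>y. 0 < y \<and> y < x) (at_right 0)"
      by (rule eventually_at_rightI[of 0 x]) (use x in auto)
    then show "eventually (\<lambda>y. a < f y) (at_right 0)"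
      by eventually_elim (use anti[of _ x] x in fastforce)
  next
    fix a assume a: "?L < a"
    show "eventually (\<lambda>y. f y < a) (at_right 0)"
      using eventually_at_right_less[of 0] by eventually_elim (use le a in fastforce)
  qed
qed

text \<open>Feller's approximation: expanding \<open>f\<close> at \<open>n\<close> writes \<open>f(n (1 - e\<^sup>-\<^sup>l\<^sup>/\<^sup>n))\<close> as \<open>\<Sum>\<^sub>k p\<^sub>k e\<^sup>-\<^sup>l\<^sup>k\<^sup>/\<^sup>n\<close> with \<open>p\<^sub>k \<ge> 0\<close>, that is, as the
  Laplace transform of the probability measure with mass \<open>p\<^sub>k\<close> at \<open>k / n\<close>. The cut-off \<open>max 0 s\<close> makes the integrand
  bounded on the whole line and changes nothing on the support.\<close>

lemma normalized_completely_monotone_approx: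
  assumes f: "completely_monotone f" and f1: "\<And>x. x > 0 \<Longrightarrow> f x \<le> 1" and lim: "(f \<longlongrightarrow> 1) (at_right 0)"
    and n: "n > 0"
  obtains M where "real_distribution M"
    "\<And>l. l > 0 \<Longrightarrow> (\<integral>s. exp (- (max 0 s * l)) \<partial>M) = f (real n * (1 - exp (- (l / real n))))"
    "AE s in M. 0 \<le> s"
proof -
  define p where "p k = cm_deriv f k (real n) / fact k * real n ^ k" for k
  have p0: "p k \<ge> 0" for k
    using completely_monotone_derivs(1)[OF f, of "real n" k] n by (simp add: p_def)
  have sums: "(\<lambda>k. p k * y ^ k) sums f (real n * (1 - y))" if "0 < y" "y \<le> 1" "y < 1" for y
    using completely_monotone_Taylor_sums[OF f, of "real n" "real n * y"] n that
    by (simp add: p_def power_mult_distrib algebra_simps)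
  have part: "(\<Sum>k<N. p k) \<le> 1" for N
  proof -
    have "((\<lambda>y. \<Sum>k<N. p k * y ^ k) \<longlongrightarrow> (\<Sum>k<N. p k * 1 ^ k)) (at_left 1)"
      by (intro tendsto_intros)
    then have "(\<Sum>k<N. p k * 1 ^ k) \<le> 1"
    proof (rule tendsto_upperbound)
      have "eventually (\<lambda>y::real. 0 < y \<and> y < 1) (at_left 1)"
        by (rule eventually_at_leftI[of 0]) auto
      then show "eventually (\<lambda>y. (\<Sum>k<N. p k * y ^ k) \<le> 1) (at_left 1)"
      proof eventually_elim
        case (elim y)
        have "(\<Sum>k<N. p k * y ^ k) \<le> (\<Sum>k. p k * y ^ k)"
          using elim p0 by (intro sum_le_suminf sums_summable[OF sums]) auto
        also have "\<dots> = f (real n * (1 - y))"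
          using elim by (intro sums_unique[symmetric] sums) auto
        also have "\<dots> \<le> 1" using elim n by (intro f1) auto
        finally show ?case .
      qed
    qed simp
    then show ?thesis by simp
  qed
  have summ: "summable p" by (rule summableI_nonneg_bounded[OF p0 part])
  have sum1: "suminf p = 1"
  proof (rule antisym)
    show "suminf p \<le> 1" by (rule suminf_le_const[OF summ part])
    have "((\<lambda>y. real n * (1 - y)) \<longlongrightarrow> real n * (1 - 1)) (at_left 1)" by (intro tendsto_intros)
    moreover have ev: "eventually (\<lambda>y::real. 0 < y \<and> y < 1) (at_left 1)"
      by (rule eventually_at_leftI[of 0]) auto
    ultimately have "filterlim (\<lambda>y. real n * (1 - y)) (at_right 0) (at_left 1)"
      using n by (intro filterlim_at[THEN iffD2]) (auto elim!: eventually_mono)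
    from filterlim_compose[OF lim this]
    show "1 \<le> suminf p"
    proof (rule tendsto_upperbound)
      show "eventually (\<lambda>y. f (real n * (1 - y)) \<le> suminf p) (at_left 1)"
        using ev
      proof eventually_elim
        case (elim y)
        have "f (real n * (1 - y)) = (\<Sum>k. p k * y ^ k)"
          using elim by (intro sums_unique sums) auto
        also have "\<dots> \<le> suminf p"
          using elim p0 by (intro suminf_le summ sums_summable[OF sums])
            (auto intro!: mult_left_le power_le_one)
        finally show ?case .
      qed
    qed simp
  qed
  have nn1: "(\<integral>\<^sup>+ k. ennreal (p k) \<partial>count_space UNIV) = 1"
    using sum1 by (simp add: nn_integral_count_space_nat suminf_ennreal2 p0 summ)
  define P where "P = embed_pmf p"
  have pmf: "pmf P k = p k" for k unfolding P_def by (rule pmf_embed_pmf[OF p0 nn1])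
  define M where "M = distr (measure_pmf P) borel (\<lambda>k. real k / real n)"
  show thesis
  proof
    show "real_distribution M" unfolding M_def by (rule prob_space.real_distribution_distr[OF measure_pmf.prob_space_axioms]) simp
    show "AE s in M. 0 \<le> s" unfolding M_def by (subst AE_distr_iff) auto
    fix l :: real assume l: "l > 0"
    have y: "0 < exp (- (l / real n))" "exp (- (l / real n)) < 1" using l n by auto
    have e: "exp (- (real k / real n * l)) = exp (- (l / real n)) ^ k" for k
      by (simp flip: exp_of_nat_mult)
    have "(\<integral>s. exp (- (max 0 s * l)) \<partial>M) = (\<integral>k. exp (- (max 0 (real k / real n) * l)) \<partial>measure_pmf P)"
      unfolding M_def by (intro integral_distr) auto
    also have "\<dots> = (\<integral>k. exp (- (l / real n)) ^ k \<partial>measure_pmf P)"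
      by (simp only: max_absorb2[OF divide_nonneg_nonneg[OF of_nat_0_le_iff of_nat_0_le_iff]] e)
    also have "\<dots> = (\<integral>k. p k * exp (- (l / real n)) ^ k \<partial>count_space UNIV)"
      unfolding measure_pmf_eq_density by (subst integral_density) (auto simp: pmf p0)
    also have "\<dots> = (\<Sum>k. p k * exp (- (l / real n)) ^ k)"
      by (rule integral_count_space_nat)
         (use sums_summable[OF sums[OF y(1) _ y(2)]] y p0 in \<open>auto simp: integrable_count_space_nat_iff abs_mult\<close>)
    also have "\<dots> = f (real n * (1 - exp (- (l / real n))))"
      using y by (intro sums_unique[symmetric] sums) auto
    finally show "(\<integral>s. exp (- (max 0 s * l)) \<partial>M) = f (real n * (1 - exp (- (l / real n))))" .
  qed
qed

lemma Suc_times_one_minus_exp_tendsto: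
  "(\<lambda>n. real (Suc n) * (1 - exp (- (l / real (Suc n))))) \<longlonglongrightarrow> l"
  proof -
    have "((\<lambda>x. - exp (- x)) has_real_derivative 1) (at 0)"
      by (auto intro!: derivative_eq_intros)
    then have D: "((\<lambda>h. (1 - exp (- h)) / h) \<longlongrightarrow> 1) (at (0::real))"
      by (simp add: DERIV_def)
    show ?thesis
    proof (cases "l = 0")
      case False
      have "(\<lambda>n. l * inverse (real (Suc n))) \<longlonglongrightarrow> l * 0"
        by (intro tendsto_intros LIMSEQ_inverse_real_of_nat)
      then have "filterlim (\<lambda>n. l / real (Suc n)) (at 0) sequentially"
        using False by (auto simp: filterlim_at divide_inverse)
      from filterlim_compose[OF D this]
      have "(\<lambda>n. l * ((1 - exp (- (l / real (Suc n)))) / (l / real (Suc n)))) \<longlonglongrightarrow> l * 1"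
        by (intro tendsto_intros)
      then show ?thesis using False by (simp add: mult.commute)
    qed (simp add: )
  qed

text \<open>The arguments \<open>n (1 - e\<^sup>-\<^sup>l\<^sup>/\<^sup>n)\<close> tend to \<open>l\<close> from below. Since \<open>f\<close> is decreasing, the approximating transforms
  dominate \<open>f\<close>, which tends to \<open>1\<close> at \<open>0\<close>; this makes the measures tight, and any weak limit represents \<open>f\<close>.\<close>

lemma normalized_completely_monotone_representation:
  assumes f: "completely_monotone f" and f1: "\<And>x. x > 0 \<Longrightarrow> f x \<le> 1" and lim: "(f \<longlongrightarrow> 1) (at_right 0)"
  obtains M where "real_distribution M"
    "\<And>l. l > 0 \<Longrightarrow> (\<integral>s. exp (- (max 0 s * l)) \<partial>M) = f l"
proof -
  define g where "g n l = real (Suc n) * (1 - exp (- (l / real (Suc n))))" for n l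
  have "\<exists>M. real_distribution M \<and> (\<forall>l>0. (\<integral>s. exp (- (max 0 s * l)) \<partial>M) = f (g n l)) \<and> (AE s in M. 0 \<le> s)" for n
    using normalized_completely_monotone_approx[OF assms, of "Suc n"] unfolding g_def by (metis zero_less_Suc)
  then obtain M where M: "\<And>n. real_distribution (M n)"
    "\<And>n l. l > 0 \<Longrightarrow> (\<integral>s. exp (- (max 0 s * l)) \<partial>M n) = f (g n l)"
    "\<And>n. AE s in M n. 0 \<le> s" by metis
  have gpos: "g n l > 0" if "l > 0" for n l using that by (simp add: g_def)
  have gle: "g n l \<le> l" for n l
  proof -
    have "1 - exp (- (l / real (Suc n))) \<le> l / real (Suc n)"
      using exp_ge_add_one_self[of "- (l / real (Suc n))"] by simp
    then have "g n l \<le> real (Suc n) * (l / real (Suc n))" unfolding g_def by (intro mult_left_mono) auto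
    then show ?thesis by simp
  qed
  have glim: "(\<lambda>n. g n l) \<longlonglongrightarrow> l" for l
    unfolding g_def by (rule Suc_times_one_minus_exp_tendsto)
  have tight: "tight M"
    unfolding tight_def
  proof (intro conjI allI impI M(1))
    fix \<epsilon> :: real assume \<epsilon>: "\<epsilon> > 0"
    \<comment> \<open>On \<open>s > 1 / x\<close> the integrand \<open>e\<^sup>-\<^sup>s\<^sup>x\<close> is at most \<open>e\<^sup>-\<^sup>1\<close>, so a transform close to \<open>1\<close> at a small \<open>x\<close> leaves
      little mass there.\<close>
    have e1: "1 - exp (- 1) > (0::real)" by simp
    have "eventually (\<lambda>x. f x > 1 - \<epsilon> * (1 - exp (- 1))) (at_right 0)"
      using \<epsilon> e1 by (intro order_tendstoD[OF lim]) simp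
    then have "eventually (\<lambda>x. f x > 1 - \<epsilon> * (1 - exp (- 1)) \<and> x > 0) (at_right 0)"
      by (intro eventually_conj eventually_at_right_less)
    then obtain x where x: "x > 0" "f x > 1 - \<epsilon> * (1 - exp (- 1))"
      using eventually_happens[of _ "at_right (0::real)"] by auto
    have "measure (M n) {- 1<..1 / x} > 1 - \<epsilon>" for n
    proof -
      interpret real_distribution "M n" by (rule M(1))
      have "f x \<le> (\<integral>s. exp (- (max 0 s * x)) \<partial>M n)"
        using M(2)[OF x(1)] completely_monotone_antimono[OF f gpos gle, OF x(1)] by simp
      also have "\<dots> \<le> (\<integral>s. exp (- 1) + (1 - exp (- 1)) * indicator {- 1<..1 / x} s \<partial>M n)"
      proof (rule integral_mono_AE)
        show "integrable (M n) (\<lambda>s. exp (- (max 0 s * x)))"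
          using x by (intro integrable_const_bound[of _ 1]) (auto simp: measurable_finite_borel)
        show "integrable (M n) (\<lambda>s. exp (- 1) + (1 - exp (- 1)) * indicator {- 1<..1 / x} s :: real)"
          by (intro integrable_const_bound[of _ 1]) (auto split: split_indicator)
        show "AE s in M n. exp (- (max 0 s * x)) \<le> exp (- 1) + (1 - exp (- 1)) * indicator {- 1<..1 / x} s"
          using M(3)
        proof eventually_elim
          case (elim s)
          show ?case
          proof (cases "s \<le> 1 / x")
            case True
            then show ?thesis using elim x by simp
          next
            case False
            then have "1 \<le> s * x" using x by (simp add: field_simps)
            then show ?thesis using False elim by simp
          qed
        qed
      qed
      also have "\<dots> = exp (- 1) + (1 - exp (- 1)) * measure (M n) {- 1<..1 / x}"
        by (subst Bochner_Integration.integral_add) (auto simp: prob_space[unfolded space_eq_univ] emeasure_eq_measure)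
      finally have "(1 - exp (- 1)) * (1 - \<epsilon>) < (1 - exp (- 1)) * measure (M n) {- 1<..1 / x}"
        using x(2) by (simp add: algebra_simps)
      then show ?thesis using e1 mult_less_cancel_left_pos by blast
    qed
    moreover have "- 1 < 1 / x" using x(1) by (smt (verit) divide_pos_pos)
    ultimately show "\<exists>a b. a < b \<and> (\<forall>n. 1 - \<epsilon> < measure (M n) {a<..b})" by blast
  qed
  from tight_imp_convergent_subsubsequence[OF tight strict_mono_id]
  obtain r M0 where r: "strict_mono r" and M0: "real_distribution M0" and conv: "weak_conv_m (M \<circ> id \<circ> r) M0"
    by blast
  show thesis
  proof
    show "real_distribution M0" by fact
    fix l :: real assume l: "l > 0"
    have "(\<lambda>n. \<integral>s. exp (- (max 0 s * l)) \<partial>(M \<circ> id \<circ> r) n) \<longlonglongrightarrow> (\<integral>s. exp (- (max 0 s * l)) \<partial>M0)"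
      by (rule weak_conv_imp_integral_bdd_continuous_conv[OF _ M0 conv, of _ 1])
         (use l M(1) in \<open>simp_all add: continuous_intros\<close>)
    then have "(\<lambda>n. f (g (r n) l)) \<longlonglongrightarrow> (\<integral>s. exp (- (max 0 s * l)) \<partial>M0)"
      by (simp add: M(2) l)
    moreover have "isCont f l"
      using completely_monotone_derivs(2)[OF f l, of 0] by (auto intro: DERIV_isCont)
    then have "(\<lambda>n. f (g (r n) l)) \<longlonglongrightarrow> f l"
      by (rule isCont_tendsto_compose) (use LIMSEQ_subseq_LIMSEQ[OF glim r, of l] in \<open>simp add: comp_def\<close>)
    ultimately show "(\<integral>s. exp (- (max 0 s * l)) \<partial>M0) = f l" by (rule LIMSEQ_unique)
  qed
qed

text \<open>Dividing by the limit at \<open>0\<close> reduces to total mass \<open>1\<close>. Pushing the representing measure forward along \<open>max 0\<close>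
  places it on the half-line without changing the integrals.\<close>

theorem Bernstein_bounded:
  assumes f: "completely_monotone f" and C: "\<And>x. x > 0 \<Longrightarrow> f x \<le> C"
  obtains \<mu> where "halfline_measure \<mu>" "\<And>\<tau>. \<tau> > 0 \<Longrightarrow> laplace \<mu> \<tau> = f \<tau>"
proof -
  obtain L where L: "(f \<longlongrightarrow> L) (at_right 0)" "\<And>x. x > 0 \<Longrightarrow> f x \<le> L" and "L \<le> C"
    by (rule antimono_tendsto_at_right_0[of f C, OF completely_monotone_antimono[OF f] C]) (rule that | assumption)+
  have f0: "f x \<ge> 0" if "x > 0" for x using f that by (simp add: completely_monotone_def)
  have L0: "L \<ge> 0" using L(2)[of 1] f0[of 1] by simp
  define g where "g x = (1 / L) * f x" for x
  obtain M where M: "real_distribution M" "\<And>l. l > 0 \<Longrightarrow> L * (\<integral>s. exp (- (max 0 s * l)) \<partial>M) = f l"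
  proof (cases "L = 0")
    case True
    obtain M :: "real measure" where "real_distribution M"
      using prob_space.real_distribution_distr[OF prob_space_return[of "0::real" borel], of id] by auto
    moreover have "f l = 0" if "l > 0" for l using L(2)[OF that] f0[OF that] True by simp
    ultimately show thesis using that True by simp
  next
    case False
    then have Lpos: "L > 0" using L0 by simp
    have "completely_monotone g" unfolding g_def using L0 by (intro completely_monotone_cmult f) simp
    moreover have "g x \<le> 1" if "x > 0" for x using L(2)[OF that] Lpos by (simp add: g_def)
    moreover have "(g \<longlongrightarrow> 1) (at_right 0)"
      using tendsto_mult[OF tendsto_const L(1), of "1 / L"] Lpos by (simp add: g_def[abs_def])
    ultimately obtain N where "real_distribution N" "\<And>l. l > 0 \<Longrightarrow> (\<integral>s. exp (- (max 0 s * l)) \<partial>N) = g l"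
      by (rule normalized_completely_monotone_representation[of g]) (rule that | assumption)+
    then show thesis using that Lpos by (simp add: g_def)
  qed
  interpret real_distribution M by (rule M(1))
  let ?N = "restrict_space borel {0..} :: real measure"
  define \<mu>1 where "\<mu>1 = distr M ?N (max 0)"
  define \<mu> where "\<mu> = density \<mu>1 (\<lambda>_. ennreal L)"
  have meas: "max 0 \<in> measurable M ?N"
    by (intro measurable_restrict_space2) (auto simp: measurable_finite_borel)
  interpret P: prob_space \<mu>1 unfolding \<mu>1_def by (rule prob_space_distr[OF meas])
  show thesis
  proof
    have "emeasure \<mu> (space \<mu>) \<noteq> \<infinity>"
      by (simp add: \<mu>_def emeasure_density P.emeasure_space_1)
    then show "halfline_measure \<mu>"
      unfolding halfline_measure_def by (auto intro!: finite_measureI simp: \<mu>_def \<mu>1_def)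
    fix l :: real assume l: "l > 0"
    have m: "(\<lambda>s. exp (- (s * l))) \<in> borel_measurable ?N"
      by (rule measurable_restrict_space1) simp
    have "laplace \<mu> l = (\<integral>s. L * exp (- (s * l)) \<partial>\<mu>1)"
      unfolding laplace_def \<mu>_def using m L0 by (subst integral_density) (auto simp: \<mu>1_def)
    also have "\<dots> = L * (\<integral>s. exp (- (s * l)) \<partial>\<mu>1)" by simp
    also have "(\<integral>s. exp (- (s * l)) \<partial>\<mu>1) = (\<integral>s. exp (- (max 0 s * l)) \<partial>M)"
      unfolding \<mu>1_def by (rule integral_distr[OF meas m])
    finally show "laplace \<mu> l = f l" using M(2)[OF l] by simp
  qed
qed

lemma halfline_integrable:
  assumes "halfline_measure \<mu>" "f \<in> (Cb :: (real \<Rightarrow> real) set)"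
  shows "integrable \<mu> f"
proof -
  interpret finite_measure \<mu> using assms by (simp add: halfline_measure_def)
  obtain C where "C \<ge> 0" "\<And>s. s \<ge> 0 \<Longrightarrow> norm (f s) \<le> C" using Cb_bound[OF assms(2)] by blast
  then show ?thesis
    by (intro integrable_const_bound[of _ C] halfline_measurable_Cb[OF assms] AE_I2)
       (auto simp: halfline_space[OF assms(1)])
qed

lemma halfline_nn_integral:
  assumes "halfline_measure \<mu>" "f \<in> (Cb :: (real \<Rightarrow> real) set)" "\<And>s. s \<ge> 0 \<Longrightarrow> f s \<ge> 0"
  shows "(\<integral>\<^sup>+ s. ennreal (f s) \<partial>\<mu>) = ennreal (\<integral>s. f s \<partial>\<mu>)"
  by (intro nn_integral_eq_integral halfline_integrable assms AE_I2)
     (simp add: halfline_space[OF assms(1)] assms(3))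

lemma inverse_Suc_at_right: "filterlim (\<lambda>n. inverse (real (Suc n))) (at_right 0) sequentially"
  by (intro filterlim_at[THEN iffD2] conjI LIMSEQ_inverse_real_of_nat) auto

text \<open>The Laplace transform increases to the total mass as its argument decreases to \<open>0\<close>.\<close>

lemma halfline_mass:
  assumes \<mu>: "halfline_measure \<mu>" and f: "\<And>\<tau>. \<tau> > 0 \<Longrightarrow> laplace \<mu> \<tau> = f \<tau>"
    and lim: "(f \<longlongrightarrow> L) (at_right 0)"
  shows "measure \<mu> {0..} = L"
proof -
  let ?e = "\<lambda>n s. exp (- (s * inverse (real (Suc n))))"
  have "(\<lambda>n. bochner \<mu> (\<lambda>s. ?e n s *\<^sub>R (1::real))) \<longlonglongrightarrow> bochner \<mu> (\<lambda>s. 1 *\<^sub>R (1::real))"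
  proof (rule bochner_dominated_convergence[OF \<mu>, where C=1])
    show "(\<lambda>s. ?e n s *\<^sub>R (1::real)) \<in> Cb" for n using Cb_exp by simp
    show "(\<lambda>s. 1 *\<^sub>R (1::real)) \<in> Cb" by (rule Cb_const)
    show "norm (?e n s *\<^sub>R (1::real)) \<le> 1" if "s \<ge> 0" for n s using that by simp
    show "(\<lambda>n. ?e n s *\<^sub>R (1::real)) \<longlonglongrightarrow> 1 *\<^sub>R 1" for s
    proof -
      have "(\<lambda>n. ?e n s *\<^sub>R (1::real)) \<longlonglongrightarrow> exp (- (s * 0)) *\<^sub>R 1"
        by (intro tendsto_intros LIMSEQ_inverse_real_of_nat)
      then show ?thesis by simp
    qed
  qed
  moreover have "bochner \<mu> (\<lambda>s. ?e n s *\<^sub>R (1::real)) = f (inverse (real (Suc n)))" for n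
    using bochner_scaleR_left[OF \<mu> Cb_exp, of "inverse (real (Suc n))" "1::real"] f[of "inverse (real (Suc n))"]
    by (simp add: laplace_def)
  moreover have "bochner \<mu> (\<lambda>s. 1 *\<^sub>R (1::real)) = measure \<mu> {0..}"
    using bochner_scaleR_left[OF \<mu> Cb_const[of 1], of "1::real"] by (simp add: halfline_space[OF \<mu>])
  ultimately have "(\<lambda>n. f (inverse (real (Suc n)))) \<longlonglongrightarrow> measure \<mu> {0..}" by simp
  moreover have "(\<lambda>n. f (inverse (real (Suc n)))) \<longlonglongrightarrow> L"
    by (rule filterlim_compose[OF lim inverse_Suc_at_right])
  ultimately show ?thesis by (rule LIMSEQ_unique)
qed

lemma bernstein_at_zero:
  assumes \<psi>: "bernstein \<psi>"
  shows "(\<psi> \<longlongrightarrow> at_zero \<psi>) (at_right 0)" "at_zero \<psi> \<ge> 0" "x > 0 \<Longrightarrow> at_zero \<psi> \<le> \<psi> x"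
proof -
  have anti: "- \<psi> y \<le> - \<psi> x" if "0 < x" "x \<le> y" for x y using bernstein_mono[OF \<psi> that] by simp
  have le: "- \<psi> x \<le> 0" if "x > 0" for x using bernstein_nonneg[OF \<psi> that] by simp
  obtain L where L: "((\<lambda>x. - \<psi> x) \<longlongrightarrow> L) (at_right 0)" "\<And>x. x > 0 \<Longrightarrow> - \<psi> x \<le> L" "L \<le> 0"
    by (rule antimono_tendsto_at_right_0[of "\<lambda>x. - \<psi> x" 0, OF anti le]) (rule that | assumption)+
  from tendsto_minus[OF L(1)] have l: "(\<psi> \<longlongrightarrow> - L) (at_right 0)" by simp
  then have "at_zero \<psi> = - L" unfolding at_zero_def by (intro tendsto_Lim) auto
  then show "(\<psi> \<longlongrightarrow> at_zero \<psi>) (at_right 0)" "at_zero \<psi> \<ge> 0" "x > 0 \<Longrightarrow> at_zero \<psi> \<le> \<psi> x"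
    using l L by (auto simp: minus_le_iff)
qed

section \<open>A finite representing measure for a Bernstein function\<close>

definition increment_measure :: "(real \<Rightarrow> real) \<Rightarrow> real measure \<Rightarrow> bool" where
  "increment_measure \<psi> \<rho> \<longleftrightarrow> halfline_measure \<rho> \<and> (\<forall>\<tau>>0. laplace \<rho> \<tau> = \<psi> (\<tau> + 1) - \<psi> \<tau>)"

lemma increment_measure_exists:
  assumes \<psi>: "bernstein \<psi>"
  obtains \<rho> where "increment_measure \<psi> \<rho>"
proof -
  have "\<psi> (x + 1) - \<psi> x \<le> \<psi> 1 - at_zero \<psi>" if x: "x > 0" for x
  proof -
    have "((\<lambda>y. \<psi> (y + 1) - \<psi> y) \<longlongrightarrow> \<psi> (0 + 1) - at_zero \<psi>) (at_right 0)"
    proof (intro tendsto_diff bernstein_at_zero[OF \<psi>])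
      have "isCont \<psi> (0 + 1)" using DERIV_isCont[OF bernstein_DERIV[OF \<psi>, of "0 + 1"]] by simp
      moreover have "((\<lambda>y. y + 1) \<longlongrightarrow> 0 + (1::real)) (at_right 0)" by (intro tendsto_intros)
      ultimately show "((\<lambda>y. \<psi> (y + 1)) \<longlongrightarrow> \<psi> (0 + 1)) (at_right 0)" by (rule isCont_tendsto_compose)
    qed
    then have "\<psi> (x + 1) - \<psi> x \<le> \<psi> (0 + 1) - at_zero \<psi>"
    proof (rule tendsto_lowerbound)
      have "eventually (\<lambda>y. 0 < y \<and> y < x) (at_right 0)"
        by (rule eventually_at_rightI[of 0 x]) (use x in auto)
      then show "eventually (\<lambda>y. \<psi> (x + 1) - \<psi> x \<le> \<psi> (y + 1) - \<psi> y) (at_right 0)"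
        by eventually_elim (use completely_monotone_antimono[OF completely_monotone_bernstein_increment[OF \<psi>, of 1]] in auto)
    qed simp
    then show ?thesis by simp
  qed
  from Bernstein_bounded[OF completely_monotone_bernstein_increment[OF \<psi>, of 1], of "\<psi> 1 - at_zero \<psi>", OF _ this]
  obtain \<rho> where "halfline_measure \<rho>" "\<And>\<tau>. \<tau> > 0 \<Longrightarrow> laplace \<rho> \<tau> = \<psi> (\<tau> + 1) - \<psi> \<tau>" by auto
  then show thesis using that by (auto simp: increment_measure_def)
qed

lemma increment_measure_mass:
  assumes \<psi>: "bernstein \<psi>" and \<rho>: "increment_measure \<psi> \<rho>"
  shows "measure \<rho> {0..} = \<psi> 1 - at_zero \<psi>"
proof (rule halfline_mass)
  show "halfline_measure \<rho>" "\<And>\<tau>. \<tau> > 0 \<Longrightarrow> laplace \<rho> \<tau> = \<psi> (\<tau> + 1) - \<psi> \<tau>"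
    using \<rho> by (auto simp: increment_measure_def)
  have "isCont \<psi> (0 + 1)" using DERIV_isCont[OF bernstein_DERIV[OF \<psi>, of "0 + 1"]] by simp
  moreover have "((\<lambda>y. y + 1) \<longlongrightarrow> 0 + (1::real)) (at_right 0)" by (intro tendsto_intros)
  ultimately have "((\<lambda>y. \<psi> (y + 1)) \<longlongrightarrow> \<psi> (0 + 1)) (at_right 0)" by (rule isCont_tendsto_compose)
  from tendsto_diff[OF this bernstein_at_zero(1)[OF \<psi>]]
  show "((\<lambda>y. \<psi> (y + 1) - \<psi> y) \<longlongrightarrow> \<psi> 1 - at_zero \<psi>) (at_right 0)" by simp
qed

text \<open>Telescoping \<open>\<psi>(k) = \<psi>(1) + \<Sum> (\<psi>(j + 1) - \<psi>(j))\<close>, where \<open>\<psi>(1) - \<psi>(0)\<close> is the total mass of \<open>\<rho>\<close>. The integrand is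
  \<open>(1 - e\<^sup>-\<^sup>u\<^sup>k) / (1 - e\<^sup>-\<^sup>u)\<close>, written so that \<open>u = 0\<close> is included.\<close>

lemma bernstein_of_nat_eq:
  assumes \<psi>: "bernstein \<psi>" and \<rho>: "increment_measure \<psi> \<rho>" and k: "k \<ge> 1"
  shows "\<psi> (real k) = at_zero \<psi> + (\<integral>u. (\<Sum>j<k. exp (- (u * real j))) \<partial>\<rho>)"
  using k
proof (induction k rule: dec_induct)
  case base
  show ?case using increment_measure_mass[OF \<psi> \<rho>] \<rho>
    by (simp add: increment_measure_def halfline_space)
next
  case (step k)
  have h: "halfline_measure \<rho>" using \<rho> by (simp add: increment_measure_def)
  have int: "integrable \<rho> (\<lambda>u. exp (- (u * real j)))" for j
    by (rule halfline_integrable[OF h Cb_exp]) simp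
  have "(\<integral>u. (\<Sum>j<Suc k. exp (- (u * real j))) \<partial>\<rho>)
     = (\<integral>u. (\<Sum>j<k. exp (- (u * real j))) \<partial>\<rho>) + laplace \<rho> (real k)"
    unfolding laplace_def sum.lessThan_Suc
    by (intro Bochner_Integration.integral_add Bochner_Integration.integrable_sum int)
  moreover have "laplace \<rho> (real k) = \<psi> (real (Suc k)) - \<psi> (real k)"
    using \<rho> step by (simp add: increment_measure_def add.commute)
  ultimately show ?case using step by simp
qed

text \<open>The Todd function, written \<open>q\<close> in the comments and continuous at \<open>0\<close>. It is the factor between \<open>\<rho>\<close> and the measure that represents \<open>\<psi>'\<close>.\<close>

definition todd :: "real \<Rightarrow> real" where
  "todd u = (if u = 0 then 1 else u / (1 - exp (- u)))"

lemma bernstein_increment_bounds: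
  assumes \<psi>: "bernstein \<psi>" and x: "x > 0" and h: "h > 0"
  shows "\<psi> (x + h) - \<psi> x \<le> h * deriv \<psi> x" "h * deriv \<psi> (x + h) \<le> \<psi> (x + h) - \<psi> x"
proof -
  obtain z where z: "x < z" "z < x + h" "\<psi> (x + h) - \<psi> x = (x + h - x) * deriv \<psi> z"
    using MVT2[of x "x + h" \<psi> "deriv \<psi>"] bernstein_DERIV[OF \<psi>] x h by auto
  note anti = completely_monotone_antimono[OF bernstein_completely_monotone_deriv[OF \<psi>]]
  show "\<psi> (x + h) - \<psi> x \<le> h * deriv \<psi> x" "h * deriv \<psi> (x + h) \<le> \<psi> (x + h) - \<psi> x"
    using z h anti[of x z] anti[of z "x + h"] x by (auto intro!: mult_left_mono)
qed

text \<open>The derivative is bounded below by difference quotients of step \<open>1 / N\<close>, corrected so that they involve only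
  increments of length \<open>1\<close>: concavity gives
  \<open>N (\<psi>(s + 1 / N) - \<psi>(s)) - N (\<psi>(s + N + 1 / N) - \<psi>(s + N)) + (\<psi>(s + N + 2) - \<psi>(s + N + 1)) \<le> \<psi>'(s)\<close>, and the left side is an
  integral against \<open>\<rho>\<close>. Its integrand tends to \<open>q(u) e\<^sup>-\<^sup>s\<^sup>u\<close>, so Fatou's lemma applies.\<close>

lemma increment_measure_le_deriv:
  assumes \<psi>: "bernstein \<psi>" and \<rho>: "increment_measure \<psi> \<rho>" and s: "s > 0"
  shows "(\<integral>\<^sup>+ u. ennreal (todd u * exp (- (u * s))) \<partial>\<rho>) \<le> ennreal (deriv \<psi> s)"
proof -
  have h: "halfline_measure \<rho>" using \<rho> by (simp add: increment_measure_def)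
  have lap: "laplace \<rho> \<tau> = \<psi> (\<tau> + 1) - \<psi> \<tau>" if "\<tau> > 0" for \<tau>
    using \<rho> that by (simp add: increment_measure_def)
  have int: "integrable \<rho> (\<lambda>u. exp (- (u * \<tau>)))" if "\<tau> > 0" for \<tau>
    by (rule halfline_integrable[OF h Cb_exp]) (use that in simp)
  define N where "N n = real (Suc n)" for n
  have N: "N n > 0" "N n \<ge> 1" for n by (auto simp: N_def)
  \<comment> \<open>The last summand vanishes in the limit for \<open>u > 0\<close> and supplies the value \<open>1\<close> at \<open>u = 0\<close>, where all others are \<open>0\<close>.\<close>
  define H where "H n u = (\<Sum>k<Suc n. N n * (exp (- (u * (s + real k))) - exp (- (u * (s + real k + 1 / N n)))))
      + exp (- (u * (s + N n + 1)))" for n u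
  have HCb: "H n \<in> Cb" for n
  proof -
    have nn: "s + real k \<ge> 0" "s + real k + 1 / N n \<ge> 0" "s + N n + 1 \<ge> 0" for k
      using s N(1)[of n] by (auto intro!: add_nonneg_nonneg)
    have "(\<lambda>u. N n * (exp (- (u * (s + real k))) - exp (- (u * (s + real k + 1 / N n))))) \<in> Cb" for k
      using Cb_scaleR[OF Cb_diff[OF Cb_exp[OF nn(1)[of k]] Cb_exp[OF nn(2)[of k]]], of "N n"] by simp
    from Cb_add[OF Cb_sum[OF this] Cb_exp[OF nn(3)]] show ?thesis unfolding H_def[abs_def] .
  qed
  have H0: "H n u \<ge> 0" if "u \<ge> 0" for n u
    unfolding H_def using that N(1)[of n]
    by (intro add_nonneg_nonneg sum_nonneg mult_nonneg_nonneg) (auto simp: algebra_simps)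
  have intH: "(\<integral>u. H n u \<partial>\<rho>) \<le> deriv \<psi> s" for n
  proof -
    have p: "s + real k > 0" "s + real k + 1 / N n > 0" "s + N n + 1 > 0" for k
      using s N(1)[of n] by (auto intro!: add_pos_nonneg)
    have "(\<integral>u. H n u \<partial>\<rho>) = (\<Sum>k<Suc n. N n * (laplace \<rho> (s + real k) - laplace \<rho> (s + real k + 1 / N n)))
        + laplace \<rho> (s + N n + 1)"
      unfolding H_def laplace_def using p int by (simp add: Bochner_Integration.integral_sum)
    also have "\<dots> = N n * ((\<psi> (s + N n) - \<psi> s) - (\<psi> (s + N n + 1 / N n) - \<psi> (s + 1 / N n))) + laplace \<rho> (s + N n + 1)"
    proof -
      have 1: "(\<Sum>k<Suc n. laplace \<rho> (x + real k)) = \<psi> (x + N n) - \<psi> x" if "x > 0" for x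
      proof -
        have "(\<Sum>k<Suc n. laplace \<rho> (x + real k)) = (\<Sum>k<Suc n. \<psi> (x + real (Suc k)) - \<psi> (x + real k))"
          using that by (intro sum.cong refl) (simp add: lap add_pos_nonneg add_ac)
        then show ?thesis
          using sum_lessThan_telescope[of "\<lambda>k. \<psi> (x + real k)" "Suc n"] by (simp add: N_def)
      qed
      have "(\<Sum>k<Suc n. N n * (laplace \<rho> (s + real k) - laplace \<rho> (s + real k + 1 / N n))) =
          N n * ((\<Sum>k<Suc n. laplace \<rho> (s + real k)) - (\<Sum>k<Suc n. laplace \<rho> ((s + 1 / N n) + real k)))"
        by (simp only: sum_subtractf[symmetric] sum_distrib_left) (simp add: add_ac)
      also have "\<dots> = N n * ((\<psi> (s + N n) - \<psi> s) - (\<psi> (s + N n + 1 / N n) - \<psi> (s + 1 / N n)))"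
        using 1[of s] 1[of "s + 1 / N n"] s N(1)[of n] by (simp add: add_pos_nonneg add_ac)
      finally show ?thesis by simp
    qed
    also have "\<dots> \<le> deriv \<psi> s"
    proof -
      have sN: "s + N n > 0" "s + N n + 1 > 0" "1 / N n > 0" using s N(1)[of n] by auto
      have "N n * (\<psi> (s + 1 / N n) - \<psi> s) \<le> N n * (1 / N n * deriv \<psi> s)"
        using N(1)[of n] bernstein_increment_bounds(1)[OF \<psi> s sN(3)] by (intro mult_left_mono) auto
      then have a: "N n * (\<psi> (s + 1 / N n) - \<psi> s) \<le> deriv \<psi> s" using N(1)[of n] by simp
      have "N n * (1 / N n * deriv \<psi> (s + N n + 1 / N n)) \<le> N n * (\<psi> (s + N n + 1 / N n) - \<psi> (s + N n))"
        using N(1)[of n] bernstein_increment_bounds(2)[OF \<psi> sN(1) sN(3)] by (intro mult_left_mono) auto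
      then have b: "deriv \<psi> (s + N n + 1 / N n) \<le> N n * (\<psi> (s + N n + 1 / N n) - \<psi> (s + N n))"
        using N(1)[of n] by simp
      have "laplace \<rho> (s + N n + 1) \<le> deriv \<psi> (s + N n + 1)"
        using bernstein_increment_bounds(1)[OF \<psi> sN(2), of 1] lap[OF sN(2)] by simp
      also have "\<dots> \<le> deriv \<psi> (s + N n + 1 / N n)"
        using s N[of n] by (intro completely_monotone_antimono[OF bernstein_completely_monotone_deriv[OF \<psi>]])
          (auto simp: divide_le_eq intro!: add_pos_nonneg)
      finally show ?thesis using a b by (simp add: algebra_simps)
    qed
    finally show ?thesis .
  qed
  have limH: "(\<lambda>n. H n u) \<longlonglongrightarrow> todd u * exp (- (u * s))" if u: "u \<ge> 0" for u
  proof (cases "u = 0")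
    case True
    then show ?thesis by (simp add: H_def todd_def)
  next
    case False
    then have u0: "u > 0" using u by simp
    have 1: "exp (- u) < 1" using u0 by simp
    have H_eq: "H n u = exp (- (u * s)) * ((N n * (1 - exp (- (u / N n)))) * (\<Sum>k<Suc n. exp (- u) ^ k))
        + exp (- (u * (s + 1))) * exp (- u) ^ Suc n" for n
    proof -
      have e1: "exp (- (u * (s + real k))) = exp (- (u * s)) * exp (- u) ^ k" for k
        by (simp add: algebra_simps flip: exp_of_nat_mult exp_add)
      have e2: "exp (- (u * (s + real k + 1 / N n))) = exp (- (u * s)) * exp (- u) ^ k * exp (- (u / N n))" for k
        unfolding e1[symmetric] by (simp add: algebra_simps flip: exp_add)
      have e3: "exp (- (u * (s + N n + 1))) = exp (- (u * (s + 1))) * exp (- u) ^ Suc n"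
        unfolding N_def by (simp add: algebra_simps flip: exp_of_nat_mult exp_add)
      show ?thesis unfolding H_def e1 e2 e3 sum_distrib_left
        by (intro arg_cong2[where f="(+)"] sum.cong refl) (simp add: algebra_simps)
    qed
    have "(\<lambda>n. exp (- (u * s)) * ((N n * (1 - exp (- (u / N n)))) * (\<Sum>k<Suc n. exp (- u) ^ k))
        + exp (- (u * (s + 1))) * exp (- u) ^ Suc n)
      \<longlonglongrightarrow> exp (- (u * s)) * (u * (1 / (1 - exp (- u)))) + exp (- (u * (s + 1))) * 0"
    proof (intro tendsto_add tendsto_mult tendsto_const)
      show "(\<lambda>n. N n * (1 - exp (- (u / N n)))) \<longlonglongrightarrow> u"
        unfolding N_def by (rule Suc_times_one_minus_exp_tendsto)
      show "(\<lambda>n. \<Sum>k<Suc n. exp (- u) ^ k) \<longlonglongrightarrow> 1 / (1 - exp (- u))"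
        using LIMSEQ_Suc[OF geometric_sums[of "exp (- u)", unfolded sums_def]] 1 by simp
      show "(\<lambda>n. exp (- u) ^ Suc n) \<longlonglongrightarrow> 0"
        using 1 by (intro LIMSEQ_Suc LIMSEQ_realpow_zero) auto
    qed
    then show ?thesis unfolding H_eq using False by (simp add: todd_def mult.commute)
  qed
  have "(\<integral>\<^sup>+ u. ennreal (todd u * exp (- (u * s))) \<partial>\<rho>) = (\<integral>\<^sup>+ u. liminf (\<lambda>n. ennreal (H n u)) \<partial>\<rho>)"
    using limH by (intro nn_integral_cong) (auto simp: halfline_space[OF h] intro!: lim_imp_Liminf[symmetric] tendsto_ennrealI)
  also have "\<dots> \<le> liminf (\<lambda>n. \<integral>\<^sup>+ u. ennreal (H n u) \<partial>\<rho>)"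
    using halfline_measurable_Cb[OF h HCb] by (intro nn_integral_liminf) measurable
  also have "\<dots> \<le> liminf (\<lambda>n. ennreal (deriv \<psi> s))"
    by (intro Liminf_mono always_eventually allI)
       (simp add: halfline_nn_integral[OF h HCb H0] intH ennreal_leI)
  also have "\<dots> = ennreal (deriv \<psi> s)" by (simp add: Liminf_const)
  finally show ?thesis .
qed

text \<open>In \<open>\<psi>(z) / (1 + z) = \<psi>(z + 2) / (z + 1) - (\<psi>(z + 2) - \<psi>(z)) / (z + 1)\<close> both terms are completely monotone and bounded,
  by \<open>\<psi>(2)\<close>, so Bernstein's theorem represents each of them.\<close>

lemma laplace_pair_exists:
  assumes \<psi>: "bernstein \<psi>"
  obtains p where "laplace_pair (\<lambda>z. \<psi> z / (1 + z)) p"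
proof -
  have c1: "completely_monotone (\<lambda>z. 1 / (z + 1))"
  proof -
    \<comment> \<open>The reciprocal \<open>1 / (z + 1)\<close> is the quotient above for the constant Bernstein function \<open>1\<close>.\<close>
    have "bernstein (\<lambda>z. 1)"
    proof -
      have d: "deriv (\<lambda>z::real. 1::real) = (\<lambda>z. 0)" "deriv (\<lambda>z::real. 0::real) = (\<lambda>z. 0)" by auto
      have "(deriv ^^ n) (\<lambda>z. 0::real) = (\<lambda>z::real. 0)" for n by (induction n) (auto simp: d)
      then have cm: "completely_monotone (\<lambda>z. 0)" by (auto simp: completely_monotone_def smooth_pos_def)
      have "(deriv ^^ n) (\<lambda>z. 1::real) differentiable at (\<tau>::real)" for n \<tau>
        using \<open>\<And>n. (deriv ^^ n) (\<lambda>z. 0::real) = (\<lambda>z::real. 0)\<close> by (cases n) (auto simp: funpow_Suc_right d simp del: funpow.simps)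
      then show ?thesis using cm by (auto simp: bernstein_def smooth_pos_def d)
    qed
    from completely_monotone_shift[OF completely_monotone_bernstein_quotient[OF this], of 1]
    show ?thesis by simp
  qed
  let ?f1 = "\<lambda>z. \<psi> ((z + 1) + 1) / (z + 1)" and ?f2 = "\<lambda>z. (\<psi> (z + 2) - \<psi> z) * (1 / (z + 1))"
  have f1: "completely_monotone ?f1"
    using completely_monotone_shift[OF completely_monotone_bernstein_quotient[OF \<psi>], of 1] by simp
  have f2: "completely_monotone ?f2"
    by (intro completely_monotone_mult completely_monotone_bernstein_increment \<psi> c1) simp
  have b2: "?f2 x \<le> \<psi> 2" and b1: "?f1 x \<le> \<psi> 2" if x: "x > 0" for x
  proof -
    \<comment> \<open>Concavity: the slope \<open>\<psi>'(2)\<close> is at most that of the chord from \<open>0\<close> to \<open>2\<close>, and \<open>\<psi>(0) \<ge> 0\<close>.\<close>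
    have "\<psi> (x + 2) \<le> (x + 1) * \<psi> 2"
    proof -
      have "deriv \<psi> 2 * 2 \<le> \<psi> 2"
      proof -
        have *: "deriv \<psi> 2 * (2 - e) \<le> \<psi> 2" if "e > 0" "e < 2" for e
          using bernstein_increment_bounds(2)[OF \<psi> that(1), of "2 - e"] that bernstein_nonneg[OF \<psi> that(1)]
          by (simp add: algebra_simps)
        have "((\<lambda>e. deriv \<psi> 2 * (2 - e)) \<longlongrightarrow> deriv \<psi> 2 * (2 - 0)) (at_right 0)" by (intro tendsto_intros)
        then have "deriv \<psi> 2 * (2 - 0) \<le> \<psi> 2"
        proof (rule tendsto_upperbound)
          show "eventually (\<lambda>e. deriv \<psi> 2 * (2 - e) \<le> \<psi> 2) (at_right 0)"
            by (rule eventually_at_rightI[of 0 2]) (use * in auto)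
        qed simp
        then show ?thesis by simp
      qed
      moreover have "\<psi> (x + 2) - \<psi> 2 \<le> x * deriv \<psi> 2"
        using bernstein_increment_bounds(1)[OF \<psi> _ x, of 2] by (simp add: add.commute)
      moreover have "x * (deriv \<psi> 2 * 2) \<le> x * \<psi> 2" "x * deriv \<psi> 2 \<ge> 0"
        using calculation(1) x bernstein_deriv_nonneg[OF \<psi>, of 2] by (auto intro!: mult_left_mono mult_nonneg_nonneg)
      ultimately show ?thesis by (simp add: algebra_simps)
    qed
    then show "?f1 x \<le> \<psi> 2" using x by (simp add: divide_le_eq add.commute mult.commute)
    moreover have "?f2 x \<le> ?f1 x"
      using x bernstein_nonneg[OF \<psi> x] by (simp add: divide_right_mono add.commute)
    ultimately show "?f2 x \<le> \<psi> 2" by linarith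
  qed
  obtain \<mu> where \<mu>: "halfline_measure \<mu>" "\<And>\<tau>. \<tau> > 0 \<Longrightarrow> laplace \<mu> \<tau> = ?f1 \<tau>"
    by (rule Bernstein_bounded[OF f1 b1]) (rule that | assumption)+
  obtain \<nu> where \<nu>: "halfline_measure \<nu>" "\<And>\<tau>. \<tau> > 0 \<Longrightarrow> laplace \<nu> \<tau> = ?f2 \<tau>"
    by (rule Bernstein_bounded[OF f2 b2]) (rule that | assumption)+
  have "\<psi> z / (1 + z) = laplace \<mu> z - laplace \<nu> z" if "z > 0" for z
    using \<mu>(2)[OF that] \<nu>(2)[OF that] that by (simp add: field_simps)
  then have "laplace_pair (\<lambda>z. \<psi> z / (1 + z)) (\<mu>, \<nu>)"
    using \<mu>(1) \<nu>(1) by (simp add: laplace_pair_def)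
  then show thesis by (rule that)
qed

text \<open>Bernstein's theorem for \<open>e\<^sup>-\<^sup>t\<^sup>\<phi>\<close>. The mass is the limit of the Laplace transform at \<open>0\<close>.\<close>

lemma subordinator:
  assumes \<phi>: "bernstein \<phi>" and t: "t \<ge> 0"
  shows "halfline_measure (subordinator \<phi> t)"
    "\<tau> > 0 \<Longrightarrow> laplace (subordinator \<phi> t) \<tau> = exp (- t * \<phi> \<tau>)"
    "measure (subordinator \<phi> t) {0..} = exp (- t * at_zero \<phi>)"
proof -
  have le1: "exp (- t * \<phi> x) \<le> 1" if "x > 0" for x
    using t bernstein_nonneg[OF \<phi> that] by simp
  obtain \<mu> where \<mu>: "halfline_measure \<mu>" "\<And>\<tau>. \<tau> > 0 \<Longrightarrow> laplace \<mu> \<tau> = exp (- t * \<phi> \<tau>)"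
    by (rule Bernstein_bounded[OF completely_monotone_exp_bernstein[OF \<phi> t] le1]) (rule that | assumption)+
  have lim: "((\<lambda>\<tau>. exp (- t * \<phi> \<tau>)) \<longlongrightarrow> exp (- t * at_zero \<phi>)) (at_right 0)"
    by (intro tendsto_intros bernstein_at_zero[OF \<phi>])
  have mass: "measure \<nu> {0..} = exp (- t * at_zero \<phi>)"
    if "halfline_measure \<nu>" "\<And>\<tau>. \<tau> > 0 \<Longrightarrow> laplace \<nu> \<tau> = exp (- t * \<phi> \<tau>)" for \<nu>
    by (rule halfline_mass[OF that lim])
  interpret finite_measure \<mu> using \<mu>(1) by (simp add: halfline_measure_def)
  have "emeasure \<mu> (space \<mu>) \<le> 1"
    using mass[OF \<mu>] bernstein_at_zero(2)[OF \<phi>] t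
    by (simp add: emeasure_eq_measure halfline_space[OF \<mu>(1)])
  then have "\<exists>\<mu>. halfline_measure \<mu> \<and> emeasure \<mu> (space \<mu>) \<le> 1 \<and> (\<forall>\<tau>>0. laplace \<mu> \<tau> = exp (- t * \<phi> \<tau>))"
    using \<mu> by blast
  from someI_ex[OF this]
  have *: "halfline_measure (subordinator \<phi> t)" "\<And>\<tau>. \<tau> > 0 \<Longrightarrow> laplace (subordinator \<phi> t) \<tau> = exp (- t * \<phi> \<tau>)"
    unfolding subordinator_def by auto
  show "halfline_measure (subordinator \<phi> t)" by (rule *)
  show "\<tau> > 0 \<Longrightarrow> laplace (subordinator \<phi> t) \<tau> = exp (- t * \<phi> \<tau>)" by (rule *)
  show "measure (subordinator \<phi> t) {0..} = exp (- t * at_zero \<phi>)" by (rule mass[OF *])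
qed

lemma todd_measurable [measurable]: "todd \<in> borel_measurable borel"
  unfolding todd_def[abs_def] by measurable

lemma todd_nonneg: "u \<ge> 0 \<Longrightarrow> todd u \<ge> 0"
  by (simp add: todd_def)

lemma todd_le: "u \<ge> 0 \<Longrightarrow> todd u \<le> 1 + u"
proof -
  assume u: "u \<ge> 0"
  show ?thesis
  proof (cases "u = 0")
    case False
    then have "1 - exp (- u) > 0" using u by simp
    moreover have "(1 + u) * exp (- u) \<le> 1"
      using exp_ge_add_one_self[of u] by (simp add: exp_minus field_simps)
    ultimately show ?thesis using False by (simp add: todd_def divide_le_eq algebra_simps)
  qed (simp add: todd_def)
qed

lemma nn_integral_Ioi_eq_Ici:
  "(\<integral>\<^sup>+ s. f s * indicator {0<..} s \<partial>lborel) = (\<integral>\<^sup>+ s. f s * indicator {0::real..} s \<partial>lborel)"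
  using AE_lborel_singleton[of "0::real"]
  by (intro nn_integral_cong_AE) (auto elim!: eventually_mono split: split_indicator)

text \<open>The value is \<open>1 / c\<close> for \<open>c > 0\<close>. The integral itself is used because it is the right extension to \<open>c = 0\<close> and is
  the form in which Tonelli's theorem applies.\<close>

abbreviation exp_int :: "real \<Rightarrow> ennreal" where
  "exp_int c \<equiv> (\<integral>\<^sup>+ s. ennreal (exp (- (s * c))) * indicator {0<..} s \<partial>lborel)"

lemma nn_integral_exp_Ioi:
  assumes c: "c > 0"
  shows "exp_int c = ennreal (1 / c)"
proof -
  have "exp_int c
      = (\<integral>\<^sup>+ s. ennreal (exp (- (s * c))) * indicator {0..} s \<partial>lborel)"
    by (rule nn_integral_Ioi_eq_Ici)
  also have "\<dots> = ennreal (0 - (- exp (- (0 * c)) / c))"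
  proof (rule nn_integral_FTC_atLeast)
    show "((\<lambda>s. - exp (- (s * c)) / c) has_real_derivative exp (- (x * c))) (at x)" for x
      using c by (auto intro!: derivative_eq_intros)
    have "filterlim (\<lambda>s. c * s) at_top at_top"
      using c by (intro filterlim_tendsto_pos_mult_at_top[OF tendsto_const _ filterlim_ident])
    then have "((\<lambda>s. exp (- (c * s))) \<longlongrightarrow> 0) at_top"
      by (intro filterlim_compose[OF exp_at_bot]) (simp add: filterlim_uminus_at_bot)
    then have "((\<lambda>s. - exp (- (s * c)) / c) \<longlongrightarrow> - 0 / c) at_top"
      using c by (intro tendsto_intros) (simp_all add: mult.commute)
    then show "((\<lambda>s. - exp (- (s * c)) / c) \<longlongrightarrow> 0) at_top" by simp
  qed auto
  finally show ?thesis by simp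
qed

text \<open>Interchanging the integrals leaves, for each \<open>s > 0\<close>, the product of the Laplace transform of \<open>\<mu>\<close> at \<open>s\<close> and of
  \<open>\<integral> q(u) e\<^sup>-\<^sup>s\<^sup>u \<rho>(du) \<le> \<psi>'(s)\<close>. The law of the subordinator gives \<open>J\<close>; the point mass at \<open>1 / c\<close> gives \<open>C[c; \<psi>]\<close>.\<close>

lemma increment_measure_Tonelli_le:
  fixes \<mu> :: "real measure"
  assumes \<psi>: "bernstein \<psi>" and \<rho>: "increment_measure \<psi> \<rho>"
    and \<mu>: "finite_measure \<mu>" "sets \<mu> = sets borel"
    and g: "\<And>s. s > 0 \<Longrightarrow> (\<integral>\<^sup>+ r. ennreal (exp (- (r * s))) \<partial>\<mu>) \<le> ennreal (g s)" "\<And>s. s > 0 \<Longrightarrow> g s \<ge> 0"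
  shows "(\<integral>\<^sup>+ r. (\<integral>\<^sup>+ u. ennreal (todd u) *
           exp_int (r + u) \<partial>\<rho>) \<partial>\<mu>) \<le> J_int g \<psi>"
proof -
  have h: "halfline_measure \<rho>" using \<rho> by (simp add: increment_measure_def)
  have idm: "(\<lambda>u. u) \<in> borel_measurable \<rho>"
    by (rule halfline_measurable[OF h]) (intro continuous_intros)
  \<comment> \<open>The image on the whole line has the Borel sigma-algebra, for which joint measurability is immediate.\<close>
  define \<rho>' where "\<rho>' = distr \<rho> borel (\<lambda>u. u)"
  interpret R0: finite_measure \<rho> using h by (simp add: halfline_measure_def)
  interpret R: finite_measure \<rho>' unfolding \<rho>'_def by (rule R0.finite_measure_distr[OF idm])
  interpret m: finite_measure \<mu> by (rule \<mu>)
  have [measurable_cong]: "sets \<rho>' = sets borel" by (simp add: \<rho>'_def)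
  note [measurable_cong] = \<mu>(2)
  have conv: "(\<integral>\<^sup>+ u. f u \<partial>\<rho>) = (\<integral>\<^sup>+ u. f u \<partial>\<rho>')" if "f \<in> borel_measurable borel" for f
    unfolding \<rho>'_def by (rule nn_integral_distr[OF idm, symmetric]) (simp add: that)
  interpret Rl: pair_sigma_finite \<rho>' lborel ..
  interpret ml: pair_sigma_finite \<mu> lborel ..
  let ?q = "\<lambda>u. ennreal (todd u)"
  let ?F = "\<lambda>s r u. ?q u * (ennreal (exp (- (s * (r + u)))) * indicator {0<..} s)"
  have "(\<integral>\<^sup>+ r. (\<integral>\<^sup>+ u. ?q u *
           exp_int (r + u) \<partial>\<rho>) \<partial>\<mu>)
      = (\<integral>\<^sup>+ r. (\<integral>\<^sup>+ u. (\<integral>\<^sup>+ s. ?F s r u \<partial>lborel) \<partial>\<rho>') \<partial>\<mu>)"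
    by (subst conv) (auto simp: nn_integral_cmult)
  also have "\<dots> = (\<integral>\<^sup>+ r. (\<integral>\<^sup>+ s. (\<integral>\<^sup>+ u. ?F s r u \<partial>\<rho>') \<partial>lborel) \<partial>\<mu>)"
    by (intro nn_integral_cong Rl.Fubini'[symmetric]) measurable
  also have "\<dots> = (\<integral>\<^sup>+ s. (\<integral>\<^sup>+ r. (\<integral>\<^sup>+ u. ?F s r u \<partial>\<rho>') \<partial>\<mu>) \<partial>lborel)"
    by (intro ml.Fubini'[symmetric]) measurable
  also have "\<dots> \<le> (\<integral>\<^sup>+ s. ennreal (g s * deriv \<psi> s) * indicator {0<..} s \<partial>lborel)"
  proof (rule nn_integral_mono)
    fix s :: real
    show "(\<integral>\<^sup>+ r. (\<integral>\<^sup>+ u. ?F s r u \<partial>\<rho>') \<partial>\<mu>) \<le> ennreal (g s * deriv \<psi> s) * indicator {0<..} s"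
    proof (cases "s > 0")
      case True
      have F: "?F s r u = ennreal (exp (- (r * s))) * ennreal (todd u * exp (- (u * s)))" for r u
      proof -
        have "exp (- (s * (r + u))) = exp (- (r * s)) * exp (- (u * s))"
          by (simp add: algebra_simps flip: exp_add)
        then show ?thesis using True by (simp add: ennreal_mult'' mult_ac)
      qed
      have "(\<integral>\<^sup>+ r. (\<integral>\<^sup>+ u. ?F s r u \<partial>\<rho>') \<partial>\<mu>)
        = (\<integral>\<^sup>+ r. ennreal (exp (- (r * s))) \<partial>\<mu>) * (\<integral>\<^sup>+ u. ennreal (todd u * exp (- (u * s))) \<partial>\<rho>')"
        unfolding F by (simp add: nn_integral_cmult nn_integral_multc)
      also have "(\<integral>\<^sup>+ u. ennreal (todd u * exp (- (u * s))) \<partial>\<rho>')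
          = (\<integral>\<^sup>+ u. ennreal (todd u * exp (- (u * s))) \<partial>\<rho>)"
        by (rule conv[symmetric]) measurable
      also have "(\<integral>\<^sup>+ r. ennreal (exp (- (r * s))) \<partial>\<mu>) * \<dots> \<le> ennreal (g s) * ennreal (deriv \<psi> s)"
        by (intro mult_mono g increment_measure_le_deriv[OF \<psi> \<rho>] True) auto
      also have "\<dots> = ennreal (g s * deriv \<psi> s)"
        by (rule ennreal_mult[symmetric]) (use g(2)[OF True] bernstein_deriv_nonneg[OF \<psi> True] in auto)
      finally show ?thesis using True by simp
    qed simp
  qed
  finally show ?thesis by (simp add: J_int_def)
qed

lemma increment_measure_J_le:
  assumes \<psi>: "bernstein \<psi>" and \<rho>: "increment_measure \<psi> \<rho>" and \<phi>: "bernstein \<phi>" and t: "t \<ge> 0"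
  shows "(\<integral>\<^sup>+ r. (\<integral>\<^sup>+ u. ennreal (todd u) *
           exp_int (r + u) \<partial>\<rho>) \<partial>subordinator \<phi> t)
       \<le> J_int (\<lambda>s. exp (- t * \<phi> s)) \<psi>"
proof -
  let ?\<mu> = "subordinator \<phi> t"
  have h: "halfline_measure ?\<mu>" by (rule subordinator[OF \<phi> t])
  have idm: "(\<lambda>u. u) \<in> borel_measurable ?\<mu>"
    by (rule halfline_measurable[OF h]) (intro continuous_intros)
  interpret m: finite_measure ?\<mu> using h by (simp add: halfline_measure_def)
  interpret R0: finite_measure \<rho> using \<rho> by (simp add: halfline_measure_def increment_measure_def)
  have idr: "(\<lambda>u. u) \<in> borel_measurable \<rho>"
    using \<rho> by (intro halfline_measurable continuous_intros) (simp add: increment_measure_def)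
  let ?G = "\<lambda>r. \<integral>\<^sup>+ u. ennreal (todd u) *
           exp_int (r + u) \<partial>\<rho>"
  have G: "?G \<in> borel_measurable borel"
    using idr by measurable
  have "(\<integral>\<^sup>+ r. ?G r \<partial>?\<mu>) = (\<integral>\<^sup>+ r. ?G r \<partial>distr ?\<mu> borel (\<lambda>r. r))"
    by (rule nn_integral_distr[OF idm, symmetric]) (simp only: measurable_distr_eq1 G)
  also have "\<dots> \<le> J_int (\<lambda>s. exp (- t * \<phi> s)) \<psi>"
  proof (rule increment_measure_Tonelli_le[OF \<psi> \<rho>])
    show "finite_measure (distr ?\<mu> borel (\<lambda>r. r))" by (rule m.finite_measure_distr[OF idm])
    fix s :: real assume s: "s > 0"
    have "(\<integral>\<^sup>+ r. ennreal (exp (- (r * s))) \<partial>distr ?\<mu> borel (\<lambda>r. r)) = (\<integral>\<^sup>+ r. ennreal (exp (- (r * s))) \<partial>?\<mu>)"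
      by (rule nn_integral_distr[OF idm]) simp
    also have "\<dots> = ennreal (laplace ?\<mu> s)"
      unfolding laplace_def by (rule halfline_nn_integral[OF h Cb_exp]) (use s in auto)
    finally show "(\<integral>\<^sup>+ r. ennreal (exp (- (r * s))) \<partial>distr ?\<mu> borel (\<lambda>r. r)) \<le> ennreal (exp (- t * \<phi> s))"
      using subordinator(2)[OF \<phi> t s] by simp
  qed auto
  finally show ?thesis .
qed

lemma increment_measure_C_le:
  assumes \<psi>: "bernstein \<psi>" and \<rho>: "increment_measure \<psi> \<rho>" and c: "c > 0"
  shows "(\<integral>\<^sup>+ u. ennreal (todd u / (1 / c + u)) \<partial>\<rho>) \<le> C_int c \<psi>"
proof -
  have h: "halfline_measure \<rho>" using \<rho> by (simp add: increment_measure_def)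
  have idr: "(\<lambda>u. u) \<in> borel_measurable \<rho>"
    by (rule halfline_measurable[OF h]) (intro continuous_intros)
  interpret R0: finite_measure \<rho> using h by (simp add: halfline_measure_def)
  let ?G = "\<lambda>r. \<integral>\<^sup>+ u. ennreal (todd u) *
           exp_int (r + u) \<partial>\<rho>"
  have G: "?G \<in> borel_measurable borel"
    using idr by measurable
  interpret P: prob_space "return borel (1 / c)" by (rule prob_space_return) simp
  have "(\<integral>\<^sup>+ u. ennreal (todd u / (1 / c + u)) \<partial>\<rho>) = ?G (1 / c)"
  proof (rule nn_integral_cong)
    fix u assume "u \<in> space \<rho>"
    then have u: "u \<ge> 0" by (simp add: halfline_space[OF h])
    then have "1 / c + u > 0" using c by (simp add: add_pos_nonneg)
    from nn_integral_exp_Ioi[OF this] todd_nonneg[OF u] this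
    show "ennreal (todd u / (1 / c + u)) = ennreal (todd u) *
           exp_int (1 / c + u)"
      by (simp flip: ennreal_mult)
  qed
  also have "\<dots> = (\<integral>\<^sup>+ r. ?G r \<partial>return borel (1 / c))"
    by (rule nn_integral_return[symmetric, OF _ G]) simp
  also have "\<dots> \<le> J_int (\<lambda>s. exp (- s / c)) \<psi>"
  proof (rule increment_measure_Tonelli_le[OF \<psi> \<rho>])
    show "finite_measure (return borel (1 / c))" by (rule P.finite_measure_axioms)
    show "(\<integral>\<^sup>+ r. ennreal (exp (- (r * s))) \<partial>return borel (1 / c)) \<le> ennreal (exp (- s / c))" for s
      by (subst nn_integral_return) auto
  qed auto
  also have "\<dots> = C_int c \<psi>" using c by (simp add: C_int_def J_int_def)
  finally show ?thesis .
qed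

section \<open>The resolvent functional and its difference quotients\<close>

text \<open>The restriction of the standard exponential law to a subset \<open>A\<close> of the half-line; the push-forward along \<open>max 0\<close> only
  changes the sigma-algebra. Averaging a semigroup over the full law gives the resolvent of its generator at \<open>1\<close>.\<close>

definition exp_measure :: "real set \<Rightarrow> real measure" where
  "exp_measure A = distr (density lborel (\<lambda>s. ennreal (exp (- s)) * indicator A s)) (restrict_space borel {0..}) (max 0)"

lemma nn_integral_exp_measure:
  assumes A: "A \<in> sets borel" "A \<subseteq> {0..}" and f: "f \<in> borel_measurable borel"
  shows "(\<integral>\<^sup>+ s. f s \<partial>exp_measure A) = (\<integral>\<^sup>+ s. f s * ennreal (exp (- s)) * indicator A s \<partial>lborel)"
proof -
  have m: "max 0 \<in> measurable (density lborel (\<lambda>s. ennreal (exp (- s)) * indicator A s)) (restrict_space borel {0..})"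
    by (intro measurable_restrict_space2) auto
  have f': "f \<in> borel_measurable (restrict_space borel {0..})"
    by (rule measurable_restrict_space1[OF f])
  have "(\<integral>\<^sup>+ s. f s \<partial>exp_measure A) = (\<integral>\<^sup>+ s. f (max 0 s) \<partial>density lborel (\<lambda>s. ennreal (exp (- s)) * indicator A s))"
    unfolding exp_measure_def by (rule nn_integral_distr[OF m]) (simp add: f')
  also have "\<dots> = (\<integral>\<^sup>+ s. ennreal (exp (- s)) * indicator A s * f (max 0 s) \<partial>lborel)"
    using A f by (intro nn_integral_density) auto
  also have "\<dots> = (\<integral>\<^sup>+ s. f s * ennreal (exp (- s)) * indicator A s \<partial>lborel)"
    using A(2) by (intro nn_integral_cong) (auto split: split_indicator simp: max_def mult.commute subset_eq)
  finally show ?thesis .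
qed

lemma halfline_exp_measure:
  assumes A: "A \<in> sets borel" "A \<subseteq> {0..}"
  shows "halfline_measure (exp_measure A)"
proof -
  have "emeasure (exp_measure A) (space (exp_measure A)) = (\<integral>\<^sup>+ s. 1 \<partial>exp_measure A)" by simp
  also have "\<dots> = (\<integral>\<^sup>+ s. ennreal (exp (- s)) * indicator A s \<partial>lborel)"
    by (subst nn_integral_exp_measure[OF A]) auto
  also have "\<dots> \<le> (\<integral>\<^sup>+ s. ennreal (exp (- s)) * indicator {0..} s \<partial>lborel)"
    using A by (intro nn_integral_mono) (auto split: split_indicator)
  also have "\<dots> = ennreal 1"
    using nn_integral_exp_Ioi[of 1] by (simp add: nn_integral_Ioi_eq_Ici)
  finally show ?thesis
    unfolding halfline_measure_def
    by (auto intro!: finite_measureI simp: exp_measure_def top_unique)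
qed

lemma laplace_exp_measure_eq:
  assumes A: "A \<in> sets borel" "A \<subseteq> {0..}" and \<tau>: "\<tau> \<ge> 0"
    and I: "(\<integral>\<^sup>+ s. ennreal (exp (- (s * (1 + \<tau>)))) * indicator A s \<partial>lborel) = ennreal c" "c \<ge> 0"
  shows "laplace (exp_measure A) \<tau> = c"
proof -
  note h = halfline_exp_measure[OF A]
  have "ennreal (laplace (exp_measure A) \<tau>) = (\<integral>\<^sup>+ s. ennreal (exp (- (s * \<tau>))) \<partial>exp_measure A)"
    unfolding laplace_def by (rule halfline_nn_integral[OF h Cb_exp, symmetric]) (use \<tau> in auto)
  also have "\<dots> = (\<integral>\<^sup>+ s. ennreal (exp (- (s * \<tau>))) * ennreal (exp (- s)) * indicator A s \<partial>lborel)"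
    by (rule nn_integral_exp_measure[OF A]) simp
  also have "\<dots> = ennreal c"
    unfolding I(1)[symmetric] by (intro nn_integral_cong) (simp add: algebra_simps flip: ennreal_mult exp_add)
  finally show ?thesis using I(2) by (simp add: laplace_def)
qed

lemma laplace_exp_measure:
  assumes \<tau>: "\<tau> \<ge> 0"
  shows "laplace (exp_measure {0..}) \<tau> = 1 / (1 + \<tau>)"
proof (rule laplace_exp_measure_eq[OF _ _ \<tau>])
  show "(\<integral>\<^sup>+ s. ennreal (exp (- (s * (1 + \<tau>)))) * indicator {0..} s \<partial>lborel) = ennreal (1 / (1 + \<tau>))"
    using nn_integral_exp_Ioi[of "1 + \<tau>"] \<tau> by (simp add: nn_integral_Ioi_eq_Ici)
qed (use \<tau> in auto)

lemma laplace_exp_measure_Icc: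
  assumes \<tau>: "\<tau> \<ge> 0" and h: "h \<ge> 0"
  shows "laplace (exp_measure {0..h}) \<tau> = (1 - exp (- (h * (1 + \<tau>)))) / (1 + \<tau>)"
proof (rule laplace_exp_measure_eq[OF _ _ \<tau>])
  have "(\<integral>\<^sup>+ s. ennreal (exp (- (s * (1 + \<tau>)))) * indicator {0..h} s \<partial>lborel)
     = ennreal (- exp (- (h * (1 + \<tau>))) / (1 + \<tau>) - (- exp (- (0 * (1 + \<tau>))) / (1 + \<tau>)))"
  proof (rule nn_integral_FTC_Icc[where F="\<lambda>s. - exp (- (s * (1 + \<tau>))) / (1 + \<tau>)"])
    have "((\<lambda>s. - exp (- (s * c)) / c) has_real_derivative exp (- (x * c))) (at x)"
      if "c > 0" for c x :: real
      using that by (auto intro!: derivative_eq_intros)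
    then show "((\<lambda>s. - exp (- (s * (1 + \<tau>))) / (1 + \<tau>)) has_real_derivative exp (- (x * (1 + \<tau>)))) (at x)" for x
      using \<tau> by simp
  qed (use h in auto)
  also have "- exp (- (h * (1 + \<tau>))) / (1 + \<tau>) - (- exp (- (0 * (1 + \<tau>))) / (1 + \<tau>)) = (1 - exp (- (h * (1 + \<tau>)))) / (1 + \<tau>)"
    by (simp add: diff_divide_distrib)
  finally show "(\<integral>\<^sup>+ s. ennreal (exp (- (s * (1 + \<tau>)))) * indicator {0..h} s \<partial>lborel) = ennreal ((1 - exp (- (h * (1 + \<tau>)))) / (1 + \<tau>))" .
qed (use \<tau> h in auto)

abbreviation "\<E> \<equiv> bochner (exp_measure {0..})"

lemma halfline_exp: "halfline_measure (exp_measure {0..})" "halfline_measure (exp_measure {0..h})"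
  by (auto intro!: halfline_exp_measure)

text \<open>The substitution \<open>s \<mapsto> s + h\<close> in \<open>\<integral>\<^sub>0\<^sup>\<infinity> e\<^sup>-\<^sup>s F(s + h) ds\<close>, obtained by comparing both sides on exponentials.\<close>

lemma bochner_exp_measure_shift:
  fixes F :: "real \<Rightarrow> 'a::banach"
  assumes F: "F \<in> Cb" and h: "h \<ge> 0"
  shows "\<E> (\<lambda>s. F (s + h)) = exp h *\<^sub>R (\<E> F - bochner (exp_measure {0..h}) F)"
proof (rule dct_functional_Laplace_unique[OF _ _ _ F])
  show "dct_functional (\<lambda>F::real \<Rightarrow> 'a. \<E> (\<lambda>s. F (s + h)))"
    by (intro dct_functional_shift dct_functional_bochner halfline_exp h)
  show "dct_functional (\<lambda>F::real \<Rightarrow> 'a. exp h *\<^sub>R (\<E> F - bochner (exp_measure {0..h}) F))"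
    by (intro dct_functional_scaleR dct_functional_diff dct_functional_bochner halfline_exp)
  fix k :: nat and x :: 'a
  have "\<E> (\<lambda>s. exp (- ((s + h) * real k)) *\<^sub>R x) = \<E> (\<lambda>s. exp (- (s * real k)) *\<^sub>R (exp (- (h * real k)) *\<^sub>R x))"
    by (intro arg_cong[where f=\<E>] ext) (simp add: algebra_simps flip: exp_add)
  also have "\<dots> = (exp (- (h * real k)) / (1 + real k)) *\<^sub>R x"
    by (subst dct_functional_exp_bochner[OF halfline_exp(1)]) (simp_all add: laplace_exp_measure)
  also have "\<dots> = exp h *\<^sub>R (\<E> (\<lambda>s. exp (- (s * real k)) *\<^sub>R x) - bochner (exp_measure {0..h}) (\<lambda>s. exp (- (s * real k)) *\<^sub>R x))"
  proof -
    have "exp h * (1 / (1 + real k) - (1 - exp (- (h * (1 + real k)))) / (1 + real k)) = exp (- (h * real k)) / (1 + real k)"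
      by (simp add: algebra_simps flip: diff_divide_distrib exp_add)
    then show ?thesis
      by (simp add: dct_functional_exp_bochner[OF halfline_exp(1)] dct_functional_exp_bochner[OF halfline_exp(2)]
          laplace_exp_measure laplace_exp_measure_Icc h flip: scaleR_diff_left)
  qed
  finally show "\<E> (\<lambda>s. exp (- ((s + h) * real k)) *\<^sub>R x) =
     exp h *\<^sub>R (\<E> (\<lambda>s. exp (- (s * real k)) *\<^sub>R x) - bochner (exp_measure {0..h}) (\<lambda>s. exp (- (s * real k)) *\<^sub>R x))" .
qed

text \<open>The measure lives on \<open>[0, h]\<close>, so \<open>F\<close> may be frozen after \<open>h\<close>.\<close>

lemma norm_bochner_exp_measure_Icc_le:
  fixes F :: "real \<Rightarrow> 'a::banach"
  assumes F: "F \<in> Cb" and h: "h \<ge> 0" and C: "\<And>s. 0 \<le> s \<Longrightarrow> s \<le> h \<Longrightarrow> norm (F s) \<le> C"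
  shows "norm (bochner (exp_measure {0..h}) F) \<le> C * (1 - exp (- h))"
proof -
  have C0: "C \<ge> 0" using C[of 0] h norm_ge_zero[of "F 0"] by linarith
  define G where "G s = F (min s h)" for s
  have GCb: "G \<in> Cb"
  proof (rule CbI[of _ C])
    have c: "continuous_on {0..} F" using F by (simp add: Cb_def)
    have "continuous_on {0..} (\<lambda>s. min s h)" by (intro continuous_intros)
    then show "continuous_on {0..} G" unfolding G_def
      by (rule continuous_on_compose2[OF c]) (use h in auto)
    show "norm (G s) \<le> C" if "s \<ge> 0" for s unfolding G_def using that h by (intro C) auto
  qed
  have meas: "measure (exp_measure {0..h}) {0..} = 1 - exp (- h)"
    using laplace_exp_measure_Icc[of 0 h] h by (simp add: laplace_def halfline_space[OF halfline_exp(2)])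
  have "ennreal (norm (bochner (exp_measure {0..h}) (\<lambda>s. F s - G s)))
      \<le> (\<integral>\<^sup>+ s. ennreal (norm (F s - G s)) \<partial>exp_measure {0..h})"
    by (rule norm_bochner_le[OF halfline_exp(2) Cb_diff[OF F GCb]])
  also have "\<dots> \<le> (\<integral>\<^sup>+ s. \<infinity> * indicator (- {0..h}) s \<partial>exp_measure {0..h})"
    by (intro nn_integral_mono) (auto split: split_indicator simp: G_def min_def halfline_space[OF halfline_exp(2)])
  also have "\<dots> = (\<integral>\<^sup>+ s. \<infinity> * indicator (- {0..h}) s * ennreal (exp (- s)) * indicator {0..h} s \<partial>lborel)"
    by (rule nn_integral_exp_measure) auto
  also have "\<dots> = (\<integral>\<^sup>+ s. 0 \<partial>(lborel :: real measure))"
    by (intro nn_integral_cong) (auto split: split_indicator)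
  finally have "bochner (exp_measure {0..h}) F = bochner (exp_measure {0..h}) G"
    by (simp add: bochner_diff[OF halfline_exp(2) F GCb])
  also have "norm \<dots> \<le> C * measure (exp_measure {0..h}) {0..}"
    by (rule norm_bochner_le_measure[OF halfline_exp(2) GCb]) (unfold G_def, intro C, use h in auto)
  finally show ?thesis by (simp add: meas)
qed

text \<open>The measure on \<open>[0, h]\<close> has mass \<open>1 - e\<^sup>-\<^sup>h\<close>; its normalised averages see only values of \<open>F\<close> near \<open>0\<close>.\<close>

lemma bochner_exp_measure_Icc_average:
  fixes F :: "real \<Rightarrow> 'a::banach"
  assumes F: "F \<in> Cb"
  shows "((\<lambda>h. (1 / (1 - exp (- h))) *\<^sub>R bochner (exp_measure {0..h}) F) \<longlongrightarrow> F 0) (at_right 0)"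
proof (rule tendstoI)
  fix e :: real assume e: "e > 0"
  have "continuous (at 0 within {0..}) F" using F by (simp add: Cb_def continuous_on_eq_continuous_within)
  then obtain d where d: "d > 0" "\<And>s. s \<ge> 0 \<Longrightarrow> \<bar>s\<bar> < d \<Longrightarrow> norm (F s - F 0) < e / 2"
    using e unfolding continuous_within_eps_delta dist_norm
    by (metis atLeast_iff diff_zero half_gt_zero real_norm_def)
  have "eventually (\<lambda>h. 0 < h \<and> h < d) (at_right 0)"
    by (rule eventually_at_rightI[of 0 d]) (use d in auto)
  then show "eventually (\<lambda>h. dist ((1 / (1 - exp (- h))) *\<^sub>R bochner (exp_measure {0..h}) F) (F 0) < e) (at_right 0)"
  proof eventually_elim
    fix h assume h: "0 < h \<and> h < d"
    have p: "1 - exp (- h) > 0" using h by simp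
    have const: "bochner (exp_measure {0..h}) (\<lambda>s. F 0) = (1 - exp (- h)) *\<^sub>R F 0"
      using dct_functional_exp_bochner[OF halfline_exp(2), of 0 h "F 0"] laplace_exp_measure_Icc[of 0 h] h by simp
    have "norm (bochner (exp_measure {0..h}) (\<lambda>s. F s - F 0)) \<le> e / 2 * (1 - exp (- h))"
      using h d(2) by (intro norm_bochner_exp_measure_Icc_le Cb_diff F Cb_const) (auto intro: less_imp_le)
    moreover have "bochner (exp_measure {0..h}) (\<lambda>s. F s - F 0) =
        (1 - exp (- h)) *\<^sub>R ((1 / (1 - exp (- h))) *\<^sub>R bochner (exp_measure {0..h}) F - F 0)"
      using p by (simp add: bochner_diff[OF halfline_exp(2) F Cb_const] const scaleR_diff_right)
    ultimately have "norm ((1 / (1 - exp (- h))) *\<^sub>R bochner (exp_measure {0..h}) F - F 0) \<le> e / 2"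
      using p by (simp add: mult.commute)
    then show "dist ((1 / (1 - exp (- h))) *\<^sub>R bochner (exp_measure {0..h}) F) (F 0) < e"
      using e by (simp add: dist_norm)
  qed
qed

text \<open>The integrand of the representation of \<open>\<psi>\<close>, with \<open>e\<^sup>-\<^sup>u\<^sup>z\<close> replaced by \<open>G u\<close>. Division by \<open>1 - e\<^sup>-\<^sup>u\<close> in place of \<open>u\<close> matches the
  normalisation of \<open>\<rho>\<close>; \<open>z\<close> is the limit at \<open>u = 0\<close>, that is, minus the derivative of \<open>G\<close>.\<close>

definition dquot :: "'a::real_normed_vector \<Rightarrow> (real \<Rightarrow> 'a) \<Rightarrow> real \<Rightarrow> 'a" where
  "dquot z G u = (if u = 0 then z else (1 / (1 - exp (- u))) *\<^sub>R (G 0 - G u))"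

lemma dquot_Cb:
  fixes G :: "real \<Rightarrow> 'a::real_normed_vector"
  assumes G: "G \<in> Cb" and z: "(dquot z G \<longlongrightarrow> z) (at_right 0)"
  shows "dquot z G \<in> Cb"
proof -
  have contG: "continuous_on {0..} G" using G by (simp add: Cb_def)
  have "continuous_on {0<..} (\<lambda>u. (1 / (1 - exp (- u))) *\<^sub>R (G 0 - G u))"
    by (intro continuous_intros continuous_on_subset[OF contG]) auto
  then have pos: "continuous_on {0<..} (dquot z G)"
    by (rule continuous_on_eq) (auto simp: dquot_def)
  have cont: "continuous_on {0..} (dquot z G)"
    unfolding continuous_on_eq_continuous_within
  proof
    fix u :: real assume u: "u \<in> {0..}"
    show "continuous (at u within {0..}) (dquot z G)"
    proof (cases "u = 0")
      case True
      have "at 0 within {0..} = at_right (0::real)"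
        by (auto simp: at_within_def greaterThan_def atLeast_def intro!: arg_cong[where f=principal] arg_cong2[where f=inf])
      then show ?thesis using z True by (simp add: continuous_within dquot_def[of z G 0])
    next
      case False
      then have "u > 0" using u by simp
      then have "isCont (dquot z G) u"
        using pos by (simp add: continuous_on_eq_continuous_at)
      then show ?thesis by (rule continuous_at_imp_continuous_at_within)
    qed
  qed
  obtain C where C: "C \<ge> 0" "\<And>s. s \<ge> 0 \<Longrightarrow> norm (G s) \<le> C" using Cb_bound[OF G] by blast
  have "bounded (dquot z G ` {0..1})"
    by (intro compact_imp_bounded compact_continuous_image continuous_on_subset[OF cont]) auto
  then obtain D where "\<forall>u\<in>{0..1}. norm (dquot z G u) \<le> D"
    by (auto simp: bounded_iff)
  then have D: "norm (dquot z G u) \<le> D" if "0 \<le> u" "u \<le> 1" for u using that by simp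
  have large: "norm (dquot z G u) \<le> 1 / (1 - exp (- 1)) * (2 * C)" if "u > 1" for u
  proof -
    have "norm (dquot z G u) = 1 / (1 - exp (- u)) * norm (G 0 - G u)" using that by (simp add: dquot_def)
    also have "\<dots> \<le> 1 / (1 - exp (- 1)) * (2 * C)"
    proof (intro mult_mono frac_le)
      show "norm (G 0 - G u) \<le> 2 * C"
        using that norm_triangle_ineq4[of "G 0" "G u"] C(2)[of 0] C(2)[of u] by simp
    qed (use that in auto)
    finally show ?thesis .
  qed
  show ?thesis
    by (rule CbI[OF cont, of "max D (1 / (1 - exp (- 1)) * (2 * C))"])
       (metis D large linorder_not_le max.coboundedI1 max.coboundedI2)
qed

lemma one_minus_exp_quotient_tendsto: "((\<lambda>h. (1 - exp (- h)) / h) \<longlongrightarrow> 1) (at_right (0::real))"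
proof -
  have "((\<lambda>x. - exp (- x)) has_real_derivative 1) (at 0)"
    by (auto intro!: derivative_eq_intros)
  then have "((\<lambda>h. (1 - exp (- h)) / h) \<longlongrightarrow> 1) (at (0::real))"
    by (simp add: DERIV_def)
  then show ?thesis by (rule tendsto_within_subset) simp
qed

text \<open>For \<open>F\<close> an orbit \<open>s \<mapsto> T s x\<close> this is \<open>(1 - T u) R x / (1 - e\<^sup>-\<^sup>u)\<close>, with \<open>A R x = x - R x\<close> at \<open>u = 0\<close>.\<close>

abbreviation "resolvent_dquot F \<equiv> dquot (F 0 - \<E> F) (\<lambda>u. \<E> (\<lambda>s. F (s + u)))"

text \<open>The shift formula removes the cancellation in the difference quotient: only an average of \<open>F\<close> over \<open>[0, u]\<close> and
  the resolvent remain, which are bounded and converge as \<open>u\<close> tends to \<open>0\<close>.\<close>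

lemma resolvent_dquot_eq:
  fixes F :: "real \<Rightarrow> 'a::banach"
  assumes F: "F \<in> Cb" and u: "u > 0"
  shows "resolvent_dquot F u = exp u *\<^sub>R ((1 / (1 - exp (- u))) *\<^sub>R bochner (exp_measure {0..u}) F - \<E> F)"
proof -
  define p where "p = 1 - exp (- u)"
  have p: "p > 0" using u by (simp add: p_def)
  have e: "exp u - 1 = exp u * p" by (simp add: p_def algebra_simps flip: exp_add)
  have "resolvent_dquot F u = (1 / p) *\<^sub>R (\<E> F - exp u *\<^sub>R (\<E> F - bochner (exp_measure {0..u}) F))"
    using u by (simp add: dquot_def p_def bochner_exp_measure_shift[OF F less_imp_le[OF u]])
  also have "\<dots> = (1 / p) *\<^sub>R (exp u *\<^sub>R bochner (exp_measure {0..u}) F - (exp u - 1) *\<^sub>R \<E> F)"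
    by (simp add: algebra_simps)
  also have "\<dots> = exp u *\<^sub>R ((1 / p) *\<^sub>R bochner (exp_measure {0..u}) F - \<E> F)"
    unfolding e using p by (simp add: scaleR_diff_right)
  finally show ?thesis by (simp add: p_def)
qed

lemma resolvent_dquot_tendsto:
  fixes F :: "real \<Rightarrow> 'a::banach"
  assumes F: "F \<in> Cb"
  shows "(resolvent_dquot F \<longlongrightarrow> F 0 - \<E> F) (at_right 0)"
proof -
  have "((\<lambda>u. exp u *\<^sub>R ((1 / (1 - exp (- u))) *\<^sub>R bochner (exp_measure {0..u}) F - \<E> F)) \<longlongrightarrow> exp 0 *\<^sub>R (F 0 - \<E> F)) (at_right 0)"
    by (intro tendsto_intros bochner_exp_measure_Icc_average F)
  moreover have "eventually (\<lambda>u. exp u *\<^sub>R ((1 / (1 - exp (- u))) *\<^sub>R bochner (exp_measure {0..u}) F - \<E> F) = resolvent_dquot F u) (at_right 0)"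
    using eventually_at_right_less[of 0] by eventually_elim (simp only: resolvent_dquot_eq[OF F])
  ultimately show ?thesis by (simp add: tendsto_cong)
qed

lemma resolvent_shift_Cb:
  fixes F :: "real \<Rightarrow> 'a::banach"
  assumes F: "F \<in> Cb"
  shows "(\<lambda>u. \<E> (\<lambda>s. F (s + u))) \<in> Cb"
proof -
  obtain C where C: "C \<ge> 0" "\<And>s. s \<ge> 0 \<Longrightarrow> norm (F s) \<le> C" using Cb_bound[OF F] by blast
  show ?thesis
  proof (rule CbI)
    show "norm (\<E> (\<lambda>s. F (s + u))) \<le> C * measure (exp_measure {0..}) {0..}" if "u \<ge> 0" for u
      using that C by (intro norm_bochner_le_measure halfline_exp Cb_shift F) auto
    show "continuous_on {0..} (\<lambda>u. \<E> (\<lambda>s. F (s + u)))"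
      unfolding continuous_on_sequentially comp_def
    proof (intro allI ballI impI)
      fix un :: "nat \<Rightarrow> real" and u assume u: "u \<in> {0..}" and un: "(\<forall>n. un n \<in> {0..}) \<and> un \<longlonglongrightarrow> u"
      show "(\<lambda>n. \<E> (\<lambda>s. F (s + un n))) \<longlonglongrightarrow> \<E> (\<lambda>s. F (s + u))"
      proof (rule bochner_dominated_convergence[OF halfline_exp(1), where C=C])
        show "(\<lambda>s. F (s + un n)) \<in> Cb" for n using un F by (intro Cb_shift) auto
        show "(\<lambda>s. F (s + u)) \<in> Cb" using u F by (intro Cb_shift) auto
        show "norm (F (s + un n)) \<le> C" if "s \<ge> 0" for n s using that un C by simp
        show "(\<lambda>n. F (s + un n)) \<longlonglongrightarrow> F (s + u)" if "s \<ge> 0" for s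
        proof (rule continuous_on_tendsto_compose[of "{0..}" F])
          show "continuous_on {0..} F" using F by (simp add: Cb_def)
          show "(\<lambda>n. s + un n) \<longlonglongrightarrow> s + u" using un by (intro tendsto_intros) auto
        qed (use that u un in auto)
      qed
    qed
  qed
qed

lemma resolvent_dquot_Cb:
  fixes F :: "real \<Rightarrow> 'a::banach"
  assumes F: "F \<in> Cb"
  shows "resolvent_dquot F \<in> Cb"
  by (rule dquot_Cb[OF resolvent_shift_Cb[OF F] resolvent_dquot_tendsto[OF F]])

text \<open>Dominated convergence holds at every \<open>u\<close> for the inner functional, and the integrands are bounded uniformly in \<open>u\<close>
  in terms of the bound of \<open>F\<close>: near \<open>0\<close> by the formula for \<open>resolvent_dquot\<close>, away from \<open>0\<close> trivially.\<close>

lemma dct_functional_resolvent_dquot: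
  assumes \<rho>: "halfline_measure \<rho>"
  shows "dct_functional (\<lambda>F :: real \<Rightarrow> 'a::banach. bochner \<rho> (resolvent_dquot F))"
proof (rule dct_functionalI)
  fix F G :: "real \<Rightarrow> 'a" and c assume F: "F \<in> Cb"
  have "resolvent_dquot (\<lambda>s. c *\<^sub>R F s) u = c *\<^sub>R resolvent_dquot F u" if "u \<ge> 0" for u
    using bochner_scaleR[OF halfline_exp(1) F] bochner_scaleR[OF halfline_exp(1) Cb_shift[OF F that]]
    by (simp add: dquot_def scaleR_diff_right mult.commute)
  then have "bochner \<rho> (resolvent_dquot (\<lambda>s. c *\<^sub>R F s)) = bochner \<rho> (\<lambda>u. c *\<^sub>R resolvent_dquot F u)"
    by (intro bochner_cong[OF \<rho>] resolvent_dquot_Cb Cb_scaleR F)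
  then show "bochner \<rho> (resolvent_dquot (\<lambda>s. c *\<^sub>R F s)) = c *\<^sub>R bochner \<rho> (resolvent_dquot F)"
    by (simp add: bochner_scaleR[OF \<rho> resolvent_dquot_Cb[OF F]])
  assume G: "G \<in> Cb"
  have "resolvent_dquot (\<lambda>s. F s + G s) u = resolvent_dquot F u + resolvent_dquot G u" if "u \<ge> 0" for u
    using bochner_add[OF halfline_exp(1) F G] bochner_add[OF halfline_exp(1) Cb_shift[OF F that] Cb_shift[OF G that]]
    by (simp add: dquot_def algebra_simps)
  then have "bochner \<rho> (resolvent_dquot (\<lambda>s. F s + G s)) = bochner \<rho> (\<lambda>u. resolvent_dquot F u + resolvent_dquot G u)"
    by (intro bochner_cong[OF \<rho>] resolvent_dquot_Cb Cb_add F G)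
  then show "bochner \<rho> (resolvent_dquot (\<lambda>s. F s + G s)) = bochner \<rho> (resolvent_dquot F) + bochner \<rho> (resolvent_dquot G)"
    by (simp add: bochner_add[OF \<rho> resolvent_dquot_Cb[OF F] resolvent_dquot_Cb[OF G]])
next
  fix Fn :: "nat \<Rightarrow> real \<Rightarrow> 'a" and F C
  assume Fn: "\<And>n. Fn n \<in> Cb" and F: "F \<in> Cb" and C: "\<And>n s. s \<ge> 0 \<Longrightarrow> norm (Fn n s) \<le> C"
    and lim: "\<And>s. s \<ge> 0 \<Longrightarrow> (\<lambda>n. Fn n s) \<longlonglongrightarrow> F s"
  have C0: "C \<ge> 0" using C[of 0] norm_ge_zero[of "Fn 0 0"] by (meson order.refl order_trans)
  have mass: "measure (exp_measure {0..}) {0..} = 1"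
    using laplace_exp_measure[of 0] by (simp add: laplace_def halfline_space[OF halfline_exp(1)])
  have bE: "norm (\<E> (\<lambda>s. Fn n (s + u))) \<le> C" if "u \<ge> 0" for n u
    using norm_bochner_le_measure[OF halfline_exp(1) Cb_shift[OF Fn[of n] that], of C] C that by (simp add: mass)
  have bound: "norm (resolvent_dquot (Fn n) u) \<le> 2 * C * exp 1 + 2 * C / (1 - exp (- 1))" if u: "u \<ge> 0" for n u
  proof -
    have b0: "norm (\<E> (Fn n)) \<le> C" using bE[of 0 n] by simp
    have nn: "0 \<le> 2 * C * exp 1" "0 \<le> 2 * C / (1 - exp (- 1))" using C0 by auto
    consider "u = 0" | "0 < u" "u \<le> 1" | "u > 1" using u by linarith
    then show ?thesis
    proof cases
      case 1
      have "norm (resolvent_dquot (Fn n) u) \<le> 2 * C"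
        using 1 C[of 0 n] b0 norm_triangle_ineq4[of "Fn n 0" "\<E> (Fn n)"] by (simp add: dquot_def)
      also have "2 * C * 1 \<le> 2 * C * exp 1" using C0 by (intro mult_left_mono) auto
      finally show ?thesis using nn by simp
    next
      case 2
      have "norm ((1 / (1 - exp (- u))) *\<^sub>R bochner (exp_measure {0..u}) (Fn n)) \<le> C"
        using norm_bochner_exp_measure_Icc_le[OF Fn[of n], of u C] C 2 by (simp add: divide_le_eq)
      then have "norm ((1 / (1 - exp (- u))) *\<^sub>R bochner (exp_measure {0..u}) (Fn n) - \<E> (Fn n)) \<le> 2 * C"
        using b0 norm_triangle_ineq4[of "(1 / (1 - exp (- u))) *\<^sub>R bochner (exp_measure {0..u}) (Fn n)" "\<E> (Fn n)"] by linarith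
      then have "exp u * norm ((1 / (1 - exp (- u))) *\<^sub>R bochner (exp_measure {0..u}) (Fn n) - \<E> (Fn n)) \<le> exp 1 * (2 * C)"
        using 2 by (intro mult_mono) auto
      then have "norm (resolvent_dquot (Fn n) u) \<le> exp 1 * (2 * C)"
        unfolding resolvent_dquot_eq[OF Fn 2(1)] by simp
      then show ?thesis using nn by (simp add: mult.commute)
    next
      case 3
      have "norm (resolvent_dquot (Fn n) u) = 1 / (1 - exp (- u)) * norm (\<E> (Fn n) - \<E> (\<lambda>s. Fn n (s + u)))"
        using 3 by (simp add: dquot_def)
      also have "\<dots> \<le> 1 / (1 - exp (- 1)) * (2 * C)"
        using 3 b0 bE[of u n] norm_triangle_ineq4[of "\<E> (Fn n)" "\<E> (\<lambda>s. Fn n (s + u))"] C0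
        by (intro mult_mono frac_le) auto
      finally show ?thesis using nn by simp
    qed
  qed
  have lim': "(\<lambda>n. resolvent_dquot (Fn n) u) \<longlonglongrightarrow> resolvent_dquot F u" if u: "u \<ge> 0" for u
  proof -
    have s: "(\<lambda>n. \<E> (\<lambda>s. Fn n (s + v))) \<longlonglongrightarrow> \<E> (\<lambda>s. F (s + v))" if "v \<ge> 0" for v
      by (rule bochner_dominated_convergence[OF halfline_exp(1) Cb_shift[OF Fn that] Cb_shift[OF F that], where C=C])
         (use C lim that in auto)
    show ?thesis
      using s[of 0] s[OF u] lim[of 0] unfolding dquot_def by (auto intro!: tendsto_intros)
  qed
  show "(\<lambda>n. bochner \<rho> (resolvent_dquot (Fn n))) \<longlonglongrightarrow> bochner \<rho> (resolvent_dquot F)"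
    by (rule bochner_dominated_convergence[OF \<rho> resolvent_dquot_Cb[OF Fn] resolvent_dquot_Cb[OF F] bound lim'])
qed

text \<open>On \<open>e\<^sup>-\<^sup>k\<^sup>s x\<close> the left side is \<open>(\<psi>(0) + \<integral> (1 - e\<^sup>-\<^sup>u\<^sup>k) / (1 - e\<^sup>-\<^sup>u) \<rho>(du)) / (1 + k) x\<close>, which is \<open>\<psi>(k) / (1 + k) x\<close>, and so is
  the right side.\<close>

lemma levy_khintchine_functional:
  fixes F :: "real \<Rightarrow> 'a::banach"
  assumes \<psi>: "bernstein \<psi>" and \<rho>: "increment_measure \<psi> \<rho>"
    and p: "laplace_pair (\<lambda>z. \<psi> z / (1 + z)) (\<mu>, \<nu>)" and F: "F \<in> Cb"
  shows "at_zero \<psi> *\<^sub>R \<E> F + bochner \<rho> (resolvent_dquot F) = bochner \<mu> F - bochner \<nu> F"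
proof -
  have h: "halfline_measure \<rho>" using \<rho> by (simp add: increment_measure_def)
  have \<mu>: "halfline_measure \<mu>" and \<nu>: "halfline_measure \<nu>"
    and lap: "\<And>\<tau>. \<tau> > 0 \<Longrightarrow> \<psi> \<tau> / (1 + \<tau>) = laplace \<mu> \<tau> - laplace \<nu> \<tau>"
    using p by (auto simp: laplace_pair_def)
  show ?thesis
  proof (rule dct_functional_Laplace_unique[OF _ _ _ F])
    show "dct_functional (\<lambda>F :: real \<Rightarrow> 'a. at_zero \<psi> *\<^sub>R \<E> F + bochner \<rho> (resolvent_dquot F))"
      by (intro dct_functional_add dct_functional_scaleR dct_functional_bochner halfline_exp dct_functional_resolvent_dquot h)
    show "dct_functional (\<lambda>F :: real \<Rightarrow> 'a. bochner \<mu> F - bochner \<nu> F)"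
      by (intro dct_functional_diff dct_functional_bochner \<mu> \<nu>)
    fix k :: nat and x :: 'a assume k: "k \<ge> 1"
    let ?e = "\<lambda>s. exp (- (s * real k)) *\<^sub>R x"
    have eCb: "?e \<in> Cb" using Cb_exp_scaleR[of "real k" 0 x] by simp
    have E: "\<E> ?e = (1 / (1 + real k)) *\<^sub>R x"
      by (simp add: dct_functional_exp_bochner[OF halfline_exp(1)] laplace_exp_measure)
    have Eu: "\<E> (\<lambda>s. ?e (s + u)) = (exp (- (u * real k)) / (1 + real k)) *\<^sub>R x" for u
    proof -
      have "\<E> (\<lambda>s. ?e (s + u)) = \<E> (\<lambda>s. exp (- (s * real k)) *\<^sub>R (exp (- (u * real k)) *\<^sub>R x))"
        by (intro arg_cong[where f=\<E>] ext) (simp add: algebra_simps flip: exp_add)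
      also have "\<dots> = (exp (- (u * real k)) / (1 + real k)) *\<^sub>R x"
        by (subst dct_functional_exp_bochner[OF halfline_exp(1)]) (simp_all add: laplace_exp_measure)
      finally show ?thesis .
    qed
    have W: "resolvent_dquot ?e u = (\<Sum>j<k. exp (- (u * real j))) *\<^sub>R ((1 / (1 + real k)) *\<^sub>R x)" for u
    proof (cases "u = 0")
      case True
      have "x - (1 / (1 + real k)) *\<^sub>R x = (1 - 1 / (1 + real k)) *\<^sub>R x" by (simp add: scaleR_diff_left)
      also have "1 - 1 / (1 + real k) = real k / (1 + real k)" by (simp add: field_simps)
      finally show ?thesis using True E by (simp add: dquot_def)
    next
      case False
      have "exp (- (u * real j)) = exp (- u) ^ j" for j
        by (simp add: mult.commute flip: exp_of_nat_mult)
      then have "(\<Sum>j<k. exp (- (u * real j))) = (1 - exp (- (u * real k))) / (1 - exp (- u))"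
        using False by (simp add: sum_gp_strict)
      moreover have "resolvent_dquot ?e u = (1 / (1 - exp (- u))) *\<^sub>R
         ((1 / (1 + real k)) *\<^sub>R x - (exp (- (u * real k)) / (1 + real k)) *\<^sub>R x)"
        using False E Eu[of u] Eu[of 0] by (simp add: dquot_def)
      ultimately show ?thesis
        by (simp add: diff_divide_distrib scaleR_diff_left scaleR_diff_right)
    qed
    have "bochner \<rho> (resolvent_dquot ?e) = (\<integral>u. (\<Sum>j<k. exp (- (u * real j))) \<partial>\<rho>) *\<^sub>R ((1 / (1 + real k)) *\<^sub>R x)"
      unfolding W by (rule bochner_scaleR_left[OF h]) (intro Cb_sum Cb_exp, simp)
    then have "at_zero \<psi> *\<^sub>R \<E> ?e + bochner \<rho> (resolvent_dquot ?e) = (\<psi> (real k) / (1 + real k)) *\<^sub>R x"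
      by (simp add: E bernstein_of_nat_eq[OF \<psi> \<rho> k] add_divide_distrib scaleR_add_left)
    also have "\<dots> = bochner \<mu> ?e - bochner \<nu> ?e"
      using lap[of "real k"] k
      by (simp add: dct_functional_exp_bochner[OF \<mu>] dct_functional_exp_bochner[OF \<nu>] scaleR_diff_left)
    finally show "at_zero \<psi> *\<^sub>R \<E> ?e + bochner \<rho> (resolvent_dquot ?e) = bochner \<mu> ?e - bochner \<nu> ?e" .
  qed
qed

section \<open>Bounded semigroups, their generators and the functional calculus\<close>

locale bounded_semigroup =
  fixes T :: "real \<Rightarrow> ('a::banach \<Rightarrow>\<^sub>L 'a)"
  assumes semigroup: "bounded_C0_semigroup T"
begin

abbreviation "M \<equiv> sup_norm T"

lemma T_0 [simp]: "T 0 = id_blinfun"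
  and T_add: "s \<ge> 0 \<Longrightarrow> t \<ge> 0 \<Longrightarrow> T (s + t) x = T s (T t x)"
  and T_tendsto: "((\<lambda>t. T t x) \<longlongrightarrow> x) (at_right 0)"
  using semigroup by (auto simp: bounded_C0_semigroup_def)

lemma norm_T_le: "s \<ge> 0 \<Longrightarrow> norm (T s) \<le> M"
proof -
  assume s: "s \<ge> 0"
  obtain B where "\<forall>B'\<in>T ` {0..}. norm B' \<le> B"
    using semigroup unfolding bounded_C0_semigroup_def bounded_iff by blast
  then have "bdd_above ((\<lambda>t. norm (T t)) ` {0..})" by (auto intro!: bdd_aboveI)
  then show ?thesis unfolding sup_norm_def using s by (intro cSUP_upper) auto
qed

lemma M_nonneg: "M \<ge> 0"
  using norm_T_le[of 0] norm_ge_zero[of "T 0"] by linarith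

text \<open>On the zero space \<open>M = 0\<close>, hence the assumption of a nonzero vector.\<close>

lemma M_ge_1: "x \<noteq> 0 \<Longrightarrow> M \<ge> 1" for x :: 'a
proof -
  assume x: "x \<noteq> 0"
  have "norm x \<le> norm (T 0) * norm x" using norm_blinfun[of "T 0" x] by simp
  also have "\<dots> \<le> M * norm x" by (intro mult_right_mono norm_T_le) auto
  finally show ?thesis using x by simp
qed

lemma norm_T_apply_le: "s \<ge> 0 \<Longrightarrow> norm (T s x) \<le> M * norm x"
  using norm_blinfun[of "T s" x] mult_right_mono[OF norm_T_le norm_ge_zero] by (rule order_trans)

lemma T_commute: "s \<ge> 0 \<Longrightarrow> t \<ge> 0 \<Longrightarrow> T s (T t x) = T t (T s x)"
  using T_add[of s t x] T_add[of t s x] by (simp add: add.commute)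

lemma T_norm_diff_le:
  assumes "0 \<le> s" "s \<le> t"
  shows "norm (T t x - T s x) \<le> M * norm (T (t - s) x - x)"
proof -
  have "T t x - T s x = T s (T (t - s) x - x)"
    using T_add[of s "t - s" x] assms by (simp add: blinfun.diff_right)
  then show ?thesis using norm_T_apply_le[OF assms(1)] by simp
qed

lemma T_Cb: "(\<lambda>s. T s x) \<in> Cb"
proof (rule CbI[OF _ norm_T_apply_le])
  show "continuous_on {0..} (\<lambda>s. T s x)"
    unfolding continuous_on_iff
  proof (intro ballI allI impI)
    fix s :: real and e :: real assume s: "s \<in> {0..}" and e: "e > 0"
    have M1: "M + 1 > 0" using M_nonneg by linarith
    then have "eventually (\<lambda>h. dist (T h x) x < e / (M + 1)) (at_right 0)"
      using e by (intro tendstoD[OF T_tendsto]) simp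
    then obtain d where d: "d > 0" "\<And>h. 0 < h \<Longrightarrow> h < d \<Longrightarrow> dist (T h x) x < e / (M + 1)"
      by (auto simp: eventually_at_right_field)
    have key: "norm (T b x - T a x) < e" if "0 \<le> a" "a \<le> b" "b - a < d" for a b
    proof (cases "a = b")
      case False
      have "norm (T b x - T a x) \<le> M * norm (T (b - a) x - x)" by (rule T_norm_diff_le[OF that(1,2)])
      also have "\<dots> \<le> M * (e / (M + 1))"
        using d(2)[of "b - a"] that False M_nonneg by (intro mult_left_mono) (auto simp: dist_norm)
      also have "\<dots> < e" using e M1 by (simp add: field_simps)
      finally show ?thesis .
    qed (use e in simp)
    show "\<exists>d>0. \<forall>x'\<in>{0..}. dist x' s < d \<longrightarrow> dist (T x' x) (T s x) < e"
    proof (intro exI[of _ d] conjI ballI impI d(1))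
      fix r :: real assume "r \<in> {0..}" "dist r s < d"
      then show "dist (T r x) (T s x) < e"
        using key[of r s] key[of s r] s by (cases "r \<le> s") (auto simp: dist_norm norm_minus_commute)
    qed
  qed
qed

lemma T_inverse_Suc_tendsto: "(\<lambda>n. T (inverse (real (Suc n))) x) \<longlonglongrightarrow> x"
  by (rule filterlim_compose[OF T_tendsto inverse_Suc_at_right])

lemma bounded_linear_bochner_T:
  assumes \<mu>: "halfline_measure \<mu>"
  shows "bounded_linear (\<lambda>x. bochner \<mu> (\<lambda>s. T s x))"
proof (rule bounded_linear_intro[where K="M * measure \<mu> {0..}"])
  show "bochner \<mu> (\<lambda>s. T s (x + y)) = bochner \<mu> (\<lambda>s. T s x) + bochner \<mu> (\<lambda>s. T s y)" for x y
    by (simp add: blinfun.add_right bochner_add[OF \<mu> T_Cb T_Cb])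
  show "bochner \<mu> (\<lambda>s. T s (r *\<^sub>R x)) = r *\<^sub>R bochner \<mu> (\<lambda>s. T s x)" for r x
    by (simp add: blinfun.scaleR_right bochner_scaleR[OF \<mu> T_Cb])
  show "norm (bochner \<mu> (\<lambda>s. T s x)) \<le> norm x * (M * measure \<mu> {0..})" for x
    using norm_bochner_le_measure[OF \<mu> T_Cb norm_T_apply_le, of x] by (simp add: mult_ac)
qed

lemma average_apply:
  assumes "halfline_measure \<mu>"
  shows "blinfun_apply (average T \<mu>) x = bochner \<mu> (\<lambda>s. T s x)"
  unfolding average_def by (simp add: bounded_linear_Blinfun_apply[OF bounded_linear_bochner_T[OF assms]])

lemma T_average_commute:
  assumes \<mu>: "halfline_measure \<mu>" and s: "s \<ge> 0"
  shows "T s (average T \<mu> x) = average T \<mu> (T s x)"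
proof -
  have "T s (average T \<mu> x) = bochner \<mu> (\<lambda>r. T s (T r x))"
    by (simp add: average_apply[OF \<mu>] bochner_bounded_linear[OF \<mu> blinfun.bounded_linear_right T_Cb])
  also have "\<dots> = bochner \<mu> (\<lambda>r. T r (T s x))"
    by (rule bochner_cong[OF \<mu> Cb_bounded_linear[OF blinfun.bounded_linear_right T_Cb]]) (rule T_commute[OF s])
  finally show ?thesis by (simp add: average_apply[OF \<mu>])
qed

text \<open>Both averages commute with the semigroup, and a bounded operator passes under the integral.\<close>

lemma average_commute:
  assumes \<mu>: "halfline_measure \<mu>" and \<nu>: "halfline_measure \<nu>"
  shows "average T \<mu> (average T \<nu> x) = average T \<nu> (average T \<mu> x)"
proof -
  have "average T \<mu> (average T \<nu> x) = bochner \<nu> (\<lambda>s. average T \<mu> (T s x))"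
    by (simp add: average_apply[OF \<nu>] bochner_bounded_linear[OF \<nu> blinfun.bounded_linear_right T_Cb])
  also have "\<dots> = bochner \<nu> (\<lambda>s. T s (average T \<mu> x))"
    by (rule bochner_cong[OF \<nu> Cb_bounded_linear[OF blinfun.bounded_linear_right T_Cb]])
       (simp add: T_average_commute[OF \<mu>])
  finally show ?thesis by (simp add: average_apply[OF \<nu>])
qed

abbreviation "A \<equiv> neg_generator T"

lemma A_iff: "(x, y) \<in> A \<longleftrightarrow> ((\<lambda>h. (1 / h) *\<^sub>R (x - T h x)) \<longlongrightarrow> y) (at_right 0)"
proof -
  have "(x, y) \<in> A \<longleftrightarrow> (x, - y) \<in> generator T"
    unfolding neg_generator_def by (auto intro: exI[of _ "- y"])
  also have "\<dots> \<longleftrightarrow> ((\<lambda>h. - ((1 / h) *\<^sub>R (x - T h x))) \<longlongrightarrow> - y) (at_right 0)"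
    by (simp add: generator_def flip: scaleR_minus_right)
  also have "\<dots> \<longleftrightarrow> ((\<lambda>h. (1 / h) *\<^sub>R (x - T h x)) \<longlongrightarrow> y) (at_right 0)"
    unfolding tendsto_minus_cancel_left by simp
  finally show ?thesis .
qed

lemma A_unique: "(x, y) \<in> A \<Longrightarrow> (x, z) \<in> A \<Longrightarrow> y = z"
  unfolding A_iff by (rule tendsto_unique[OF _ _ ]) auto

lemma A_commute:
  assumes xy: "(x, y) \<in> A" and L: "\<And>s x. s \<ge> 0 \<Longrightarrow> T s (blinfun_apply L x) = L (T s x)"
  shows "(L x, L y) \<in> A"
proof -
  have "((\<lambda>h. L ((1 / h) *\<^sub>R (x - T h x))) \<longlongrightarrow> L y) (at_right 0)"
    using xy unfolding A_iff by (rule blinfun.tendsto[OF tendsto_const])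
  moreover have "eventually (\<lambda>h. L ((1 / h) *\<^sub>R (x - T h x)) = (1 / h) *\<^sub>R (L x - T h (L x))) (at_right 0)"
    using eventually_at_right_less[of 0]
    by eventually_elim (simp add: L blinfun.scaleR_right blinfun.diff_right)
  ultimately show ?thesis unfolding A_iff by (simp add: tendsto_cong)
qed

lemma A_T: "(x, y) \<in> A \<Longrightarrow> s \<ge> 0 \<Longrightarrow> (T s x, T s y) \<in> A"
  by (erule A_commute) (simp add: T_commute)

abbreviation "R \<equiv> average T (exp_measure {0..})"

lemma R_apply: "R x = \<E> (\<lambda>s. T s x)"
  by (rule average_apply[OF halfline_exp(1)])

lemma T_R: "u \<ge> 0 \<Longrightarrow> T u (R x) = \<E> (\<lambda>s. T (s + u) x)"
proof -
  assume u: "u \<ge> 0"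
  have "\<E> (\<lambda>s. T (s + u) x) = \<E> (\<lambda>s. T s (T u x))"
    by (rule bochner_cong[OF halfline_exp(1) Cb_shift[OF T_Cb u]]) (rule T_add[OF _ u])
  moreover have "T u (R x) = R (T u x)" by (rule T_average_commute[OF halfline_exp(1) u])
  moreover have "R (T u x) = \<E> (\<lambda>s. T s (T u x))" by (rule R_apply)
  ultimately show ?thesis by (simp only:)
qed

definition orbit_dquot :: "'a \<Rightarrow> 'a \<Rightarrow> real \<Rightarrow> 'a" where
  "orbit_dquot y z = dquot z (\<lambda>u. T u y)"

lemma orbit_dquot_tendsto_iff: "(orbit_dquot y z \<longlongrightarrow> z) (at_right 0) \<longleftrightarrow> (y, z) \<in> A"
proof
  assume l: "(orbit_dquot y z \<longlongrightarrow> z) (at_right 0)"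
  have "((\<lambda>h. ((1 - exp (- h)) / h) *\<^sub>R orbit_dquot y z h) \<longlongrightarrow> 1 *\<^sub>R z) (at_right 0)"
    by (intro tendsto_scaleR one_minus_exp_quotient_tendsto l)
  moreover have "eventually (\<lambda>h. ((1 - exp (- h)) / h) *\<^sub>R orbit_dquot y z h = (1 / h) *\<^sub>R (y - T h y)) (at_right 0)"
    using eventually_at_right_less[of 0] by eventually_elim (simp add: orbit_dquot_def dquot_def)
  ultimately show "(y, z) \<in> A" unfolding A_iff by (simp add: tendsto_cong)
next
  assume "(y, z) \<in> A"
  then have l: "((\<lambda>h. (1 / h) *\<^sub>R (y - T h y)) \<longlongrightarrow> z) (at_right 0)" by (simp add: A_iff)
  have "((\<lambda>h. inverse ((1 - exp (- h)) / h) *\<^sub>R ((1 / h) *\<^sub>R (y - T h y))) \<longlongrightarrow> inverse 1 *\<^sub>R z) (at_right 0)"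
    by (intro tendsto_scaleR tendsto_inverse one_minus_exp_quotient_tendsto l) simp
  moreover have "eventually (\<lambda>h. inverse ((1 - exp (- h)) / h) *\<^sub>R ((1 / h) *\<^sub>R (y - T h y)) = orbit_dquot y z h) (at_right 0)"
    using eventually_at_right_less[of 0] by eventually_elim (simp add: orbit_dquot_def dquot_def)
  ultimately show "(orbit_dquot y z \<longlongrightarrow> z) (at_right 0)" by (simp add: tendsto_cong)
qed

lemma orbit_dquot_Cb: "(y, z) \<in> A \<Longrightarrow> orbit_dquot y z \<in> Cb"
  using dquot_Cb[OF T_Cb, of z y] orbit_dquot_tendsto_iff[of y z] by (simp add: orbit_dquot_def)

lemma orbit_dquot_commute:
  assumes L: "\<And>s x. s \<ge> 0 \<Longrightarrow> T s (blinfun_apply L x) = L (T s x)" and u: "u \<ge> 0"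
  shows "orbit_dquot (L y) (L z) u = L (orbit_dquot y z u)"
  using u by (simp add: orbit_dquot_def dquot_def L blinfun.scaleR_right blinfun.diff_right)

lemma resolvent_dquot_orbit: "u \<ge> 0 \<Longrightarrow> resolvent_dquot (\<lambda>s. T s x) u = orbit_dquot (R x) (x - R x) u"
  using T_R[of u x, symmetric] by (simp add: orbit_dquot_def dquot_def R_apply[symmetric])

text \<open>By the limit of the difference quotients of the resolvent functional along an orbit. This is \<open>(1 + A) R x = x\<close>.\<close>

lemma R_in_A: "(R x, x - R x) \<in> A"
proof -
  have "(resolvent_dquot (\<lambda>s. T s x) \<longlongrightarrow> x - R x) (at_right 0)"
    using resolvent_dquot_tendsto[OF T_Cb, of x] by (simp add: R_apply)
  moreover have "eventually (\<lambda>u. resolvent_dquot (\<lambda>s. T s x) u = orbit_dquot (R x) (x - R x) u) (at_right 0)"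
    using eventually_at_right_less[of 0] by eventually_elim (rule resolvent_dquot_orbit[OF less_imp_le])
  ultimately show ?thesis using tendsto_cong orbit_dquot_tendsto_iff by blast
qed

lemma R_A: "(y, z) \<in> A \<Longrightarrow> R z = y - R y"
  using A_unique[OF A_commute[of y z R] R_in_A[of y]] by (simp add: T_average_commute[OF halfline_exp(1)])

lemma hp_calculus_average:
  assumes \<psi>: "bernstein \<psi>"
  obtains \<mu> \<nu> where "laplace_pair (\<lambda>z. \<psi> z / (1 + z)) (\<mu>, \<nu>)" "halfline_measure \<mu>" "halfline_measure \<nu>"
    "hp_calculus T (\<lambda>z. \<psi> z / (1 + z)) = average T \<mu> - average T \<nu>"
proof -
  obtain p where "laplace_pair (\<lambda>z. \<psi> z / (1 + z)) p" by (rule laplace_pair_exists[OF \<psi>])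
  then have p: "laplace_pair (\<lambda>z. \<psi> z / (1 + z)) (SOME p. laplace_pair (\<lambda>z. \<psi> z / (1 + z)) p)" by (rule someI)
  obtain \<mu> \<nu> where eq: "(SOME p. laplace_pair (\<lambda>z. \<psi> z / (1 + z)) p) = (\<mu>, \<nu>)" by (metis surj_pair)
  note p = p[unfolded eq]
  show thesis
  proof (rule that[OF p])
    show "halfline_measure \<mu>" "halfline_measure \<nu>" using p by (simp_all add: laplace_pair_def)
    show "hp_calculus T (\<lambda>z. \<psi> z / (1 + z)) = average T \<mu> - average T \<nu>"
      unfolding hp_calculus_def eq by simp
  qed
qed

lemma hp_calculus_eq:
  assumes \<psi>: "bernstein \<psi>" and \<rho>: "increment_measure \<psi> \<rho>"
  shows "blinfun_apply (hp_calculus T (\<lambda>z. \<psi> z / (1 + z))) x =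
    at_zero \<psi> *\<^sub>R R x + bochner \<rho> (orbit_dquot (R x) (x - R x))"
proof -
  obtain \<mu> \<nu> where p: "laplace_pair (\<lambda>z. \<psi> z / (1 + z)) (\<mu>, \<nu>)" and \<mu>: "halfline_measure \<mu>" and \<nu>: "halfline_measure \<nu>"
    and hp: "hp_calculus T (\<lambda>z. \<psi> z / (1 + z)) = average T \<mu> - average T \<nu>"
    by (rule hp_calculus_average[OF \<psi>])
  have h: "halfline_measure \<rho>" using \<rho> by (simp add: increment_measure_def)
  have "blinfun_apply (hp_calculus T (\<lambda>z. \<psi> z / (1 + z))) x = bochner \<mu> (\<lambda>s. T s x) - bochner \<nu> (\<lambda>s. T s x)"
    unfolding hp by (simp add: blinfun.diff_left average_apply \<mu> \<nu>)
  also have "\<dots> = at_zero \<psi> *\<^sub>R \<E> (\<lambda>s. T s x) + bochner \<rho> (resolvent_dquot (\<lambda>s. T s x))"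
    by (rule levy_khintchine_functional[OF \<psi> \<rho> p T_Cb, symmetric])
  also have "bochner \<rho> (resolvent_dquot (\<lambda>s. T s x)) = bochner \<rho> (orbit_dquot (R x) (x - R x))"
    by (rule bochner_cong[OF h resolvent_dquot_Cb[OF T_Cb] resolvent_dquot_orbit])
  finally show ?thesis by (simp add: R_apply)
qed

lemma average_hp_calculus_commute:
  assumes \<psi>: "bernstein \<psi>" and \<mu>: "halfline_measure \<mu>"
  shows "average T \<mu> (hp_calculus T (\<lambda>z. \<psi> z / (1 + z)) x) = hp_calculus T (\<lambda>z. \<psi> z / (1 + z)) (average T \<mu> x)"
proof -
  obtain \<mu>' \<nu>' where h: "halfline_measure \<mu>'" "halfline_measure \<nu>'"
    and hp: "hp_calculus T (\<lambda>z. \<psi> z / (1 + z)) = average T \<mu>' - average T \<nu>'"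
    by (rule hp_calculus_average[OF \<psi>])
  show ?thesis
    unfolding hp by (simp add: blinfun.diff_left blinfun.diff_right average_commute[OF \<mu> h(1)] average_commute[OF \<mu> h(2)])
qed

text \<open>\<open>\<psi>(A) x\<close> is \<open>(1 + A)\<close> applied to the image of \<open>x\<close> under the functional calculus; if that image is \<open>R y\<close>, the result is \<open>y\<close>.\<close>

lemma in_bernstein_op:
  assumes "R y = hp_calculus T (\<lambda>z. \<psi> z / (1 + z)) x"
  shows "(x, z) \<in> bernstein_op T \<psi> \<longleftrightarrow> z = y"
proof -
  have "(x, z) \<in> bernstein_op T \<psi> \<longleftrightarrow> (\<exists>v. z = R y + v \<and> (R y, v) \<in> A)"
    using assms by (auto simp: bernstein_op_def bop_def)
  also have "\<dots> \<longleftrightarrow> z = y"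
  proof
    assume "\<exists>v. z = R y + v \<and> (R y, v) \<in> A"
    then obtain v where "z = R y + v" "(R y, v) \<in> A" by blast
    moreover from this(2) have "v = y - R y" by (rule A_unique[OF _ R_in_A])
    ultimately show "z = y" by simp
  next
    assume "z = y"
    then show "\<exists>v. z = R y + v \<and> (R y, v) \<in> A" by (intro exI[of _ "y - R y"]) (simp add: R_in_A)
  qed
  finally show ?thesis .
qed

end

section \<open>The Yosida condition\<close>

locale yosida_semigroup = bounded_semigroup +
  fixes c\<^sub>0 c\<^sub>1 :: real
  assumes c0: "c\<^sub>0 \<ge> 0" and c1: "c\<^sub>1 > 0" and yosida: "yosida T c\<^sub>0 c\<^sub>1"
begin

text \<open>The bounded operator \<open>A T(p)\<close>; the Yosida condition provides it for \<open>p > 0\<close>.\<close>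

definition AT :: "real \<Rightarrow> 'a \<Rightarrow> 'a" where
  "AT p x = (THE y. (T p x, y) \<in> A)"

lemma AT: "p > 0 \<Longrightarrow> (T p x, AT p x) \<in> A"
  and norm_AT_le: "p > 0 \<Longrightarrow> norm (AT p x) \<le> (c\<^sub>0 + c\<^sub>1 / p) * norm x"
proof -
  assume p: "p > 0"
  then obtain B where B: "bop (T p) O A = bop B" "norm B \<le> c\<^sub>0 + c\<^sub>1 / p"
    using yosida unfolding yosida_def by blast
  have "(x, B x) \<in> bop (T p) O A" unfolding B(1) by (auto simp: bop_def)
  then have Bx: "(T p x, B x) \<in> A" by (auto simp: bop_def)
  then have eq: "AT p x = B x" unfolding AT_def using A_unique by blast
  show "(T p x, AT p x) \<in> A" using Bx eq by simp
  have "norm (B x) \<le> norm B * norm x" by (rule norm_blinfun)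
  also have "\<dots> \<le> (c\<^sub>0 + c\<^sub>1 / p) * norm x" by (intro mult_right_mono B) simp
  finally show "norm (AT p x) \<le> (c\<^sub>0 + c\<^sub>1 / p) * norm x" unfolding eq .
qed

lemma T_AT: "p > 0 \<Longrightarrow> s \<ge> 0 \<Longrightarrow> T s (AT p x) = AT (s + p) x"
  using A_unique[OF A_T[OF AT, of p s x]] AT[of "s + p" x] T_add[of s p x] by simp

lemma AT_T: "p > 0 \<Longrightarrow> s \<ge> 0 \<Longrightarrow> AT p (T s x) = AT (s + p) x"
  using A_unique[OF AT[of p "T s x"]] AT[of "s + p" x] T_add[of p s x] by (simp add: add.commute)

text \<open>With \<open>y = T p x\<close> and \<open>h = u / n\<close>, \<open>y - T u y\<close> is the sum of the \<open>n\<close> terms \<open>T(kh) (y - T h y)\<close>. Each is \<open>h\<close> times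
  \<open>T(kh) A y\<close> up to an error \<open>o(h)\<close> uniform in \<open>k\<close>, and \<open>T(kh) A y = A T(p + kh) x\<close> is controlled by the Yosida condition.\<close>

lemma norm_T_increment_le:
  assumes p: "p > 0" and u: "u \<ge> 0"
  shows "norm (T p x - T (p + u) x) \<le> u * (c\<^sub>0 + c\<^sub>1 / p) * norm x"
proof (cases "u = 0")
  case False
  then have u: "u > 0" using u by simp
  define y where "y = T p x"
  define z where "z = AT p x"
  define K where "K = (c\<^sub>0 + c\<^sub>1 / p) * norm x"
  define D where "D h = (1 / h) *\<^sub>R (y - T h y)" for h
  have yz: "(D \<longlongrightarrow> z) (at_right 0)"
    using AT[OF p, of x] unfolding A_iff y_def z_def D_def[abs_def] .
  have Tz: "norm (T s z) \<le> K" if "s \<ge> 0" for s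
  proof -
    have "norm (T s z) \<le> (c\<^sub>0 + c\<^sub>1 / (s + p)) * norm x"
      unfolding z_def T_AT[OF p that] using p that by (intro norm_AT_le) simp
    also have "\<dots> \<le> K" unfolding K_def using p that c1
      by (intro mult_right_mono add_left_mono divide_left_mono) auto
    finally show ?thesis .
  qed
  have bound: "norm (y - T u y) \<le> u * (K + M * norm (D (u / real (Suc n)) - z))" for n
  proof -
    define N where "N = real (Suc n)"
    define h where "h = u / N"
    have h: "h > 0" "N > 0" "N * h = u" using u by (auto simp: h_def N_def)
    have step: "norm (T (real k * h) y - T (real (Suc k) * h) y) \<le> h * (K + M * norm (D h - z))" for k
    proof -
      have kh: "real k * h \<ge> 0" using h by simp
      have "T (real (Suc k) * h) y = T (real k * h) (T h y)"
        using T_add[OF kh, of h y] h by (simp add: algebra_simps)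
      then have "T (real k * h) y - T (real (Suc k) * h) y = T (real k * h) (h *\<^sub>R D h)"
        using h by (simp add: D_def blinfun.diff_right)
      also have "\<dots> = h *\<^sub>R (T (real k * h) z + T (real k * h) (D h - z))"
        by (simp add: blinfun.scaleR_right blinfun.diff_right)
      also have "norm \<dots> \<le> h * (K + M * norm (D h - z))"
      proof -
        have "norm (T (real k * h) z + T (real k * h) (D h - z)) \<le> K + M * norm (D h - z)"
          by (rule order_trans[OF norm_triangle_ineq add_mono[OF Tz[OF kh] norm_T_apply_le[OF kh]]])
        then show ?thesis using h by (simp add: mult_left_mono)
      qed
      finally show ?thesis .
    qed
    have "y - T u y = (\<Sum>k<Suc n. T (real k * h) y - T (real (Suc k) * h) y)"
      using h(3) sum_lessThan_telescope'[of "\<lambda>k. T (real k * h) y" "Suc n"] by (simp add: N_def)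
    also have "norm \<dots> \<le> real (card {..<Suc n}) * (h * (K + M * norm (D h - z)))"
      by (rule sum_norm_bound) (rule step)
    also have "\<dots> = u * (K + M * norm (D h - z))"
      using h(3) by (simp add: N_def mult.assoc[symmetric])
    finally show ?thesis by (simp add: h_def N_def)
  qed
  have "filterlim (\<lambda>n. u / real (Suc n)) (at_right 0) sequentially"
  proof (intro filterlim_at[THEN iffD2] conjI)
    have "(\<lambda>n. u * inverse (real (Suc n))) \<longlonglongrightarrow> u * 0" by (intro tendsto_intros LIMSEQ_inverse_real_of_nat)
    then show "(\<lambda>n. u / real (Suc n)) \<longlonglongrightarrow> 0" by (simp add: divide_inverse)
  qed (use u in auto)
  from filterlim_compose[OF yz this]
  have "(\<lambda>n. u * (K + M * norm (D (u / real (Suc n)) - z))) \<longlonglongrightarrow> u * (K + M * norm (z - z))"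
    by (intro tendsto_intros)
  from LIMSEQ_le_const[OF this, of "norm (y - T u y)"] bound
  have "norm (y - T u y) \<le> u * K" by auto
  moreover have "T u y = T (p + u) x" using T_add[of u p x] p u by (simp add: y_def add.commute)
  ultimately show ?thesis by (simp add: y_def K_def mult.assoc)
qed simp

text \<open>The minimum of the two bounds \<open>2 M\<close> and \<open>u (c\<^sub>0 + c\<^sub>1 / p)\<close> is at most the sum of the minima for \<open>c\<^sub>0\<close> and for \<open>c\<^sub>1 / p\<close>; both
  are smoothed by \<open>min(1, v) \<le> 2 v / (1 + v)\<close>, with \<open>v = u c\<^sub>0\<close> and \<open>v = u / p\<close>.\<close>

lemma norm_orbit_dquot_le:
  assumes p: "p > 0" and u: "u \<ge> 0"
  shows "norm (orbit_dquot (T p x) (AT p x) u) \<le>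
    todd u * ((4 * M * (if c\<^sub>0 = 0 then 0 else 1 / (1 / c\<^sub>0 + u)) + 2 * max (2 * M) c\<^sub>1 / (p + u)) * norm x)"
proof (cases "x = 0")
  case True
  have "norm (AT p 0) \<le> 0" using norm_AT_le[OF p, of 0] by simp
  then show ?thesis using True by (simp add: orbit_dquot_def dquot_def)
next
  case False
  note M1 = M_ge_1[OF False]
  define m where "m = max (2 * M) c\<^sub>1"
  define g where "g = (if c\<^sub>0 = 0 then 0 else 1 / (1 / c\<^sub>0 + u))"
  have m: "m \<ge> 2 * M" "m \<ge> c\<^sub>1" "m > 0" using c1 by (auto simp: m_def)
  have g_c0: "g = c\<^sub>0 / (1 + u * c\<^sub>0)" using c0 u by (auto simp: g_def field_simps)
  have pu: "p + u > 0" using p u by simp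
  have d1: "1 + u * c\<^sub>0 > 0" using c0 u by (simp add: add_pos_nonneg)
  have key: "min (2 * M) (u * (c\<^sub>0 + c\<^sub>1 / p)) \<le> u * (4 * M * g + 2 * m / (p + u))"
  proof -
    have a: "min (2 * M) (u * c\<^sub>0) \<le> u * (4 * M * g)"
    proof (cases "u * c\<^sub>0 \<le> 1")
      case True
      have "u * c\<^sub>0 * (1 + u * c\<^sub>0) \<le> u * c\<^sub>0 * (4 * M)"
        using True M1 c0 u by (intro mult_left_mono) auto
      then have "u * c\<^sub>0 \<le> u * (4 * M * g)" using d1 by (simp add: g_c0 field_simps)
      then show ?thesis by simp
    next
      case False
      then have "1 + u * c\<^sub>0 \<le> 2 * (u * c\<^sub>0)" by linarith
      then have "2 * M * (1 + u * c\<^sub>0) \<le> 2 * M * (2 * (u * c\<^sub>0))"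
        using M1 by (intro mult_left_mono) simp_all
      then have "2 * M \<le> u * (4 * M * g)" using d1 by (simp add: g_c0 field_simps)
      then show ?thesis by (rule min.coboundedI1)
    qed
    have b: "min (2 * M) (u * (c\<^sub>1 / p)) \<le> u * (2 * m / (p + u))"
    proof (cases "u \<le> p")
      case True
      have "u * c\<^sub>1 * (p + u) \<le> u * m * (2 * p)"
        using True m p u c1 by (intro mult_mono) auto
      then have "u * (c\<^sub>1 / p) \<le> u * (2 * m / (p + u))" using p pu by (simp add: field_simps)
      then show ?thesis by simp
    next
      case False
      have "2 * M * (p + u) \<le> m * (2 * u)"
        using False m p u by (intro mult_mono) auto
      then have "2 * M \<le> u * (2 * m / (p + u))" using pu by (simp add: field_simps)
      then show ?thesis by simp
    qed
    have "min (2 * M) (u * (c\<^sub>0 + c\<^sub>1 / p)) \<le> min (2 * M) (u * c\<^sub>0) + min (2 * M) (u * (c\<^sub>1 / p))"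
    proof -
      have "u * c\<^sub>0 \<ge> 0" "u * (c\<^sub>1 / p) \<ge> 0" using c0 c1 u p by auto
      then show ?thesis using M_nonneg by (auto simp: min_def distrib_left)
    qed
    also have "\<dots> \<le> u * (4 * M * g) + u * (2 * m / (p + u))" using a b by (rule add_mono)
    finally show ?thesis by (simp add: distrib_left)
  qed
  have "norm (orbit_dquot (T p x) (AT p x) u) \<le> todd u * ((4 * M * g + 2 * m / (p + u)) * norm x)"
  proof (cases "u = 0")
    case True
    have "c\<^sub>0 + c\<^sub>1 / p \<le> 4 * M * g + 2 * m / (p + u)"
    proof -
      have "1 * c\<^sub>0 \<le> 4 * M * c\<^sub>0" using M1 c0 by (intro mult_right_mono) auto
      moreover have "c\<^sub>1 / p \<le> 2 * m / p" using m p by (intro divide_right_mono) auto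
      ultimately show ?thesis using True by (simp add: g_c0)
    qed
    then have "(c\<^sub>0 + c\<^sub>1 / p) * norm x \<le> (4 * M * g + 2 * m / (p + u)) * norm x"
      by (intro mult_right_mono) auto
    then show ?thesis using True norm_AT_le[OF p, of x]
      by (simp add: orbit_dquot_def dquot_def todd_def)
  next
    case False
    then have u0: "u > 0" using u by simp
    have e: "1 - exp (- u) > 0" using u0 by simp
    have "norm (T p x - T u (T p x)) \<le> min (2 * M) (u * (c\<^sub>0 + c\<^sub>1 / p)) * norm x"
    proof -
      have eq: "T u (T p x) = T (p + u) x" using T_add[of u p x] p u by (simp add: add.commute)
      have "norm (T p x - T (p + u) x) \<le> 2 * M * norm x"
        using norm_triangle_ineq4[of "T p x" "T (p + u) x"] norm_T_apply_le[of p x] norm_T_apply_le[of "p + u" x] p u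
        by simp
      moreover note norm_T_increment_le[OF p u, of x]
      ultimately show ?thesis unfolding eq by (auto simp: min_def)
    qed
    also have "\<dots> \<le> u * (4 * M * g + 2 * m / (p + u)) * norm x"
      by (intro mult_right_mono key) simp
    finally have "norm (T p x - T u (T p x)) / (1 - exp (- u)) \<le> u * (4 * M * g + 2 * m / (p + u)) * norm x / (1 - exp (- u))"
      using e by (intro divide_right_mono) auto
    then show ?thesis using u0 by (simp add: orbit_dquot_def dquot_def todd_def mult.assoc)
  qed
  then show ?thesis by (simp add: m_def g_def)
qed

end

section \<open>The subordinate semigroup\<close>

text \<open>The operators below approximate \<open>(\<psi>(A) - \<psi>(0)) S\<close> by \<open>(\<psi>(A) - \<psi>(0)) T(\<delta>) S\<close>.\<close>

locale subordinated_yosida_semigroup = yosida_semigroup +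
  fixes \<psi> \<phi> :: "real \<Rightarrow> real" and \<rho> :: "real measure" and t :: real
  assumes \<psi>: "bernstein \<psi>" and \<phi>: "bernstein \<phi>" and t: "t > 0"
    and J_finite: "J_int (\<lambda>s. exp (- t * \<phi> s)) \<psi> < \<infinity>"
    and \<rho>: "increment_measure \<psi> \<rho>"
begin

abbreviation "\<mu> \<equiv> subordinator \<phi> t"
abbreviation "S \<equiv> average T \<mu>"

lemma halfline_\<mu>: "halfline_measure \<mu>" and halfline_\<rho>: "halfline_measure \<rho>"
  using subordinator(1)[OF \<phi>, of t] t \<rho> by (auto simp: increment_measure_def)

text \<open>This is \<open>(\<psi>(A) - \<psi>(0)) T(\<delta>) x\<close>.\<close>

definition psi_T :: "real \<Rightarrow> 'a \<Rightarrow> 'a" where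
  "psi_T \<delta> x = bochner \<rho> (orbit_dquot (T \<delta> x) (AT \<delta> x))"

lemma orbit_dquot_AT_Cb: "\<delta> > 0 \<Longrightarrow> orbit_dquot (T \<delta> x) (AT \<delta> x) \<in> Cb"
  by (rule orbit_dquot_Cb[OF AT])

lemma AT_add: "\<delta> > 0 \<Longrightarrow> AT \<delta> (x + y) = AT \<delta> x + AT \<delta> y"
  and AT_scaleR: "\<delta> > 0 \<Longrightarrow> AT \<delta> (c *\<^sub>R x) = c *\<^sub>R AT \<delta> x"
proof -
  assume d: "\<delta> > 0"
  note x = AT[OF d, of x, unfolded A_iff] and y = AT[OF d, of y, unfolded A_iff]
  have "(T \<delta> (x + y), AT \<delta> x + AT \<delta> y) \<in> A"
    using tendsto_add[OF x y] unfolding A_iff by (simp add: blinfun.add_right algebra_simps)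
  with AT[OF d] show "AT \<delta> (x + y) = AT \<delta> x + AT \<delta> y" by (rule A_unique)
  have "(T \<delta> (c *\<^sub>R x), c *\<^sub>R AT \<delta> x) \<in> A"
    using tendsto_scaleR[OF tendsto_const x, of c] unfolding A_iff
    by (simp add: blinfun.scaleR_right algebra_simps)
  with AT[OF d] show "AT \<delta> (c *\<^sub>R x) = c *\<^sub>R AT \<delta> x" by (rule A_unique)
qed

lemma psi_T_add: "\<delta> > 0 \<Longrightarrow> psi_T \<delta> (x + y) = psi_T \<delta> x + psi_T \<delta> y"
proof -
  assume d: "\<delta> > 0"
  have "orbit_dquot (T \<delta> (x + y)) (AT \<delta> (x + y)) = (\<lambda>u. orbit_dquot (T \<delta> x) (AT \<delta> x) u + orbit_dquot (T \<delta> y) (AT \<delta> y) u)"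
    by (rule ext) (simp add: orbit_dquot_def dquot_def AT_add[OF d] blinfun.add_right algebra_simps)
  then show ?thesis
    by (simp add: psi_T_def bochner_add[OF halfline_\<rho> orbit_dquot_AT_Cb[OF d] orbit_dquot_AT_Cb[OF d]])
qed

lemma psi_T_scaleR: "\<delta> > 0 \<Longrightarrow> psi_T \<delta> (c *\<^sub>R x) = c *\<^sub>R psi_T \<delta> x"
proof -
  assume d: "\<delta> > 0"
  have "orbit_dquot (T \<delta> (c *\<^sub>R x)) (AT \<delta> (c *\<^sub>R x)) = (\<lambda>u. c *\<^sub>R orbit_dquot (T \<delta> x) (AT \<delta> x) u)"
    by (rule ext) (simp add: orbit_dquot_def dquot_def AT_scaleR[OF d] blinfun.scaleR_right algebra_simps)
  then show ?thesis
    by (simp add: psi_T_def bochner_scaleR[OF halfline_\<rho> orbit_dquot_AT_Cb[OF d]])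
qed

lemma psi_T_diff: "\<delta> > 0 \<Longrightarrow> psi_T \<delta> (x - y) = psi_T \<delta> x - psi_T \<delta> y"
  using psi_T_add[of \<delta> x "- y"] psi_T_scaleR[of \<delta> "-1" y] by simp

lemma T_psi_T: "\<delta> > 0 \<Longrightarrow> s \<ge> 0 \<Longrightarrow> T s (psi_T \<delta> x) = psi_T (s + \<delta>) x"
proof -
  assume d: "\<delta> > 0" and s: "s \<ge> 0"
  have "T s (psi_T \<delta> x) = bochner \<rho> (\<lambda>u. T s (orbit_dquot (T \<delta> x) (AT \<delta> x) u))"
    unfolding psi_T_def by (rule bochner_bounded_linear[OF halfline_\<rho> blinfun.bounded_linear_right orbit_dquot_AT_Cb[OF d], symmetric])
  also have "\<dots> = bochner \<rho> (orbit_dquot (T s (T \<delta> x)) (T s (AT \<delta> x)))"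
    by (rule bochner_cong[OF halfline_\<rho> Cb_bounded_linear[OF blinfun.bounded_linear_right orbit_dquot_AT_Cb[OF d]]])
       (simp add: orbit_dquot_commute T_commute s)
  also have "\<dots> = psi_T (s + \<delta>) x" using d s by (simp add: psi_T_def T_AT T_add)
  finally show ?thesis .
qed

lemma psi_T_T: "\<delta> > 0 \<Longrightarrow> s \<ge> 0 \<Longrightarrow> psi_T \<delta> (T s x) = psi_T (s + \<delta>) x"
  using T_add[of \<delta> s x] by (simp add: psi_T_def AT_T add.commute)

text \<open>The resolvent turns \<open>A\<close> into \<open>1 - R\<close>, so the formula for the functional calculus of \<open>\<psi>(z) / (1 + z)\<close> applies.\<close>

lemma R_psi_T: "\<delta> > 0 \<Longrightarrow> R (psi_T \<delta> x) = hp_calculus T (\<lambda>z. \<psi> z / (1 + z)) (T \<delta> x) - at_zero \<psi> *\<^sub>R R (T \<delta> x)"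
proof -
  assume d: "\<delta> > 0"
  have "R (psi_T \<delta> x) = bochner \<rho> (\<lambda>u. R (orbit_dquot (T \<delta> x) (AT \<delta> x) u))"
    unfolding psi_T_def by (rule bochner_bounded_linear[OF halfline_\<rho> blinfun.bounded_linear_right orbit_dquot_AT_Cb[OF d], symmetric])
  also have "\<dots> = bochner \<rho> (orbit_dquot (R (T \<delta> x)) (R (AT \<delta> x)))"
    by (rule bochner_cong[OF halfline_\<rho> Cb_bounded_linear[OF blinfun.bounded_linear_right orbit_dquot_AT_Cb[OF d]]])
       (rule orbit_dquot_commute[symmetric, OF T_average_commute[OF halfline_exp(1)]])
  also have "R (AT \<delta> x) = T \<delta> x - R (T \<delta> x)" by (rule R_A[OF AT[OF d]])
  finally show ?thesis using hp_calculus_eq[OF \<psi> \<rho>, of "T \<delta> x"] by simp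
qed

text \<open>This is \<open>c\<^sub>0 / (1 + c\<^sub>0 u)\<close>, written as the integral of \<open>e\<^sup>-\<^sup>s\<^sup>u\<close> against the weight \<open>e\<^sup>-\<^sup>s\<^sup>/\<^sup>c\<^sup>0\<close> of \<open>C[c\<^sub>0; \<psi>]\<close>.\<close>

definition yosida_weight :: "real \<Rightarrow> real" where
  "yosida_weight u = (if c\<^sub>0 = 0 then 0 else 1 / (1 / c\<^sub>0 + u))"

definition weight_int :: ennreal where
  "weight_int = (\<integral>\<^sup>+ u. ennreal (todd u * yosida_weight u) \<partial>\<rho>)"

definition max_const :: real where "max_const = max (2 * M) c\<^sub>1"

text \<open>The bound for \<open>(\<psi>(A) - \<psi>(0)) S\<close>, with the integral over \<open>\<rho>\<close> in place of \<open>C[c\<^sub>0; \<psi>]\<close>, since its finiteness is immediate.\<close>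

definition norm_bound_enn :: ennreal where
  "norm_bound_enn = ennreal (2 * max_const) * J_int (\<lambda>s. exp (- t * \<phi> s)) \<psi> + ennreal (4 * M * exp (- t * at_zero \<phi>)) * weight_int"

lemma yosida_weight_zero: "c\<^sub>0 = 0 \<Longrightarrow> yosida_weight u = 0"
  unfolding yosida_weight_def by simp

lemma weight_int_le: "weight_int \<le> C_int c\<^sub>0 \<psi>"
proof (cases "c\<^sub>0 = 0")
  case True
  have "weight_int = 0" unfolding weight_int_def yosida_weight_zero[OF True] by simp
  then show ?thesis by (simp only: zero_le)
next
  case False
  then show ?thesis using increment_measure_C_le[OF \<psi> \<rho>, of c\<^sub>0] c0 by (simp add: weight_int_def yosida_weight_def)
qed

lemma weight_int_finite: "weight_int < \<infinity>"
proof -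
  interpret finite_measure \<rho> using halfline_\<rho> by (simp add: halfline_measure_def)
  have "weight_int \<le> (\<integral>\<^sup>+ u. ennreal (c\<^sub>0 + 1) \<partial>\<rho>)"
    unfolding weight_int_def
  proof (intro nn_integral_mono ennreal_leI)
    fix u assume "u \<in> space \<rho>"
    then have u: "u \<ge> 0" by (simp add: halfline_space[OF halfline_\<rho>])
    show "todd u * yosida_weight u \<le> c\<^sub>0 + 1"
    proof (cases "c\<^sub>0 = 0")
      case True
      show ?thesis unfolding yosida_weight_zero[OF True] using c0 by simp
    next
      case False
      then have c: "c\<^sub>0 > 0" using c0 by simp
      have p: "1 / c\<^sub>0 + u > 0" using c u by (simp add: add_pos_nonneg)
      have "todd u / (1 / c\<^sub>0 + u) \<le> (1 + u) / (1 / c\<^sub>0 + u)"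
        using p by (intro divide_right_mono todd_le u) simp
      also have "\<dots> \<le> c\<^sub>0 + 1"
      proof -
        have "(c\<^sub>0 + 1) * (1 / c\<^sub>0 + u) = 1 + u + c\<^sub>0 * u + 1 / c\<^sub>0" using c by (simp add: field_simps)
        moreover have "c\<^sub>0 * u \<ge> 0" "1 / c\<^sub>0 \<ge> 0" using c u by auto
        ultimately have "1 + u \<le> (c\<^sub>0 + 1) * (1 / c\<^sub>0 + u)" by linarith
        then show ?thesis using p by (simp only: pos_divide_le_eq)
      qed
      finally show ?thesis using False by (simp add: yosida_weight_def)
    qed
  qed
  also have "\<dots> < \<infinity>" by (simp add: emeasure_eq_measure ennreal_mult_less_top)
  finally show ?thesis .
qed

lemma norm_bound_enn_finite: "norm_bound_enn < \<infinity>"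
  using weight_int_finite J_finite by (simp add: norm_bound_enn_def ennreal_mult_less_top)

text \<open>Integrating the pointwise estimate at \<open>p = r + \<delta>\<close> over \<open>\<rho>\<close>. Since \<open>1 / (r + \<delta> + u) \<le> \<integral> e\<^sup>-\<^sup>s\<^sup>(\<^sup>r\<^sup>+\<^sup>u\<^sup>) ds\<close>, the
  resulting bound does not depend on \<open>\<delta>\<close>.\<close>

lemma nn_norm_psi_T_le:
  assumes r: "r \<ge> 0" and d: "\<delta> > 0"
  shows "ennreal (norm (psi_T (r + \<delta>) x)) \<le> ennreal (norm x) * (ennreal (4 * M) * weight_int +
     ennreal (2 * max_const) * (\<integral>\<^sup>+ u. ennreal (todd u) *
       exp_int (r + u) \<partial>\<rho>))"
proof -
  have idr [measurable]: "(\<lambda>u. u) \<in> borel_measurable \<rho>"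
    by (rule halfline_measurable[OF halfline_\<rho>]) (intro continuous_intros)
  interpret finite_measure \<rho> using halfline_\<rho> by (simp add: halfline_measure_def)
  let ?I = "\<lambda>u. exp_int (r + u)"
  let ?p = "r + \<delta>"
  have p: "?p > 0" using r d by simp
  have m0: "max_const \<ge> 0" using c1 by (simp add: max_const_def)
  have meas1: "(\<lambda>u. ennreal (todd u * yosida_weight u)) \<in> borel_measurable \<rho>"
    using idr unfolding yosida_weight_def by measurable
  have meas2: "(\<lambda>u. ennreal (todd u) * ?I u) \<in> borel_measurable \<rho>"
    using idr by measurable
  have "ennreal (norm (psi_T ?p x)) \<le> (\<integral>\<^sup>+ u. ennreal (norm (orbit_dquot (T ?p x) (AT ?p x) u)) \<partial>\<rho>)"
    unfolding psi_T_def by (rule norm_bochner_le[OF halfline_\<rho> orbit_dquot_AT_Cb[OF p]])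
  also have "\<dots> \<le> (\<integral>\<^sup>+ u. ennreal (norm x) * (ennreal (4 * M) * ennreal (todd u * yosida_weight u) +
      ennreal (2 * max_const) * (ennreal (todd u) * ?I u)) \<partial>\<rho>)"
  proof (rule nn_integral_mono)
    fix u assume "u \<in> space \<rho>"
    then have u: "u \<ge> 0" by (simp add: halfline_space[OF halfline_\<rho>])
    have q: "todd u \<ge> 0" by (rule todd_nonneg[OF u])
    have g0: "yosida_weight u \<ge> 0" using c0 u by (simp add: yosida_weight_def)
    have pu: "?p + u > 0" using p u by simp
    have I: "ennreal (1 / (?p + u)) \<le> ?I u"
      unfolding nn_integral_exp_Ioi[OF pu, symmetric]
    proof (rule nn_integral_mono)
      fix s :: real
      show "ennreal (exp (- (s * (?p + u)))) * indicator {0<..} s \<le> ennreal (exp (- (s * (r + u)))) * indicator {0<..} s"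
        using d by (auto split: split_indicator intro!: ennreal_leI mult_left_mono)
    qed
    have "norm (orbit_dquot (T ?p x) (AT ?p x) u)
        \<le> todd u * ((4 * M * yosida_weight u + 2 * max_const / (?p + u)) * norm x)"
      using norm_orbit_dquot_le[OF p u, of x] by (simp add: yosida_weight_def max_const_def)
    also have "\<dots> = norm x * (4 * M * (todd u * yosida_weight u) + 2 * max_const * (todd u * (1 / (?p + u))))"
      by (simp add: algebra_simps)
    finally have "ennreal (norm (orbit_dquot (T ?p x) (AT ?p x) u)) \<le> ennreal (norm x * (4 * M * (todd u * yosida_weight u) + 2 * max_const * (todd u * (1 / (?p + u)))))"
      by (rule ennreal_leI)
    also have "\<dots> = ennreal (norm x) * (ennreal (4 * M) * ennreal (todd u * yosida_weight u) +
      ennreal (2 * max_const) * (ennreal (todd u) * ennreal (1 / (?p + u))))"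
    proof -
      have alg: "ennreal (a * (b * (c * d) + e * (c * f))) =
          ennreal a * (ennreal b * ennreal (c * d) + ennreal e * (ennreal c * ennreal f))"
        if "a \<ge> 0" "b \<ge> 0" "c \<ge> 0" "d \<ge> 0" "e \<ge> 0" "f \<ge> 0" for a b c d e f :: real
        using that by (simp add: ennreal_mult ennreal_plus)
      show ?thesis by (rule alg) (use q g0 m0 M_nonneg pu in auto)
    qed
    also have "\<dots> \<le> ennreal (norm x) * (ennreal (4 * M) * ennreal (todd u * yosida_weight u) +
      ennreal (2 * max_const) * (ennreal (todd u) * ?I u))"
      by (intro mult_left_mono add_left_mono I) auto
    finally show "ennreal (norm (orbit_dquot (T ?p x) (AT ?p x) u)) \<le> \<dots>" .
  qed
  also have "\<dots> = ennreal (norm x) * (ennreal (4 * M) * weight_int + ennreal (2 * max_const) * (\<integral>\<^sup>+ u. ennreal (todd u) * ?I u \<partial>\<rho>))"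
    unfolding weight_int_def using meas1 meas2 by (simp add: nn_integral_cmult nn_integral_add)
  finally show ?thesis .
qed

lemma nn_norm_S_psi_T_le:
  assumes d: "\<delta> > 0"
  shows "ennreal (norm (S (psi_T \<delta> x))) \<le> ennreal (norm x) * norm_bound_enn"
proof -
  let ?G = "\<lambda>r. \<integral>\<^sup>+ u. ennreal (todd u) *
       exp_int (r + u) \<partial>\<rho>"
  have idr: "(\<lambda>u. u) \<in> borel_measurable \<rho>"
    by (rule halfline_measurable[OF halfline_\<rho>]) (intro continuous_intros)
  have idm: "(\<lambda>u. u) \<in> borel_measurable \<mu>"
    by (rule halfline_measurable[OF halfline_\<mu>]) (intro continuous_intros)
  interpret R0: finite_measure \<rho> using halfline_\<rho> by (simp add: halfline_measure_def)
  interpret m0: finite_measure \<mu> using halfline_\<mu> by (simp add: halfline_measure_def)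
  have G: "?G \<in> borel_measurable borel"
    using idr by measurable
  have G': "?G \<in> borel_measurable \<mu>" using measurable_compose[OF idm G] by simp
  have mass: "emeasure \<mu> (space \<mu>) = ennreal (exp (- t * at_zero \<phi>))"
    using subordinator(3)[OF \<phi>, of t] t by (simp add: m0.emeasure_eq_measure halfline_space[OF halfline_\<mu>])
  define J' where "J' = (\<integral>\<^sup>+ r. ?G r \<partial>\<mu>)"
  have J': "J' \<le> J_int (\<lambda>s. exp (- t * \<phi> s)) \<psi>"
    unfolding J'_def using t by (intro increment_measure_J_le[OF \<psi> \<rho> \<phi>]) simp
  have "ennreal (norm (S (psi_T \<delta> x))) \<le> (\<integral>\<^sup>+ r. ennreal (norm (T r (psi_T \<delta> x))) \<partial>\<mu>)"
    unfolding average_apply[OF halfline_\<mu>] by (rule norm_bochner_le[OF halfline_\<mu> T_Cb])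
  also have "(\<integral>\<^sup>+ r. ennreal (norm (T r (psi_T \<delta> x))) \<partial>\<mu>)
      \<le> (\<integral>\<^sup>+ r. ennreal (norm x) * (ennreal (4 * M) * weight_int + ennreal (2 * max_const) * ?G r) \<partial>\<mu>)"
    by (intro nn_integral_mono) (simp add: halfline_space[OF halfline_\<mu>] T_psi_T[OF d] nn_norm_psi_T_le[OF _ d])
  finally have 1: "ennreal (norm (S (psi_T \<delta> x)))
      \<le> (\<integral>\<^sup>+ r. ennreal (norm x) * (ennreal (4 * M) * weight_int + ennreal (2 * max_const) * ?G r) \<partial>\<mu>)" .
  have 2: "(\<integral>\<^sup>+ r. ennreal (norm x) * (ennreal (4 * M) * weight_int + ennreal (2 * max_const) * ?G r) \<partial>\<mu>)
      = ennreal (norm x) * (ennreal (4 * M) * weight_int * ennreal (exp (- t * at_zero \<phi>)) + ennreal (2 * max_const) * J')"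
    using G' by (simp add: nn_integral_cmult nn_integral_add mass J'_def)
  have "ennreal (norm (S (psi_T \<delta> x)))
      \<le> ennreal (norm x) * (ennreal (4 * M) * weight_int * ennreal (exp (- t * at_zero \<phi>)) + ennreal (2 * max_const) * J_int (\<lambda>s. exp (- t * \<phi> s)) \<psi>)"
    by (rule order_trans[OF 1[unfolded 2]]) (intro mult_left_mono add_left_mono J', auto)
  then show ?thesis
    using M_nonneg by (simp add: norm_bound_enn_def ennreal_mult mult_ac add.commute)
qed

definition norm_bound :: real where "norm_bound = enn2real norm_bound_enn"

lemma ennreal_norm_bound: "ennreal norm_bound = norm_bound_enn" using norm_bound_enn_finite by (simp add: norm_bound_def)

lemma norm_bound_nonneg: "norm_bound \<ge> 0" by (simp add: norm_bound_def)

lemma norm_S_psi_T_le: "\<delta> > 0 \<Longrightarrow> norm (S (psi_T \<delta> x)) \<le> norm_bound * norm x"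
  using nn_norm_S_psi_T_le[of \<delta> x] norm_bound_nonneg
  by (simp add: ennreal_norm_bound[symmetric] mult.commute flip: ennreal_mult)

text \<open>On a vector \<open>T h x\<close> the approximants are \<open>S \<Psi>\<^sub>h T(\<delta>) x\<close>, with \<open>\<Psi>\<^sub>h\<close> written \<open>psi_T h\<close> here, and converge because \<open>T(\<delta>) x\<close> does.
  Such vectors are dense and the approximants are uniformly bounded.\<close>

lemma S_psi_T_convergent: "convergent (\<lambda>n. S (psi_T (inverse (real (Suc n))) x))"
proof -
  define d where "d n = inverse (real (Suc n))" for n
  have d: "d n > 0" for n by (simp add: d_def)
  have dlim: "(\<lambda>n. T (d n) x) \<longlonglongrightarrow> x"
    unfolding d_def by (rule T_inverse_Suc_tendsto)
  have "Cauchy (\<lambda>n. S (psi_T (d n) x))"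
  proof (rule metric_CauchyI)
    fix e :: real assume e: "e > 0"
    define e' where "e' = e / (3 * (norm_bound + 1))"
    have e': "e' > 0" "3 * norm_bound * e' < e" using e norm_bound_nonneg by (auto simp: e'_def field_simps)
    have "eventually (\<lambda>h. dist (T h x) x < e' \<and> h > 0) (at_right 0)"
      by (intro eventually_conj tendstoD[OF T_tendsto e'(1)] eventually_at_right_less)
    then obtain h where h: "h > 0" "norm (x - T h x) \<le> e'"
      using eventually_happens[of _ "at_right (0::real)"] by (auto simp: dist_norm norm_minus_commute intro: less_imp_le)
    obtain n0 where n0: "\<And>i j. i \<ge> n0 \<Longrightarrow> j \<ge> n0 \<Longrightarrow> norm (T (d i) x - T (d j) x) < e'"
      using metric_CauchyD[OF LIMSEQ_imp_Cauchy[OF dlim] e'(1)] by (auto simp: dist_norm)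
    show "\<exists>n0. \<forall>i\<ge>n0. \<forall>j\<ge>n0. dist (S (psi_T (d i) x)) (S (psi_T (d j) x)) < e"
    proof (intro exI allI impI)
      fix i j assume ij: "i \<ge> n0" "j \<ge> n0"
      have swap: "psi_T (d i) (T h x) = psi_T h (T (d i) x)" for i
        using psi_T_T[OF d[of i], of h x] psi_T_T[OF h(1), of "d i" x] d[of i] h(1) by (simp add: add.commute)
      define a where "a i = S (psi_T (d i) (x - T h x))" for i
      define b where "b = S (psi_T h (T (d i) x - T (d j) x))"
      have eq: "S (psi_T (d i) x) - S (psi_T (d j) x) = a i - a j + b"
        by (simp add: a_def b_def psi_T_diff[OF d] psi_T_diff[OF h(1)] swap blinfun.diff_right)
      have "norm (a i) \<le> norm_bound * e'" for i
        unfolding a_def using norm_S_psi_T_le[OF d] mult_left_mono[OF h(2) norm_bound_nonneg] by (rule order_trans)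
      moreover have "norm b \<le> norm_bound * e'"
        unfolding b_def using norm_S_psi_T_le[OF h(1)] mult_left_mono[OF less_imp_le[OF n0[OF ij]] norm_bound_nonneg] by (rule order_trans)
      moreover have "norm (a i - a j + b) \<le> norm (a i) + norm (a j) + norm b"
        using norm_triangle_ineq[of "a i - a j" b] norm_triangle_ineq4[of "a i" "a j"] by linarith
      ultimately have "norm (a i - a j + b) \<le> norm_bound * e' + norm_bound * e' + norm_bound * e'"
        by (meson add_mono order_trans)
      then show "dist (S (psi_T (d i) x)) (S (psi_T (d j) x)) < e"
        unfolding dist_norm eq using e'(2) by linarith
    qed
  qed
  then show ?thesis unfolding d_def by (rule Cauchy_convergent)
qed

definition psi_S :: "'a \<Rightarrow> 'a" where
  "psi_S x = lim (\<lambda>n. S (psi_T (inverse (real (Suc n))) x))"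

lemma psi_S_lim: "(\<lambda>n. S (psi_T (inverse (real (Suc n))) x)) \<longlonglongrightarrow> psi_S x"
  using S_psi_T_convergent[of x] by (simp add: psi_S_def convergent_LIMSEQ_iff)

lemma norm_psi_S_le: "norm (psi_S x) \<le> norm_bound * norm x"
  by (rule LIMSEQ_le_const2[OF tendsto_norm[OF psi_S_lim]]) (auto intro!: norm_S_psi_T_le)

lemma bounded_linear_psi_S: "bounded_linear psi_S"
proof (rule bounded_linear_intro[where K=norm_bound])
  fix x y c
  show "psi_S (x + y) = psi_S x + psi_S y"
    by (rule LIMSEQ_unique[OF psi_S_lim]) (use tendsto_add[OF psi_S_lim[of x] psi_S_lim[of y]] in \<open>simp add: psi_T_add blinfun.add_right\<close>)
  show "psi_S (c *\<^sub>R x) = c *\<^sub>R psi_S x"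
    by (rule LIMSEQ_unique[OF psi_S_lim]) (use tendsto_scaleR[OF tendsto_const psi_S_lim[of x], of c] in \<open>simp add: psi_T_scaleR blinfun.scaleR_right\<close>)
  show "norm (psi_S x) \<le> norm x * norm_bound" using norm_psi_S_le[of x] by (simp add: mult.commute)
qed

text \<open>The identity for \<open>R psi_T\<close> passes to the limit, as \<open>R\<close> and \<open>S\<close> are bounded and commute.\<close>

lemma R_psi_S: "R (psi_S x) = S (hp_calculus T (\<lambda>z. \<psi> z / (1 + z)) x) - at_zero \<psi> *\<^sub>R S (R x)"
proof -
  let ?d = "\<lambda>n. inverse (real (Suc n))"
  let ?H = "hp_calculus T (\<lambda>z. \<psi> z / (1 + z))"
  note dlim = T_inverse_Suc_tendsto[of x]
  have tendsto_apply: "(\<lambda>n. blinfun_apply B (f n)) \<longlonglongrightarrow> B y" if "f \<longlonglongrightarrow> y" for B and f :: "nat \<Rightarrow> 'a" and y :: 'a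
    by (rule bounded_linear.tendsto[OF blinfun.bounded_linear_right that])
  have "R (S (psi_T (?d n) x)) = S (?H (T (?d n) x)) - at_zero \<psi> *\<^sub>R S (R (T (?d n) x))" for n
  proof -
    have "R (S (psi_T (?d n) x)) = S (R (psi_T (?d n) x))" by (rule average_commute[OF halfline_exp(1) halfline_\<mu>])
    also have "R (psi_T (?d n) x) = ?H (T (?d n) x) - at_zero \<psi> *\<^sub>R R (T (?d n) x)" by (rule R_psi_T) simp
    finally show ?thesis by (simp add: blinfun.diff_right blinfun.scaleR_right)
  qed
  moreover have "(\<lambda>n. S (?H (T (?d n) x)) - at_zero \<psi> *\<^sub>R S (R (T (?d n) x))) \<longlonglongrightarrow> S (?H x) - at_zero \<psi> *\<^sub>R S (R x)"
    by (rule tendsto_diff[OF tendsto_apply[OF tendsto_apply[OF dlim]]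
          tendsto_scaleR[OF tendsto_const tendsto_apply[OF tendsto_apply[OF dlim]]]])
  ultimately have "(\<lambda>n. R (S (psi_T (?d n) x))) \<longlonglongrightarrow> S (?H x) - at_zero \<psi> *\<^sub>R S (R x)"
    by (simp only:)
  with tendsto_apply[OF psi_S_lim] show ?thesis by (rule LIMSEQ_unique)
qed

text \<open>For \<open>B = \<psi>(0) S + (\<psi>(A) - \<psi>(0)) S\<close> the previous identity reads \<open>R (B x) = H (S x)\<close>, with \<open>H\<close> the operator assigned to
  \<open>\<psi>(z) / (1 + z)\<close>. This puts \<open>S x\<close> in the domain of \<open>\<psi>(A)\<close>, with value \<open>B x\<close>.\<close>

lemma bop_subordinate_bernstein_op:
  "\<exists>B. bop S O bernstein_op T \<psi> = bop B \<and> norm B \<le> at_zero \<psi> * norm S + norm_bound"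
proof -
  let ?H = "hp_calculus T (\<lambda>z. \<psi> z / (1 + z))"
  define B where "B = at_zero \<psi> *\<^sub>R S + Blinfun psi_S"
  have B: "B x = at_zero \<psi> *\<^sub>R S x + psi_S x" for x
    by (simp add: B_def blinfun.add_left blinfun.scaleR_left bounded_linear_Blinfun_apply[OF bounded_linear_psi_S])
  have RB: "R (B x) = ?H (S x)" for x
    by (simp add: B blinfun.add_right blinfun.scaleR_right R_psi_S average_commute[OF halfline_exp(1) halfline_\<mu>]
        average_hp_calculus_commute[OF \<psi> halfline_\<mu>])
  have "bop S O bernstein_op T \<psi> = bop B"
    using in_bernstein_op[OF RB] by (auto simp: bop_def)
  moreover have "norm B \<le> at_zero \<psi> * norm S + norm_bound"
  proof (rule norm_blinfun_bound)
    show "0 \<le> at_zero \<psi> * norm S + norm_bound" using bernstein_at_zero(2)[OF \<psi>] norm_bound_nonneg by simp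
    fix x
    have "norm (B x) \<le> at_zero \<psi> * norm (S x) + norm (psi_S x)"
      unfolding B using norm_triangle_ineq[of "at_zero \<psi> *\<^sub>R S x" "psi_S x"] bernstein_at_zero(2)[OF \<psi>] by simp
    also have "\<dots> \<le> at_zero \<psi> * (norm S * norm x) + norm_bound * norm x"
      by (intro add_mono mult_left_mono norm_blinfun norm_psi_S_le bernstein_at_zero(2)[OF \<psi>])
    finally show "norm (B x) \<le> (at_zero \<psi> * norm S + norm_bound) * norm x" by (simp add: algebra_simps)
  qed
  ultimately show ?thesis by blast
qed

end

theorem corollary3p3:
  fixes T :: "real \<Rightarrow> ('a::banach \<Rightarrow>\<^sub>L 'a)"
    and \<psi> \<phi> :: "real \<Rightarrow> real" and c\<^sub>0 c\<^sub>1 t :: real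
  assumes "bernstein \<psi>" and "bernstein \<phi>"
    and "\<And>r. r > 0 \<Longrightarrow> J_int (\<lambda>s. exp (- r * \<phi> s)) \<psi> < \<infinity>"
    and "bounded_C0_semigroup T"
    and "c\<^sub>0 \<ge> 0" and "c\<^sub>1 > 0" and "yosida T c\<^sub>0 c\<^sub>1"
    and "t > 0"
  shows "\<exists>B. bop (subordinate T \<phi> t) O bernstein_op T \<psi> = bop B \<and>
    ennreal (norm B) \<le>
      ennreal (at_zero \<psi> * norm (subordinate T \<phi> t))
      + ennreal (2 * max (2 * sup_norm T) c\<^sub>1) * J_int (\<lambda>s. exp (- t * \<phi> s)) \<psi>
      + ennreal (4 * sup_norm T * exp (- t * at_zero \<phi>)) * C_int c\<^sub>0 \<psi>"
proof -
  obtain \<rho> where "increment_measure \<psi> \<rho>" by (rule increment_measure_exists[OF assms(1)])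
  then interpret subordinated_yosida_semigroup T c\<^sub>0 c\<^sub>1 \<psi> \<phi> \<rho> t
    using assms by unfold_locales auto
  obtain B where B: "bop S O bernstein_op T \<psi> = bop B" "norm B \<le> at_zero \<psi> * norm S + norm_bound"
    using bop_subordinate_bernstein_op by blast
  have "ennreal (norm B) \<le> ennreal (at_zero \<psi> * norm S) + ennreal norm_bound"
    using ennreal_leI[OF B(2)] bernstein_at_zero(2)[OF \<psi>] norm_bound_nonneg by simp
  also have "\<dots> \<le> ennreal (at_zero \<psi> * norm S) + (ennreal (2 * max_const) * J_int (\<lambda>s. exp (- t * \<phi> s)) \<psi>
      + ennreal (4 * M * exp (- t * at_zero \<phi>)) * C_int c\<^sub>0 \<psi>)"
    unfolding ennreal_norm_bound norm_bound_enn_def by (intro add_left_mono mult_left_mono weight_int_le) auto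
  finally show ?thesis
    using B(1) by (auto simp: subordinate_def max_const_def add.assoc)
qed

end
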